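(* Let $\Omega=\mathbb{R}$ or $\Omega=\mathbb{T}$, $N\in\mathbb{N}$, $T>0$, and let $g,G,L,V$ satisfy the assumptions listed in the context. For $x<y$ and $u\in\mathbb{R}$ set $$I(x,y,u)=L(u)+G\Big(\frac{1/N}{y-x}\Big),$$ and suppose that there are $q\in(1,\infty)$, $\alpha>0$ and $\beta\ge0$ such that $I(x,y,u)\ge\alpha|u|^q-\beta$ for all $x<y$ and all $u\in\mathbb{R}$. Let $\mathbf{x}^0,\mathbf{x}^T\in\mathcal{K}^N$ have pairwise non-touching particles (that is, $x_{i-1}<x_i$ for all $1\le i\le N$). Then there exists a unique solution $(\mathbf{x},\mathbf{u})\in C^1([0,T];\mathcal{K}^N)\times L^\infty([0,T];\mathbb{R}^N)$, with $\dot{\mathbf{x}}=\mathbf{u}$, of the $N$-particle variational problem with data $\mathbf{x}(0)=\mathbf{x}^0$, $\mathbf{x}(T)=\mathbf{x}^T$ described in the context.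
   Context: Standing assumptions. $g\in C^1([0,\infty))$ is real-valued and non-decreasing, with $r\mapsto r g'(r)$ locally integrable near $0$. $G:(0,\infty)\to\mathbb{R}$ is a $C^1$ function (determined up to a constant) with $G'(r)=\frac{1}{r^2}\int_0^r s g'(s)\,ds$, extended continuously to $r=0$; $G$ is assumed convex. $V\in C^1(\Omega\times[0,T];\mathbb{R})$ and $x\mapsto V(x,t)$ is concave for every $t\in[0,T]$ (if $\Omega=\mathbb{T}=\mathbb{R}/\mathbb{Z}$, this means that $V(\cdot,t)$ is constant). $L:\mathbb{R}\to\mathbb{R}$ is continuous, bounded below and uniformly convex: there is $\theta>0$ with $L(\lambda u+(1-\lambda)v)\le \lambda L(u)+(1-\lambda)L(v)-\theta\lambda(1-\lambda)(u-v)^2$ for all $u,v\in\mathbb{R}$, $\lambda\in[0,1]$. Configuration space. If $\Omega=\mathbb{R}$, $\mathcal{K}^N=\{(x_1,\dots,x_N)\in\mathbb{R}^N:x_1\le\dots\le x_N\}$ and $x_0=-\infty$ (so the $i=1$ term below is $G(0)$). If $\Omega=\mathbb{T}$, positions are represented by ordered lifts in $\mathbb{R}$: $\mathcal{K}^N=\{(x_1,\dots,x_N)\in\mathbb{R}^N:x_1\le\dots\le x_N\le x_1+1\}$ and $x_0=x_N-1$. The $N$-particle variational problem. Given $\mathbf{x}^0,\mathbf{x}^T\in\mathcal{K}^N$, minimize $$\widetilde{\mathcal J}(\mathbf{x},\dot{\mathbf{x}})=\frac1N\sum_{i=1}^N\int_0^T\Big[L(\dot x_i(s))+G\Big(\frac{1/N}{x_i(s)-x_{i-1}(s)}\Big)-V(x_i(s),s)\Big]ds$$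 among absolutely continuous $\mathbf{x}:[0,T]\to\mathcal{K}^N$ with $\mathbf{x}(0)=\mathbf{x}^0$, $\mathbf{x}(T)=\mathbf{x}^T$. When $x_i(s)=x_{i-1}(s)$, the $G$-term is interpreted as $\lim_{r\to\infty}G(r)\in(-\infty,+\infty]$. A solution is a pair $(\mathbf{x},\dot{\mathbf{x}})$ with $\mathbf{x}$ a minimizer. *)

theory Defs
  imports "HOL-Analysis.Analysis"
begin

text \<open>
  The spatial domain is either the real line or the torus \<open>\<real>/\<int>\<close>.  On the torus, positions are
  represented by ordered lifts in \<open>\<real>\<close> and functions of the position by functions on \<open>\<real>\<close>.
  A configuration is a function \<open>nat \<Rightarrow> real\<close> of which only the values at \<open>1, \<dots>, N\<close> are relevant;
  a trajectory is a function of time with values in the configurations.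
\<close>

datatype spatial_domain = Real_Line | Torus


subsection \<open>Regularity classes\<close>

text \<open>
  Derivatives are taken relative to the set, so they are one-sided at boundary points; the sets
  in question, \<open>{0..T}\<close>, \<open>{0..}\<close>, \<open>{0<..}\<close> and \<open>UNIV \<times> {0..T}\<close>, are such that the derivative is
  unique.  The library notion \<open>C1_differentiable_on\<close> asks for two-sided derivatives instead.
\<close>

definition C1_on :: "'a::real_normed_vector set \<Rightarrow> ('a \<Rightarrow> 'b::real_normed_vector) \<Rightarrow> bool" where
  "C1_on S f \<longleftrightarrow>
     (\<exists>D :: 'a \<Rightarrow> 'a \<Rightarrow>\<^sub>L 'b.
        (\<forall>z\<in>S. (f has_derivative blinfun_apply (D z)) (at z within S)) \<and> continuous_on S D)"

definition absolutely_continuous_on :: "real set \<Rightarrow> (real \<Rightarrow> real) \<Rightarrow> bool" where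
  "absolutely_continuous_on S f \<longleftrightarrow>
     (\<forall>\<epsilon>>0. \<exists>\<delta>>0. \<forall>(n::nat) l r.
        (\<forall>k<n. l k \<le> r k \<and> {l k..r k} \<subseteq> S) \<longrightarrow>
        disjoint_family_on (\<lambda>k. {l k<..<r k}) {..<n} \<longrightarrow>
        (\<Sum>k<n. r k - l k) < \<delta> \<longrightarrow>
        (\<Sum>k<n. \<bar>f (r k) - f (l k)\<bar>) < \<epsilon>)"

definition C1_trajectory :: "nat \<Rightarrow> real \<Rightarrow> (real \<Rightarrow> nat \<Rightarrow> real) \<Rightarrow> bool" where
  "C1_trajectory N T x \<longleftrightarrow> (\<forall>i\<in>{1..N}. C1_on {0..T} (\<lambda>t. x t i))"

definition Linfty_trajectory :: "nat \<Rightarrow> real \<Rightarrow> (real \<Rightarrow> nat \<Rightarrow> real) \<Rightarrow> bool" where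
  "Linfty_trajectory N T u \<longleftrightarrow>
     (\<forall>i\<in>{1..N}. (\<lambda>t. u t i) \<in> borel_measurable (lebesgue_on {0..T}) \<and>
        (\<exists>C. AE t in lebesgue_on {0..T}. \<bar>u t i\<bar> \<le> C))"


subsection \<open>Hypotheses on the data\<close>

abbreviation half_line_deriv :: "(real \<Rightarrow> real) \<Rightarrow> real \<Rightarrow> real" where
  "half_line_deriv g r \<equiv> vector_derivative g (at r within {0..})"

definition admissible_coupling :: "(real \<Rightarrow> real) \<Rightarrow> bool" where
  "admissible_coupling g \<longleftrightarrow>
     C1_on {0..} g \<and> mono_on {0..} g \<and>
     (\<exists>\<delta>>0. set_integrable lborel {0..\<delta>} (\<lambda>r. r * half_line_deriv g r))"

definition is_interaction_energy :: "(real \<Rightarrow> real) \<Rightarrow> (real \<Rightarrow> real) \<Rightarrow> bool" where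
  "is_interaction_energy g G \<longleftrightarrow>
     C1_on {0<..} G \<and>
     (\<forall>r>0. (G has_real_derivative
        (1 / r\<^sup>2 * (LINT s:{0..r}|lborel. s * half_line_deriv g s))) (at r)) \<and>
     continuous_on {0..} G"

definition admissible_potential ::
    "spatial_domain \<Rightarrow> real \<Rightarrow> (real \<Rightarrow> real \<Rightarrow> real) \<Rightarrow> bool" where
  "admissible_potential \<Omega> T V \<longleftrightarrow>
     C1_on (UNIV \<times> {0..T}) (\<lambda>(x, t). V x t) \<and>
     (\<forall>t\<in>{0..T}. case \<Omega> of
        Real_Line \<Rightarrow> concave_on UNIV (\<lambda>x. V x t)
      | Torus \<Rightarrow> (\<lambda>x. V x t) constant_on UNIV)"

definition uniformly_convex :: "(real \<Rightarrow> real) \<Rightarrow> bool" where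
  "uniformly_convex L \<longleftrightarrow>
     (\<exists>\<theta>>0. \<forall>u v. \<forall>c\<in>{0..1}.
        L (c * u + (1 - c) * v)
          \<le> c * L u + (1 - c) * L v - \<theta> * c * (1 - c) * (u - v)\<^sup>2)"

definition admissible_lagrangian :: "(real \<Rightarrow> real) \<Rightarrow> bool" where
  "admissible_lagrangian L \<longleftrightarrow>
     continuous_on UNIV L \<and> bdd_below (range L) \<and> uniformly_convex L"

definition pair_cost ::
    "nat \<Rightarrow> (real \<Rightarrow> real) \<Rightarrow> (real \<Rightarrow> real) \<Rightarrow> real \<Rightarrow> real \<Rightarrow> real \<Rightarrow> real" where
  "pair_cost N L G x y u = L u + G ((1 / real N) / (y - x))"


subsection \<open>Configurations\<close>

definition configurations :: "spatial_domain \<Rightarrow> nat \<Rightarrow> (nat \<Rightarrow> real) set" where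
  "configurations \<Omega> N =
     {x. mono_on {1..N} x \<and> (\<Omega> = Torus \<longrightarrow> x N \<le> x 1 + 1)}"

text \<open>The position \<open>x\<^bsub>i-1\<^esub>\<close>, with the conventions for \<open>x\<^sub>0\<close>.\<close>

definition left_neighbour :: "spatial_domain \<Rightarrow> nat \<Rightarrow> (nat \<Rightarrow> real) \<Rightarrow> nat \<Rightarrow> ereal" where
  "left_neighbour \<Omega> N x i =
     (if i = 1 then (case \<Omega> of Real_Line \<Rightarrow> -\<infinity> | Torus \<Rightarrow> ereal (x N - 1))
      else ereal (x (i - 1)))"

definition non_touching :: "spatial_domain \<Rightarrow> nat \<Rightarrow> (nat \<Rightarrow> real) \<Rightarrow> bool" where
  "non_touching \<Omega> N x \<longleftrightarrow> (\<forall>i\<in>{1..N}. left_neighbour \<Omega> N x i < ereal (x i))"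


subsection \<open>The variational problem\<close>

definition extend_at_infinity :: "(real \<Rightarrow> real) \<Rightarrow> ereal \<Rightarrow> ereal" where
  "extend_at_infinity G r =
     (if r = \<infinity> then Lim at_top (\<lambda>\<rho>. ereal (G \<rho>)) else ereal (G (real_of_ereal r)))"

text \<open>
  In \<open>ereal\<close>, division satisfies \<open>a / \<infinity> = 0\<close> for real \<open>a\<close> and \<open>a / 0 = \<infinity>\<close> for \<open>a > 0\<close>.  Hence the
  interaction term below is \<open>G 0\<close> when the left neighbour is at \<open>-\<infinity>\<close>, and the limit of \<open>G\<close> at
  infinity when the particle touches its left neighbour.
\<close>

definition running_cost ::
    "spatial_domain \<Rightarrow> nat \<Rightarrow> (real \<Rightarrow> real) \<Rightarrow> (real \<Rightarrow> real) \<Rightarrow> (real \<Rightarrow> real \<Rightarrow> real) \<Rightarrow>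
     (real \<Rightarrow> nat \<Rightarrow> real) \<Rightarrow> (real \<Rightarrow> nat \<Rightarrow> real) \<Rightarrow> nat \<Rightarrow> real \<Rightarrow> ereal" where
  "running_cost \<Omega> N L G V x u i s =
     ereal (L (u s i))
     + extend_at_infinity G (ereal (1 / real N) / (ereal (x s i) - left_neighbour \<Omega> N (x s) i))
     - ereal (V (x s i) s)"

text \<open>
  Lebesgue integral of an extended-real function whose negative part has finite integral, with
  values in \<open>(-\<infinity>, \<infinity>]\<close>.  Since \<open>e2ennreal\<close> truncates negative numbers to \<open>0\<close>, the two terms are
  the integrals of the positive and of the negative part.  The measure is the completed one,
  because an almost everywhere defined derivative is only Lebesgue measurable.
\<close>

definition extended_integral :: "'a measure \<Rightarrow> ('a \<Rightarrow> ereal) \<Rightarrow> ereal" where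
  "extended_integral M f =
     enn2ereal (\<integral>\<^sup>+ s. e2ennreal (f s) \<partial>M) - enn2ereal (\<integral>\<^sup>+ s. e2ennreal (- f s) \<partial>M)"

definition action ::
    "spatial_domain \<Rightarrow> nat \<Rightarrow> real \<Rightarrow> (real \<Rightarrow> real) \<Rightarrow> (real \<Rightarrow> real) \<Rightarrow> (real \<Rightarrow> real \<Rightarrow> real) \<Rightarrow>
     (real \<Rightarrow> nat \<Rightarrow> real) \<Rightarrow> (real \<Rightarrow> nat \<Rightarrow> real) \<Rightarrow> ereal" where
  "action \<Omega> N T L G V x u =
     ereal (1 / real N) *
       (\<Sum>i=1..N. extended_integral (lebesgue_on {0..T}) (running_cost \<Omega> N L G V x u i))"

definition velocity :: "(real \<Rightarrow> nat \<Rightarrow> real) \<Rightarrow> real \<Rightarrow> nat \<Rightarrow> real" where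
  "velocity x t i = deriv (\<lambda>s. x s i) t"

definition admissible_trajectories ::
    "spatial_domain \<Rightarrow> nat \<Rightarrow> real \<Rightarrow> (nat \<Rightarrow> real) \<Rightarrow> (nat \<Rightarrow> real) \<Rightarrow>
     (real \<Rightarrow> nat \<Rightarrow> real) set" where
  "admissible_trajectories \<Omega> N T x0 xT =
     {x. (\<forall>t\<in>{0..T}. x t \<in> configurations \<Omega> N) \<and>
         (\<forall>i\<in>{1..N}. absolutely_continuous_on {0..T} (\<lambda>t. x t i)) \<and>
         (\<forall>i\<in>{1..N}. x 0 i = x0 i \<and> x T i = xT i)}"

definition is_minimizer ::
    "spatial_domain \<Rightarrow> nat \<Rightarrow> real \<Rightarrow> (real \<Rightarrow> real) \<Rightarrow> (real \<Rightarrow> real) \<Rightarrow> (real \<Rightarrow> real \<Rightarrow> real) \<Rightarrow>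
     (nat \<Rightarrow> real) \<Rightarrow> (nat \<Rightarrow> real) \<Rightarrow> (real \<Rightarrow> nat \<Rightarrow> real) \<Rightarrow> bool" where
  "is_minimizer \<Omega> N T L G V x0 xT x \<longleftrightarrow>
     x \<in> admissible_trajectories \<Omega> N T x0 xT \<and>
     (\<forall>y\<in>admissible_trajectories \<Omega> N T x0 xT.
        action \<Omega> N T L G V x (velocity x) \<le> action \<Omega> N T L G V y (velocity y))"

text \<open>
  The second component of a solution is a representative of the almost everywhere defined
  derivative of the first one.
\<close>

definition is_solution ::
    "spatial_domain \<Rightarrow> nat \<Rightarrow> real \<Rightarrow> (real \<Rightarrow> real) \<Rightarrow> (real \<Rightarrow> real) \<Rightarrow> (real \<Rightarrow> real \<Rightarrow> real) \<Rightarrow>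
     (nat \<Rightarrow> real) \<Rightarrow> (nat \<Rightarrow> real) \<Rightarrow>
     (real \<Rightarrow> nat \<Rightarrow> real) \<Rightarrow> (real \<Rightarrow> nat \<Rightarrow> real) \<Rightarrow> bool" where
  "is_solution \<Omega> N T L G V x0 xT x u \<longleftrightarrow>
     is_minimizer \<Omega> N T L G V x0 xT x \<and>
     (AE t in lebesgue_on {0..T}. \<forall>i\<in>{1..N}. ((\<lambda>s. x s i) has_real_derivative u t i) (at t))"

end

theory Submission
  imports Defs "HOL-Real_Asymp.Real_Asymp"
begin

text \<open>
  The velocities of a minimizer are \<open>x' = (\<partial>L)\<^sup>-\<^sup>1(p)\<close>, where the momenta \<open>p\<close> integrate the forces, so a
  \<open>C\<^sup>1\<close> minimizer is a solution of a two-point boundary value problem.  For such a solution, minimality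
  and uniqueness among all absolutely continuous competitors follow from convexity by one integration
  by parts; the uniform convexity of \<open>L\<close> controls the difference of the velocities.

  The boundary value problem is solved for an interaction that is continued by its tangent below a small
  gap \<open>\<epsilon>\<close>, with velocities bounded by \<open>R\<close>.  A minimizing sequence of continuous velocities is Cauchy
  by uniform convexity, and it stays close to the solutions of the problems linearized along it, so the
  limit solves the boundary value problem.  Comparison with straight lines bounds the velocities and the
  time integral of the forces independently of \<open>R\<close> and \<open>\<epsilon>\<close>; hence the velocity bound is inactive.
  If \<open>G\<close> is not constant, the force at distance \<open>d\<close> is at least of order \<open>d\<^sup>-\<^sup>2\<close>, so the gaps stay
  above \<open>\<epsilon>\<close> for small \<open>\<epsilon>\<close>.  If \<open>G\<close> is constant, the particles are independent and their order is
  preserved because \<open>\<partial>\<^sub>xV\<close> is nonincreasing in \<open>x\<close>.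
\<close>

subsection \<open>Absolutely continuous functions\<close>

text \<open>\<open>L\<close> is uniformly convex but possibly not differentiable, so the
  Euler-Lagrange equation is used in momentum form: \<open>strong_minimizer\<close> stands for
  \<open>p \<in> \<partial>L(v)\<close>, and uniform convexity makes \<open>v\<close> a Lipschitz
  function of \<open>p\<close>. Regularity of minimizers is not proved directly: a C1 orbit is
  constructed, and every minimizer is shown to coincide with it. Competitors are merely absolutely
  continuous with velocity \<open>deriv\<close>, which calls for the fundamental theorem of calculus
  and integration by parts in that class.

  A convex minorant that agrees with it along the orbit is enough, because the optimality estimate
  uses the interaction from below at competitors and exactly at the orbit. The a priori constants
  see the interaction only through a lower bound and a bound for its value at distance
  \<open>\<delta> / 2\<close>; so \<open>\<epsilon>\<close> can be chosen after them, without
  circularity.\<close>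

definition interval_system ::
    "real \<Rightarrow> real \<Rightarrow> 'k set \<Rightarrow> ('k \<Rightarrow> real) \<Rightarrow> ('k \<Rightarrow> real) \<Rightarrow> bool" where
  "interval_system a b A l r \<longleftrightarrow>
     finite A \<and> (\<forall>k\<in>A. a \<le> l k \<and> l k \<le> r k \<and> r k \<le> b) \<and>
     disjoint_family_on (\<lambda>k. {l k<..<r k}) A"

text \<open>The intervals need not cover \<open>{s..t}\<close>. Hence the empty system contributes
  \<open>0\<close>, a system can be cut at a point, and an interval can be appended, all without
  refining partitions.\<close>

definition variation_sums :: "(real \<Rightarrow> real) \<Rightarrow> real \<Rightarrow> real \<Rightarrow> real set" where
  "variation_sums f s t =
     {\<Sum>k\<in>A. \<bar>f (r k) - f (l k)\<bar> |A l r. interval_system s t (A :: nat set) l r}"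

definition variation :: "(real \<Rightarrow> real) \<Rightarrow> real \<Rightarrow> real \<Rightarrow> real" where
  "variation f s t = Sup (variation_sums f s t)"

lemma interval_systemI:
  assumes "finite A" "\<And>k. k \<in> A \<Longrightarrow> a \<le> l k \<and> l k \<le> r k \<and> r k \<le> b"
    "\<And>j k. j \<in> A \<Longrightarrow> k \<in> A \<Longrightarrow> j \<noteq> k \<Longrightarrow> {l j<..<r j} \<inter> {l k<..<r k} = {}"
  shows "interval_system a b A l r"
  using assms by (auto simp: interval_system_def disjoint_family_on_def)

lemma interval_systemD:
  assumes "interval_system a b A l r"
  shows "finite A" "\<And>k. k \<in> A \<Longrightarrow> a \<le> l k" "\<And>k. k \<in> A \<Longrightarrow> l k \<le> r k"
    "\<And>k. k \<in> A \<Longrightarrow> r k \<le> b"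
    "\<And>j k. j \<in> A \<Longrightarrow> k \<in> A \<Longrightarrow> j \<noteq> k \<Longrightarrow> {l j<..<r j} \<inter> {l k<..<r k} = {}"
  using assms by (auto simp: interval_system_def disjoint_family_on_def)

lemma interval_system_mono:
  "interval_system a b A l r \<Longrightarrow> c \<le> a \<Longrightarrow> b \<le> d \<Longrightarrow> interval_system c d A l r"
  by (force simp: interval_system_def)

text \<open>Intervals beyond \<open>s\<close> become degenerate instead of being removed. The index
  set is unchanged, so in \<open>variation_sums_split\<close> a sum is compared termwise with its
  two halves.\<close>

lemma interval_system_min:
  assumes "interval_system a t A l r" "a \<le> s"
  shows "interval_system a s A (\<lambda>k. min (l k) s) (\<lambda>k. min (r k) s)"
proof (rule interval_systemI)
  note D = interval_systemD[OF assms(1)]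
  show "finite A" by (rule D)
  show "a \<le> min (l k) s \<and> min (l k) s \<le> min (r k) s \<and> min (r k) s \<le> s" if "k \<in> A" for k
    using D(2-4)[OF that] assms(2) by auto
  show "{min (l j) s<..<min (r j) s} \<inter> {min (l k) s<..<min (r k) s} = {}"
    if "j \<in> A" "k \<in> A" "j \<noteq> k" for j k
  proof -
    have "{min (l m) s<..<min (r m) s} \<subseteq> {l m<..<r m}" for m by auto
    then show ?thesis using D(5)[OF that] by blast
  qed
qed

lemma interval_system_max:
  assumes "interval_system a t A l r" "s \<le> t"
  shows "interval_system s t A (\<lambda>k. max (l k) s) (\<lambda>k. max (r k) s)"
proof (rule interval_systemI)
  note D = interval_systemD[OF assms(1)]
  show "finite A" by (rule D)
  show "s \<le> max (l k) s \<and> max (l k) s \<le> max (r k) s \<and> max (r k) s \<le> t" if "k \<in> A" for k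
    using D(2-4)[OF that] assms(2) by auto
  show "{max (l j) s<..<max (r j) s} \<inter> {max (l k) s<..<max (r k) s} = {}"
    if "j \<in> A" "k \<in> A" "j \<noteq> k" for j k
  proof -
    have "{max (l m) s<..<max (r m) s} \<subseteq> {l m<..<r m}" for m by auto
    then show ?thesis using D(5)[OF that] by blast
  qed
qed

text \<open>Disjointness of the open intervals turns the sum of lengths into the Lebesgue measure of
  a union inside \<open>{a..b}\<close>.\<close>

lemma sum_interval_system_le:
  assumes "interval_system a b A l r" "a \<le> b"
  shows "(\<Sum>k\<in>A. r k - l k) \<le> b - a"
proof -
  note D = interval_systemD[OF assms(1)]
  have "(\<Sum>k\<in>A. r k - l k) = (\<Sum>k\<in>A. measure lborel {l k<..<r k})"
    using D(3) by (intro sum.cong) auto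
  also have "\<dots> = measure lborel (\<Union>k\<in>A. {l k<..<r k})"
    using assms(1) D(1)
    by (intro measure_finite_Union[symmetric])
      (auto simp: interval_system_def emeasure_lborel_box_finite[unfolded box_real] less_top[symmetric])
  also have "\<dots> \<le> measure lborel {a..b}"
  proof (rule measure_mono_fmeasurable)
    show "(\<Union>k\<in>A. {l k<..<r k}) \<subseteq> {a..b}" using D(2,4) by force
    show "(\<Union>k\<in>A. {l k<..<r k}) \<in> sets lborel" using D(1) by (intro sets.finite_UN) auto
    show "{a..b} \<in> fmeasurable lborel" using fmeasurable_cbox[of a b] by simp
  qed
  finally show ?thesis using assms(2) by simp
qed

text \<open>The definition of absolute continuity indexes the intervals by an initial segment of the
  natural numbers; double families of intervals need an arbitrary finite index set.\<close>

lemma absolutely_continuous_on_system: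
  assumes "absolutely_continuous_on {a..b} f" "\<epsilon> > 0"
  obtains \<delta> where "\<delta> > 0"
    "\<And>(A :: 'k set) l r. interval_system a b A l r \<Longrightarrow> (\<Sum>k\<in>A. r k - l k) < \<delta> \<Longrightarrow>
       (\<Sum>k\<in>A. \<bar>f (r k) - f (l k)\<bar>) < \<epsilon>"
proof -
  obtain \<delta> where \<delta>: "\<delta> > 0"
    "\<And>(n::nat) l r. (\<forall>k<n. l k \<le> r k \<and> {l k..r k} \<subseteq> {a..b}) \<Longrightarrow>
        disjoint_family_on (\<lambda>k. {l k<..<r k}) {..<n} \<Longrightarrow>
        (\<Sum>k<n. r k - l k) < \<delta> \<Longrightarrow>
        (\<Sum>k<n. \<bar>f (r k) - f (l k)\<bar>) < \<epsilon>"
    using assms unfolding absolutely_continuous_on_def by blast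
  have "(\<Sum>k\<in>A. \<bar>f (r k) - f (l k)\<bar>) < \<epsilon>"
    if S: "interval_system a b A l r" and len: "(\<Sum>k\<in>A. r k - l k) < \<delta>" for A :: "'k set" and l r
  proof -
    note D = interval_systemD[OF S]
    obtain h where h: "bij_betw h {..<card A} A"
      using ex_bij_betw_nat_finite[OF D(1)] atLeast0LessThan by auto
    have mem: "h k \<in> A" if "k < card A" for k
      using h that by (auto simp: bij_betw_def)
    have "(\<Sum>k<card A. \<bar>f ((r \<circ> h) k) - f ((l \<circ> h) k)\<bar>) < \<epsilon>"
    proof (rule \<delta>(2))
      show "\<forall>k<card A. (l \<circ> h) k \<le> (r \<circ> h) k \<and> {(l \<circ> h) k..(r \<circ> h) k} \<subseteq> {a..b}"
        using D(2-4) mem by force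
      show "disjoint_family_on (\<lambda>k. {(l \<circ> h) k<..<(r \<circ> h) k}) {..<card A}"
        unfolding disjoint_family_on_def
      proof (intro ballI impI)
        fix j k assume jk: "j \<in> {..<card A}" "k \<in> {..<card A}" "j \<noteq> k"
        then have "h j \<noteq> h k" using h by (auto simp: bij_betw_def inj_on_def)
        then show "{(l \<circ> h) j<..<(r \<circ> h) j} \<inter> {(l \<circ> h) k<..<(r \<circ> h) k} = {}"
          using D(5)[of "h j" "h k"] mem jk by simp
      qed
      show "(\<Sum>k<card A. (r \<circ> h) k - (l \<circ> h) k) < \<delta>"
        using len sum.reindex_bij_betw[OF h, of "\<lambda>k. r k - l k"] by simp
    qed
    then show ?thesis
      using sum.reindex_bij_betw[OF h, of "\<lambda>k. \<bar>f (r k) - f (l k)\<bar>"] by simp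
  qed
  with \<delta>(1) show thesis by (rule that)
qed

lemma absolutely_continuous_on_systemI:
  assumes "\<And>\<epsilon>. \<epsilon> > 0 \<Longrightarrow> \<exists>\<delta>>0. \<forall>(A :: nat set) l r. interval_system a b A l r \<longrightarrow>
       (\<Sum>k\<in>A. r k - l k) < \<delta> \<longrightarrow> (\<Sum>k\<in>A. \<bar>f (r k) - f (l k)\<bar>) < \<epsilon>"
  shows "absolutely_continuous_on {a..b} f"
  unfolding absolutely_continuous_on_def
proof (intro allI impI)
  fix \<epsilon> :: real assume "\<epsilon> > 0"
  then obtain \<delta> where \<delta>: "\<delta> > 0" "\<And>(A :: nat set) l r. interval_system a b A l r \<Longrightarrow>
       (\<Sum>k\<in>A. r k - l k) < \<delta> \<Longrightarrow> (\<Sum>k\<in>A. \<bar>f (r k) - f (l k)\<bar>) < \<epsilon>"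
    using assms by blast
  have "interval_system a b {..<n} l r"
    if "\<forall>k<n. l k \<le> r k \<and> {l k..r k} \<subseteq> {a..b}" "disjoint_family_on (\<lambda>k. {l k<..<r k}) {..<n}"
    for n :: nat and l r
    using that by (auto simp: interval_system_def)
  then show "\<exists>\<delta>>0. \<forall>(n::nat) l r.
        (\<forall>k<n. l k \<le> r k \<and> {l k..r k} \<subseteq> {a..b}) \<longrightarrow>
        disjoint_family_on (\<lambda>k. {l k<..<r k}) {..<n} \<longrightarrow>
        (\<Sum>k<n. r k - l k) < \<delta> \<longrightarrow>
        (\<Sum>k<n. \<bar>f (r k) - f (l k)\<bar>) < \<epsilon>"
    using \<delta> by blast
qed

lemma absolutely_continuous_on_subinterval:
  assumes "absolutely_continuous_on {a..b} f" "a \<le> c" "d \<le> b"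
  shows "absolutely_continuous_on {c..d} f"
proof (rule absolutely_continuous_on_systemI)
  fix \<epsilon> :: real assume "\<epsilon> > 0"
  from absolutely_continuous_on_system[OF assms(1) this]
  obtain \<delta> where "\<delta> > 0" "\<And>(A :: nat set) l r. interval_system a b A l r \<Longrightarrow>
       (\<Sum>k\<in>A. r k - l k) < \<delta> \<Longrightarrow> (\<Sum>k\<in>A. \<bar>f (r k) - f (l k)\<bar>) < \<epsilon>"
    by metis
  then show "\<exists>\<delta>>0. \<forall>(A :: nat set) l r. interval_system c d A l r \<longrightarrow>
       (\<Sum>k\<in>A. r k - l k) < \<delta> \<longrightarrow> (\<Sum>k\<in>A. \<bar>f (r k) - f (l k)\<bar>) < \<epsilon>"
    using interval_system_mono assms(2,3) by blast
qed

lemma absolutely_continuous_on_continuous: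
  assumes "absolutely_continuous_on {a..b} f"
  shows "continuous_on {a..b} f"
  unfolding continuous_on_iff
proof (intro ballI allI impI)
  fix x e :: real assume x: "x \<in> {a..b}" and "e > 0"
  from absolutely_continuous_on_system[OF assms this(2)]
  obtain \<delta> where \<delta>: "\<delta> > 0" "\<And>(A :: nat set) l r. interval_system a b A l r \<Longrightarrow>
       (\<Sum>k\<in>A. r k - l k) < \<delta> \<Longrightarrow> (\<Sum>k\<in>A. \<bar>f (r k) - f (l k)\<bar>) < e"
    by metis
  have "dist (f y) (f x) < e" if "y \<in> {a..b}" "dist y x < \<delta>" for y
  proof -
    have "\<bar>f (max x y) - f (min x y)\<bar> < e"
      using \<delta>(2)[of "{0}" "\<lambda>_. min x y" "\<lambda>_. max x y"] that x
      by (auto simp: interval_system_def dist_real_def disjoint_family_on_def)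
    then show ?thesis by (auto simp: dist_real_def min_def max_def split: if_splits)
  qed
  then show "\<exists>d>0. \<forall>x'\<in>{a..b}. dist x' x < d \<longrightarrow> dist (f x') (f x) < e"
    using \<delta>(1) by blast
qed

lemma absolutely_continuous_on_diff:
  assumes "absolutely_continuous_on {a..b} f" "absolutely_continuous_on {a..b} g"
  shows "absolutely_continuous_on {a..b} (\<lambda>x. f x - g x)"
proof (rule absolutely_continuous_on_systemI)
  fix \<epsilon> :: real assume "\<epsilon> > 0"
  then have e2: "\<epsilon> / 2 > 0" by simp
  obtain \<delta>1 where \<delta>1: "\<delta>1 > 0" "\<And>(A :: nat set) l r. interval_system a b A l r \<Longrightarrow>
       (\<Sum>k\<in>A. r k - l k) < \<delta>1 \<Longrightarrow> (\<Sum>k\<in>A. \<bar>f (r k) - f (l k)\<bar>) < \<epsilon> / 2"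
    using absolutely_continuous_on_system[OF assms(1) e2] by metis
  obtain \<delta>2 where \<delta>2: "\<delta>2 > 0" "\<And>(A :: nat set) l r. interval_system a b A l r \<Longrightarrow>
       (\<Sum>k\<in>A. r k - l k) < \<delta>2 \<Longrightarrow> (\<Sum>k\<in>A. \<bar>g (r k) - g (l k)\<bar>) < \<epsilon> / 2"
    using absolutely_continuous_on_system[OF assms(2) e2] by metis
  have "(\<Sum>k\<in>A. \<bar>(f (r k) - g (r k)) - (f (l k) - g (l k))\<bar>) < \<epsilon>"
    if "interval_system a b A l r" "(\<Sum>k\<in>A. r k - l k) < min \<delta>1 \<delta>2" for A :: "nat set" and l r
  proof -
    have "(\<Sum>k\<in>A. \<bar>(f (r k) - g (r k)) - (f (l k) - g (l k))\<bar>)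
      \<le> (\<Sum>k\<in>A. \<bar>f (r k) - f (l k)\<bar> + \<bar>g (r k) - g (l k)\<bar>)"
      by (intro sum_mono) linarith
    also have "\<dots> < \<epsilon> / 2 + \<epsilon> / 2"
      unfolding sum.distrib using that by (intro add_strict_mono \<delta>1(2) \<delta>2(2)) auto
    finally show ?thesis by simp
  qed
  then show "\<exists>\<delta>>0. \<forall>(A :: nat set) l r. interval_system a b A l r \<longrightarrow>
       (\<Sum>k\<in>A. r k - l k) < \<delta> \<longrightarrow>
       (\<Sum>k\<in>A. \<bar>(f (r k) - g (r k)) - (f (l k) - g (l k))\<bar>) < \<epsilon>"
    using \<delta>1(1) \<delta>2(1) by (intro exI[of _ "min \<delta>1 \<delta>2"]) auto
qed

text \<open>In the integration by parts the Lipschitz factor is a C1 function, later a momentum.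
  With \<open>f = 1\<close> the lemma also shows that Lipschitz functions are absolutely
  continuous.\<close>

lemma absolutely_continuous_on_lipschitz_mult:
  assumes f: "absolutely_continuous_on {a..b} f" and ab: "a \<le> b"
    and p: "\<And>s t. s \<in> {a..b} \<Longrightarrow> t \<in> {a..b} \<Longrightarrow> \<bar>p t - p s\<bar> \<le> B * \<bar>t - s\<bar>"
  shows "absolutely_continuous_on {a..b} (\<lambda>x. p x * f x)"
proof (rule absolutely_continuous_on_systemI)
  fix \<epsilon> :: real assume \<epsilon>: "\<epsilon> > 0"
  have B: "\<bar>p t - p s\<bar> \<le> \<bar>B\<bar> * \<bar>t - s\<bar>" if "s \<in> {a..b}" "t \<in> {a..b}" for s t
    using p[OF that] mult_right_mono[of B "\<bar>B\<bar>" "\<bar>t - s\<bar>"] by linarith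
  define P where "P = \<bar>p a\<bar> + \<bar>B\<bar> * (b - a) + 1"
  have P: "\<bar>p t\<bar> \<le> P" if "t \<in> {a..b}" for t
  proof -
    have "\<bar>B\<bar> * \<bar>t - a\<bar> \<le> \<bar>B\<bar> * (b - a)" using that by (intro mult_left_mono) auto
    then show ?thesis using B[of a t] that ab unfolding P_def by auto
  qed
  have "P > 0" unfolding P_def using ab by (simp add: add_nonneg_pos)
  have "bounded (f ` {a..b})"
    by (intro compact_imp_bounded compact_continuous_image
        absolutely_continuous_on_continuous[OF f]) auto
  then obtain M where M: "M > 0" "\<And>t. t \<in> {a..b} \<Longrightarrow> \<bar>f t\<bar> \<le> M"
    by (auto simp: bounded_pos)
  have "\<epsilon> / (2 * P) > 0" using \<epsilon> \<open>P > 0\<close> by simp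
  from absolutely_continuous_on_system[OF f this]
  obtain \<delta> where \<delta>: "\<delta> > 0" "\<And>(A :: nat set) l r. interval_system a b A l r \<Longrightarrow>
       (\<Sum>k\<in>A. r k - l k) < \<delta> \<Longrightarrow> (\<Sum>k\<in>A. \<bar>f (r k) - f (l k)\<bar>) < \<epsilon> / (2 * P)"
    by metis
  \<comment> \<open>Half of \<open>\<epsilon>\<close> is reserved for the increments of
    \<open>f\<close> and half for those of \<open>p\<close>; \<open>\<bar>B\<bar> + 1\<close> keeps
    the denominator positive.\<close>
  define \<delta>' where "\<delta>' = min \<delta> (\<epsilon> / (2 * M * (\<bar>B\<bar> + 1)))"
  have "\<delta>' > 0" using \<delta>(1) \<epsilon> M(1) by (auto simp: \<delta>'_def intro!: divide_pos_pos mult_pos_pos)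
  have "(\<Sum>k\<in>A. \<bar>p (r k) * f (r k) - p (l k) * f (l k)\<bar>) < \<epsilon>"
    if S: "interval_system a b A l r" and len: "(\<Sum>k\<in>A. r k - l k) < \<delta>'" for A :: "nat set" and l r
  proof -
    note D = interval_systemD[OF S]
    have "\<bar>p (r k) * f (r k) - p (l k) * f (l k)\<bar>
        \<le> P * \<bar>f (r k) - f (l k)\<bar> + M * (\<bar>B\<bar> + 1) * (r k - l k)" if "k \<in> A" for k
    proof -
      have m: "l k \<in> {a..b}" "r k \<in> {a..b}" using D(2-4)[OF that] by auto
      have "\<bar>p (r k) * f (r k) - p (l k) * f (l k)\<bar>
          = \<bar>p (r k) * (f (r k) - f (l k)) + (p (r k) - p (l k)) * f (l k)\<bar>"
        by (simp add: algebra_simps)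
      also have "\<dots> \<le> \<bar>p (r k)\<bar> * \<bar>f (r k) - f (l k)\<bar> + \<bar>p (r k) - p (l k)\<bar> * \<bar>f (l k)\<bar>"
        by (metis abs_mult abs_triangle_ineq)
      also have "\<dots> \<le> P * \<bar>f (r k) - f (l k)\<bar> + (\<bar>B\<bar> + 1) * (r k - l k) * M"
      proof (intro add_mono mult_mono)
        show "\<bar>p (r k) - p (l k)\<bar> \<le> (\<bar>B\<bar> + 1) * (r k - l k)"
          using B[OF m] D(3)[OF that] by (simp add: algebra_simps)
      qed (use m P M D(3)[OF that] \<open>P > 0\<close> in auto)
      finally show ?thesis by (simp add: algebra_simps)
    qed
    then have "(\<Sum>k\<in>A. \<bar>p (r k) * f (r k) - p (l k) * f (l k)\<bar>)
      \<le> P * (\<Sum>k\<in>A. \<bar>f (r k) - f (l k)\<bar>) + M * (\<bar>B\<bar> + 1) * (\<Sum>k\<in>A. r k - l k)"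
      unfolding sum_distrib_left sum.distrib[symmetric] by (intro sum_mono)
    also have "\<dots> < P * (\<epsilon> / (2 * P)) + M * (\<bar>B\<bar> + 1) * (\<epsilon> / (2 * M * (\<bar>B\<bar> + 1)))"
    proof (rule add_less_le_mono)
      show "P * (\<Sum>k\<in>A. \<bar>f (r k) - f (l k)\<bar>) < P * (\<epsilon> / (2 * P))"
        using len \<open>P > 0\<close> by (intro mult_strict_left_mono \<delta>(2)[OF S]) (auto simp: \<delta>'_def)
      show "M * (\<bar>B\<bar> + 1) * (\<Sum>k\<in>A. r k - l k) \<le> M * (\<bar>B\<bar> + 1) * (\<epsilon> / (2 * M * (\<bar>B\<bar> + 1)))"
        using len M(1) by (intro mult_left_mono) (auto simp: \<delta>'_def)
    qed
    also have "\<dots> = \<epsilon>"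
    proof -
      have "M * (\<bar>B\<bar> + 1) > 0" using M(1) by (simp add: mult_pos_pos add_nonneg_pos)
      moreover have "P * (\<epsilon> / (2 * P)) = \<epsilon> / 2" using \<open>P > 0\<close> by simp
      moreover have "C * (\<epsilon> / (2 * C)) = \<epsilon> / 2" if "C > 0" for C :: real using that by simp
      ultimately show ?thesis by (metis field_sum_of_halves mult.assoc)
    qed
    finally show ?thesis .
  qed
  then show "\<exists>\<delta>>0. \<forall>(A :: nat set) l r. interval_system a b A l r \<longrightarrow>
       (\<Sum>k\<in>A. r k - l k) < \<delta> \<longrightarrow> (\<Sum>k\<in>A. \<bar>p (r k) * f (r k) - p (l k) * f (l k)\<bar>) < \<epsilon>"
    using \<open>\<delta>' > 0\<close> by blast
qed

section \<open>Total variation of an absolutely continuous function\<close>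

lemma variation_sumsI:
  "interval_system s t (A :: nat set) l r \<Longrightarrow>
    (\<Sum>k\<in>A. \<bar>f (r k) - f (l k)\<bar>) \<in> variation_sums f s t"
  unfolding variation_sums_def by blast

lemma variation_sums_split:
  assumes "x \<in> variation_sums f a t" "a \<le> s" "s \<le> t"
  obtains y z where "y \<in> variation_sums f a s" "z \<in> variation_sums f s t" "x \<le> y + z"
proof -
  obtain A l r where S: "interval_system a t (A :: nat set) l r"
    and x: "x = (\<Sum>k\<in>A. \<bar>f (r k) - f (l k)\<bar>)"
    using assms(1) unfolding variation_sums_def by blast
  let ?y = "\<Sum>k\<in>A. \<bar>f (min (r k) s) - f (min (l k) s)\<bar>"
  let ?z = "\<Sum>k\<in>A. \<bar>f (max (r k) s) - f (max (l k) s)\<bar>"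
  have "?y \<in> variation_sums f a s"
    by (rule variation_sumsI[OF interval_system_min[OF S assms(2)]])
  moreover have "?z \<in> variation_sums f s t"
    by (rule variation_sumsI[OF interval_system_max[OF S assms(3)]])
  moreover have "x \<le> ?y + ?z"
    unfolding x sum.distrib[symmetric] by (intro sum_mono) (auto simp: min_def max_def)
  ultimately show thesis by (rule that)
qed

lemma zero_in_variation_sums: "0 \<in> variation_sums f s t"
  unfolding variation_sums_def
  by (rule CollectI, rule exI[of _ "{}"]) (simp add: interval_system_def disjoint_family_on_def)

lemma bdd_above_variation_sums_join:
  assumes "bdd_above (variation_sums f a s)" "bdd_above (variation_sums f s t)" "a \<le> s" "s \<le> t"
  shows "bdd_above (variation_sums f a t)"
proof -
  obtain B C where "\<And>x. x \<in> variation_sums f a s \<Longrightarrow> x \<le> B" "\<And>x. x \<in> variation_sums f s t \<Longrightarrow> x \<le> C"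
    using assms(1,2) unfolding bdd_above_def by blast
  then have "x \<le> B + C" if "x \<in> variation_sums f a t" for x
    using variation_sums_split[OF that assms(3,4)] by (metis add_mono order_trans)
  then show ?thesis unfolding bdd_above_def by blast
qed

text \<open>With tolerance \<open>1\<close> in the definition of absolute continuity, each interval
  shorter than \<open>\<delta>\<close> has variation at most \<open>1\<close>. Finitely many steps
  of length \<open>\<delta> / 2\<close>, strictly below \<open>\<delta>\<close>, reach
  \<open>b\<close>.\<close>

lemma bdd_above_variation_sums:
  assumes "absolutely_continuous_on {a..b} f" "a \<le> b"
  shows "bdd_above (variation_sums f a b)"
proof -
  obtain \<delta> where \<delta>: "\<delta> > 0" "\<And>(A :: nat set) l r. interval_system a b A l r \<Longrightarrow>
       (\<Sum>k\<in>A. r k - l k) < \<delta> \<Longrightarrow> (\<Sum>k\<in>A. \<bar>f (r k) - f (l k)\<bar>) < 1"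
    using absolutely_continuous_on_system[OF assms(1), of 1] by (metis zero_less_one)
  have short: "bdd_above (variation_sums f s t)" if "a \<le> s" "s \<le> t" "t \<le> b" "t - s < \<delta>" for s t
  proof -
    have "x \<le> 1" if x: "x \<in> variation_sums f s t" for x
    proof -
      obtain A l r where S: "interval_system s t (A :: nat set) l r"
        and x: "x = (\<Sum>k\<in>A. \<bar>f (r k) - f (l k)\<bar>)"
        using x unfolding variation_sums_def by blast
      show ?thesis unfolding x
        using \<delta>(2)[OF interval_system_mono[OF S]] sum_interval_system_le[OF S]
          \<open>a \<le> s\<close> \<open>s \<le> t\<close> \<open>t \<le> b\<close> \<open>t - s < \<delta>\<close> by fastforce
    qed
    then show ?thesis unfolding bdd_above_def by blast
  qed
  have "bdd_above (variation_sums f a (min b (a + real n * (\<delta> / 2))))" for n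
  proof (induction n)
    case 0
    show ?case using short[of a a] assms(2) \<delta>(1) by (simp add: min_def)
  next
    case (Suc n)
    show ?case
    proof (rule bdd_above_variation_sums_join[OF Suc])
      show "a \<le> min b (a + real n * (\<delta> / 2))" using assms(2) \<delta>(1) by simp
      show 1: "min b (a + real n * (\<delta> / 2)) \<le> min b (a + real (Suc n) * (\<delta> / 2))"
        using \<delta>(1) by (auto simp: min_def field_simps)
      show "bdd_above (variation_sums f (min b (a + real n * (\<delta> / 2)))
         (min b (a + real (Suc n) * (\<delta> / 2))))"
        using \<delta>(1) assms(2) 1 by (intro short) (auto simp: min_def field_simps)
    qed
  qed
  moreover obtain n where "real n > (b - a) / (\<delta> / 2)" using reals_Archimedean2 by blast
  then have "min b (a + real n * (\<delta> / 2)) = b" using \<delta>(1) by (auto simp: min_def field_simps)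
  ultimately show ?thesis by metis
qed

context
  fixes f a b assumes ac: "absolutely_continuous_on {a..b} f"
begin

lemma bdd_above_variation_sums_subinterval:
  "a \<le> s \<Longrightarrow> s \<le> t \<Longrightarrow> t \<le> b \<Longrightarrow> bdd_above (variation_sums f s t)"
  by (rule bdd_above_variation_sums[OF absolutely_continuous_on_subinterval[OF ac]])

lemma variation_sums_le:
  "x \<in> variation_sums f s t \<Longrightarrow> a \<le> s \<Longrightarrow> s \<le> t \<Longrightarrow> t \<le> b \<Longrightarrow> x \<le> variation f s t"
  unfolding variation_def by (intro cSup_upper bdd_above_variation_sums_subinterval)

lemma variation_subadditive:
  assumes "a \<le> s" "s \<le> t" "t \<le> b"
  shows "variation f a t \<le> variation f a s + variation f s t"
  unfolding variation_def[of f a t]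
proof (rule cSup_least)
  show "variation_sums f a t \<noteq> {}" using zero_in_variation_sums by blast
  fix x assume "x \<in> variation_sums f a t"
  then obtain y z where "y \<in> variation_sums f a s" "z \<in> variation_sums f s t" "x \<le> y + z"
    using variation_sums_split assms by blast
  then show "x \<le> variation f a s + variation f s t"
    using variation_sums_le[of y a s] variation_sums_le[of z s t] assms by linarith
qed

text \<open>One interval from \<open>s\<close> to \<open>t\<close> is appended to a system in
  \<open>{a..s}\<close>. This form of the estimate makes both \<open>variation f a\<close> and its
  difference with \<open>f\<close> nondecreasing.\<close>

lemma variation_superadditive:
  assumes "a \<le> s" "s \<le> t" "t \<le> b"
  shows "variation f a s + \<bar>f t - f s\<bar> \<le> variation f a t"
proof -
  have "x \<le> variation f a t - \<bar>f t - f s\<bar>" if x: "x \<in> variation_sums f a s" for x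
  proof -
    obtain A l r where S: "interval_system a s (A :: nat set) l r"
      and x: "x = (\<Sum>k\<in>A. \<bar>f (r k) - f (l k)\<bar>)"
      using x unfolding variation_sums_def by blast
    note D = interval_systemD[OF S]
    obtain n where n: "n \<notin> A" using ex_new_if_finite[OF infinite_UNIV_nat D(1)] by blast
    let ?l = "l(n := s)" and ?r = "r(n := t)"
    have "interval_system a t (insert n A) ?l ?r"
    proof (rule interval_systemI)
      show "finite (insert n A)" using D(1) by simp
      show "a \<le> ?l k \<and> ?l k \<le> ?r k \<and> ?r k \<le> t" if "k \<in> insert n A" for k
        using that D(2-4)[of k] assms by auto
      show "{?l j<..<?r j} \<inter> {?l k<..<?r k} = {}"
        if "j \<in> insert n A" "k \<in> insert n A" "j \<noteq> k" for j k
      proof -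
        have *: "{l i<..<r i} \<inter> {s<..<t} = {}" if "i \<in> A" for i
          using D(4)[OF that] by auto
        show ?thesis using that D(5)[of j k] *[of j] *[of k] by auto
      qed
    qed
    then have "(\<Sum>k\<in>insert n A. \<bar>f (?r k) - f (?l k)\<bar>) \<in> variation_sums f a t"
      by (rule variation_sumsI)
    moreover have "(\<Sum>k\<in>insert n A. \<bar>f (?r k) - f (?l k)\<bar>) = \<bar>f t - f s\<bar> + x"
    proof -
      have "(\<Sum>k\<in>A. \<bar>f (?r k) - f (?l k)\<bar>) = x"
        unfolding x using n by (intro sum.cong) auto
      then show ?thesis using n D(1) by simp
    qed
    ultimately show ?thesis using variation_sums_le[of _ a t] assms by fastforce
  qed
  then have "variation f a s \<le> variation f a t - \<bar>f t - f s\<bar>"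
    unfolding variation_def[of f a s]
    using zero_in_variation_sums by (intro cSup_least) (blast, blast)
  then show ?thesis by simp
qed

text \<open>Inside each interval of a short system a nearly optimal system is chosen. Together they
  form a system indexed by pairs whose total length is not larger, so the \<open>\<delta>\<close> of
  \<open>f\<close> serves for its variation.\<close>

lemma variation_absolutely_continuous: "absolutely_continuous_on {a..b} (variation f a)"
proof (rule absolutely_continuous_on_systemI)
  fix \<epsilon> :: real assume \<epsilon>: "\<epsilon> > 0"
  then have "\<epsilon> / 2 > 0" by simp
  from absolutely_continuous_on_system[OF ac this]
  obtain \<delta> where \<delta>: "\<delta> > 0" "\<And>(A :: (nat \<times> nat) set) l r. interval_system a b A l r \<Longrightarrow>
       (\<Sum>k\<in>A. r k - l k) < \<delta> \<Longrightarrow> (\<Sum>k\<in>A. \<bar>f (r k) - f (l k)\<bar>) < \<epsilon> / 2"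
    by metis
  have "(\<Sum>k\<in>A. \<bar>variation f a (r k) - variation f a (l k)\<bar>) < \<epsilon>"
    if S: "interval_system a b A l r" and len: "(\<Sum>k\<in>A. r k - l k) < \<delta>" for A :: "nat set" and l r
  proof -
    note D = interval_systemD[OF S]
    \<comment> \<open>The losses \<open>\<eta>\<close> of all intervals add up to less than
      \<open>\<epsilon> / 2\<close>, also for empty \<open>A\<close>.\<close>
    define \<eta> where "\<eta> = \<epsilon> / (2 * (real (card A) + 1))"
    have \<eta>: "\<eta> > 0" using \<epsilon> by (simp add: \<eta>_def)
    have "\<exists>B l' r'. interval_system (l k) (r k) (B :: nat set) l' r' \<and>
        variation f (l k) (r k) - \<eta> < (\<Sum>j\<in>B. \<bar>f (r' j) - f (l' j)\<bar>)" if "k \<in> A" for k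
    proof -
      have "\<exists>x\<in>variation_sums f (l k) (r k). variation f (l k) (r k) - \<eta> < x"
        unfolding variation_def using \<eta> zero_in_variation_sums
        by (metis diff_less empty_iff less_cSupE less_eq_real_def diff_gt_0_iff_gt add_0 less_diff_eq minus_diff_eq neg_less_iff_less ab_semigroup_add_class.add.commute diff_less_eq less_add_same_cancel1)
      then show ?thesis unfolding variation_sums_def by blast
    qed
    then obtain B l' r' where B: "\<And>k. k \<in> A \<Longrightarrow> interval_system (l k) (r k) (B k :: nat set) (l' k) (r' k)"
      "\<And>k. k \<in> A \<Longrightarrow> variation f (l k) (r k) - \<eta> < (\<Sum>j\<in>B k. \<bar>f (r' k j) - f (l' k j)\<bar>)"
      by metis
    let ?l = "\<lambda>(k, j). l' k j" and ?r = "\<lambda>(k, j). r' k j"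
    have fin: "finite (B k)" if "k \<in> A" for k using interval_systemD(1)[OF B(1)[OF that]] .
    have sys: "interval_system a b (Sigma A B) ?l ?r"
    proof (rule interval_systemI)
      show "finite (Sigma A B)" using D(1) fin by (rule finite_SigmaI)
      show "a \<le> ?l p \<and> ?l p \<le> ?r p \<and> ?r p \<le> b" if "p \<in> Sigma A B" for p
        using that D(2-4) interval_systemD(2-4)[OF B(1)] by force
      show "{?l p<..<?r p} \<inter> {?l q<..<?r q} = {}"
        if "p \<in> Sigma A B" "q \<in> Sigma A B" "p \<noteq> q" for p q
      proof -
        obtain k j m i where pq: "p = (k, j)" "q = (m, i)" by fastforce
        have sub: "{l' k j<..<r' k j} \<subseteq> {l k<..<r k}" "{l' m i<..<r' m i} \<subseteq> {l m<..<r m}"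
          using that pq interval_systemD(2,4)[OF B(1)] by fastforce+
        show ?thesis
        proof (cases "k = m")
          case True
          then show ?thesis using that pq interval_systemD(5)[OF B(1), of k j i] by auto
        next
          case False
          then have "{l k<..<r k} \<inter> {l m<..<r m} = {}" using that pq D(5)[of k m] by auto
          then show ?thesis using pq sub by (simp only: prod.case) blast
        qed
      qed
    qed
    have "(\<Sum>p\<in>Sigma A B. ?r p - ?l p) = (\<Sum>k\<in>A. \<Sum>j\<in>B k. r' k j - l' k j)"
      using D(1) fin by (subst sum.Sigma) (auto simp: case_prod_beta)
    also have "\<dots> \<le> (\<Sum>k\<in>A. r k - l k)"
      using sum_interval_system_le[OF B(1)] D(3) by (intro sum_mono) auto
    finally have "(\<Sum>p\<in>Sigma A B. ?r p - ?l p) < \<delta>" using len by simp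
    then have "(\<Sum>p\<in>Sigma A B. \<bar>f (?r p) - f (?l p)\<bar>) < \<epsilon> / 2" by (rule \<delta>(2)[OF sys])
    also have "(\<Sum>p\<in>Sigma A B. \<bar>f (?r p) - f (?l p)\<bar>) = (\<Sum>k\<in>A. \<Sum>j\<in>B k. \<bar>f (r' k j) - f (l' k j)\<bar>)"
      using D(1) fin by (subst sum.Sigma) (auto simp: case_prod_beta)
    finally have small: "(\<Sum>k\<in>A. \<Sum>j\<in>B k. \<bar>f (r' k j) - f (l' k j)\<bar>) < \<epsilon> / 2" .
    have "(\<Sum>k\<in>A. \<bar>variation f a (r k) - variation f a (l k)\<bar>)
        \<le> (\<Sum>k\<in>A. (\<Sum>j\<in>B k. \<bar>f (r' k j) - f (l' k j)\<bar>) + \<eta>)"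
    proof (rule sum_mono)
      fix k assume k: "k \<in> A"
      show "\<bar>variation f a (r k) - variation f a (l k)\<bar> \<le> (\<Sum>j\<in>B k. \<bar>f (r' k j) - f (l' k j)\<bar>) + \<eta>"
        using variation_subadditive[of "l k" "r k"] variation_superadditive[of "l k" "r k"]
          D(2-4)[OF k] B(2)[OF k] by linarith
    qed
    also have "\<dots> = (\<Sum>k\<in>A. \<Sum>j\<in>B k. \<bar>f (r' k j) - f (l' k j)\<bar>) + real (card A) * \<eta>"
      by (simp add: sum.distrib)
    also have "\<dots> < \<epsilon> / 2 + \<epsilon> / 2"
    proof (rule add_strict_mono[OF small])
      show "real (card A) * \<eta> < \<epsilon> / 2" unfolding \<eta>_def using \<epsilon> by (simp add: field_simps)
    qed
    finally show ?thesis by simp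
  qed
  then show "\<exists>\<delta>>0. \<forall>(A :: nat set) l r. interval_system a b A l r \<longrightarrow>
       (\<Sum>k\<in>A. r k - l k) < \<delta> \<longrightarrow>
       (\<Sum>k\<in>A. \<bar>variation f a (r k) - variation f a (l k)\<bar>) < \<epsilon>"
    using \<delta>(1) by blast
qed

end

text \<open>The function \<open>h\<close> is the Radon-Nikodym density of the Stieltjes measure of
  \<open>F\<close>. That measure ignores Lebesgue null sets: such a set is covered by nonoverlapping
  intervals of total length below \<open>\<delta>\<close>, and absolute continuity of
  \<open>F\<close> bounds the measure of every finite subfamily by
  \<open>\<epsilon>\<close>.\<close>

lemma mono_absolutely_continuous_density:
  assumes mono: "mono_on {a..b} F" and ac: "absolutely_continuous_on {a..b} F" and ab: "a < b"
  obtains h where "h absolutely_integrable_on UNIV"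
    "\<And>t. t \<in> {a..b} \<Longrightarrow> F t - F a = integral {a..t} h"
proof -
  \<comment> \<open>Not a derivative: \<open>F'\<close> continues \<open>F\<close> by constants
    beyond \<open>a\<close> and \<open>b\<close>, so that \<open>interval_measure\<close> sees a
    nondecreasing continuous function on the whole line.\<close>
  define F' where "F' x = F (min (max x a) b)" for x
  have F'_eq: "F' x = F x" if "x \<in> {a..b}" for x using that by (auto simp: F'_def)
  have F'_mono: "F' x \<le> F' y" if "x \<le> y" for x y
    unfolding F'_def using that ab by (intro mono_onD[OF mono]) auto
  have F'_cont: "continuous_on UNIV F'"
    unfolding F'_def using ab
    by (intro continuous_on_compose2[OF absolutely_continuous_on_continuous[OF ac]] continuous_intros)
      auto
  define \<mu> where "\<mu> = interval_measure F'"
  have Icc: "emeasure \<mu> {c..d} = ennreal (F' d - F' c)" if "c \<le> d" for c d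
    unfolding \<mu>_def by (intro emeasure_interval_measure_Icc that F'_mono F'_cont)
  have sets_\<mu>: "sets \<mu> = sets borel" by (simp add: \<mu>_def)
  define \<nu> where "\<nu> = density \<mu> (indicator {a..b})"
  have \<nu>: "emeasure \<nu> S = emeasure \<mu> (S \<inter> {a..b})" if "S \<in> sets borel" for S
  proof -
    have "emeasure \<nu> S = (\<integral>\<^sup>+ x. indicator {a..b} x * indicator S x \<partial>\<mu>)"
      unfolding \<nu>_def using that
      by (subst emeasure_density) (auto simp: sets_\<mu> measurable_cong_sets[OF sets_\<mu> refl])
    also have "(\<lambda>x. indicator {a..b} x * indicator S x :: ennreal) = indicator (S \<inter> {a..b})"
      by (auto simp: fun_eq_iff indicator_def)
    finally have "emeasure \<nu> S = (\<integral>\<^sup>+ x. indicator (S \<inter> {a..b}) x \<partial>\<mu>)" .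
    then show ?thesis using that by (simp add: sets_\<mu>)
  qed
  have sets_\<nu>: "sets \<nu> = sets lborel" by (simp add: \<nu>_def sets_\<mu>)
  have ac_\<nu>: "absolutely_continuous lborel \<nu>"
    unfolding absolutely_continuous_def
  proof
    fix S assume S: "S \<in> null_sets (lborel :: real measure)"
    then have Sb: "S \<in> sets borel" by auto
    let ?S = "S \<inter> {a..b}"
    have S0: "?S \<in> null_sets lebesgue"
      using S by (intro null_sets_completionI null_set_Int2) auto
    have "emeasure \<mu> ?S \<le> 0 + ennreal \<epsilon>" if \<epsilon>: "\<epsilon> > 0" for \<epsilon>
    proof -
      obtain \<delta> where \<delta>: "\<delta> > 0" "\<And>(A :: real set set) l r. interval_system a b A l r \<Longrightarrow>
         (\<Sum>k\<in>A. r k - l k) < \<delta> \<Longrightarrow> (\<Sum>k\<in>A. \<bar>F (r k) - F (l k)\<bar>) < \<epsilon>"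
        using absolutely_continuous_on_system[OF ac \<epsilon>] by metis
      have lm: "?S \<in> lmeasurable" and m0: "measure lebesgue ?S = 0"
        using S0 by (auto simp: fmeasurableI_null_sets measure_eq_0_null_sets)
      obtain D where D: "countable D"
        "\<And>K. K \<in> D \<Longrightarrow> K \<subseteq> cbox a b \<and> K \<noteq> {} \<and> (\<exists>c d. K = cbox c d)"
        "pairwise (\<lambda>A B. interior A \<inter> interior B = {}) D"
        "?S \<subseteq> \<Union>D" "\<Union>D \<in> lmeasurable" "measure lebesgue (\<Union>D) \<le> measure lebesgue ?S + \<delta> / 2"
        by (rule measurable_outer_intervals_bounded[OF lm, of a b "\<delta> / 2"]) (use \<delta>(1) in simp_all)
      define l where "l K = Inf K" for K :: "real set"
      define r where "r K = Sup K" for K :: "real set"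
      have K: "K = {l K..r K}" "l K \<le> r K" "a \<le> l K" "r K \<le> b" if "K \<in> D" for K
      proof -
        obtain c d where cd: "K = {c..d}" using D(2)[OF \<open>K \<in> D\<close>] by (auto simp: box_real)
        have "c \<le> d" using D(2)[OF that] cd by auto
        then have "l K = c" "r K = d" using cd by (auto simp: l_def r_def)
        then show "K = {l K..r K}" "l K \<le> r K" "a \<le> l K" "r K \<le> b"
          using cd \<open>c \<le> d\<close> D(2)[OF that] by auto
      qed
      have fin: "emeasure \<mu> (\<Union>E) \<le> ennreal \<epsilon>" if E: "finite E" "E \<subseteq> D" for E
      proof -
        have disj: "{l J<..<r J} \<inter> {l K<..<r K} = {}" if "J \<in> E" "K \<in> E" "J \<noteq> K" for J K
        proof -
          have "interior J \<inter> interior K = {}" using D(3) that E(2) by (auto simp: pairwise_def)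
          then show ?thesis using K(1)[of J] K(1)[of K] that E(2)
            by (metis interior_atLeastAtMost_real subsetD)
        qed
        have sys: "interval_system a b E l r"
          using E K(2-4) disj by (intro interval_systemI) auto
        have "(\<Sum>J\<in>E. r J - l J) = (\<Sum>J\<in>E. measure lebesgue {l J<..<r J})"
          using K(2) E(2) by (intro sum.cong) auto
        also have "\<dots> = measure lebesgue (\<Union>J\<in>E. {l J<..<r J})"
          using E(1) disj
          by (intro measure_finite_Union[symmetric])
            (use emeasure_lborel_box_finite[where 'a = real] in \<open>auto simp: disjoint_family_on_def box_real less_top\<close>)
        also have "\<dots> \<le> measure lebesgue (\<Union>D)"
        proof (rule measure_mono_fmeasurable[OF _ _ D(5)])
          have "{l J<..<r J} \<subseteq> J" if "J \<in> E" for J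
          proof -
            have "{l J<..<r J} \<subseteq> {l J..r J}" by auto
            also have "\<dots> = J" using K(1)[of J] that E(2) by auto
            finally show ?thesis .
          qed
          then show "(\<Union>J\<in>E. {l J<..<r J}) \<subseteq> \<Union>D" using E(2) by blast
          show "(\<Union>J\<in>E. {l J<..<r J}) \<in> sets lebesgue" using E(1) by (intro sets.finite_UN) auto
        qed
        also have "\<dots> < \<delta>" using D(6) m0 \<delta>(1) by simp
        finally have small: "(\<Sum>J\<in>E. \<bar>F (r J) - F (l J)\<bar>) < \<epsilon>" by (rule \<delta>(2)[OF sys])
        have "J \<in> sets \<mu>" if "J \<in> E" for J
          using K(1)[of J] that E(2) unfolding sets_\<mu> by (metis atLeastAtMost_borel subsetD)
        then have "emeasure \<mu> (\<Union>J\<in>E. J) \<le> (\<Sum>J\<in>E. emeasure \<mu> J)"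
          using E(1) by (intro emeasure_subadditive_finite) auto
        also have "\<dots> = (\<Sum>J\<in>E. ennreal \<bar>F (r J) - F (l J)\<bar>)"
        proof (rule sum.cong[OF refl])
          fix J assume "J \<in> E"
          then have J: "J \<in> D" using E(2) by auto
          have "emeasure \<mu> J = emeasure \<mu> {l J..r J}" using K(1)[OF J] by simp
          also have "\<dots> = ennreal (F' (r J) - F' (l J))" by (rule Icc[OF K(2)[OF J]])
          also have "\<dots> = ennreal \<bar>F (r J) - F (l J)\<bar>"
            using F'_mono[OF K(2)[OF J]] F'_eq[of "l J"] F'_eq[of "r J"] K(2-4)[OF J] by auto
          finally show "emeasure \<mu> J = ennreal \<bar>F (r J) - F (l J)\<bar>" .
        qed
        also have "\<dots> = ennreal (\<Sum>J\<in>E. \<bar>F (r J) - F (l J)\<bar>)" by (simp add: sum_ennreal)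
        also have "\<dots> \<le> ennreal \<epsilon>" using small by (intro ennreal_leI) simp
        finally show ?thesis by simp
      qed
      show ?thesis
      proof (cases "D = {}")
        case True
        then show ?thesis using D(4) by simp
      next
        case False
        \<comment> \<open>The countable cover is exhausted by finite subfamilies, for which
          \<open>fin\<close> gives the same bound \<open>\<epsilon>\<close>; continuity from below
          passes it to the union.\<close>
        let ?E = "\<lambda>n. from_nat_into D ` {..n::nat}"
        have E: "?E n \<subseteq> D" "finite (?E n)" for n using from_nat_into[OF False] by auto
        have UN: "(\<Union>n. \<Union>(?E n)) = \<Union>D"
        proof -
          have "(\<Union>n. \<Union>(?E n)) = \<Union>(range (from_nat_into D))" by auto
          then show ?thesis using range_from_nat_into[OF False D(1)] by simp
        qed
        have D_meas: "J \<in> sets \<mu>" if "J \<in> D" for J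
          by (subst K(1)[OF that]) (simp add: sets_\<mu>)
        have "emeasure \<mu> ?S \<le> emeasure \<mu> (\<Union>n. \<Union>(?E n))"
          unfolding UN using D(1,4) D_meas by (intro emeasure_mono sets.countable_Union) auto
        also have "\<dots> = (SUP n. emeasure \<mu> (\<Union>(?E n)))"
        proof (rule SUP_emeasure_incseq[symmetric])
          show "range (\<lambda>n. \<Union>(?E n)) \<subseteq> sets \<mu>"
            using E D_meas by (intro image_subsetI sets.finite_Union) auto
          show "incseq (\<lambda>n. \<Union>(?E n))"
            unfolding incseq_def by (intro allI impI Union_mono image_mono) auto
        qed
        also have "\<dots> \<le> ennreal \<epsilon>" using fin E by (intro SUP_least) auto
        finally show ?thesis by simp
      qed
    qed
    then have "emeasure \<mu> ?S \<le> 0" by (rule ennreal_le_epsilon)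
    then have "emeasure \<nu> S = 0" using \<nu>[OF Sb] by simp
    then show "S \<in> null_sets \<nu>" using Sb by (intro null_setsI) (simp_all add: sets_\<nu>)
  qed
  obtain k where k: "k \<in> borel_measurable lborel" "density lborel k = \<nu>"
    using sigma_finite_measure.Radon_Nikodym[OF sigma_finite_lborel ac_\<nu> sets_\<nu>] by (rule bexE)
  have k_int: "(\<integral>\<^sup>+ x. k x * indicator S x \<partial>lborel) = emeasure \<mu> (S \<inter> {a..b})"
    if "S \<in> sets borel" for S
    using emeasure_density[OF k(1), of S] \<nu>[OF that] that by (simp add: k(2))
  have "(\<integral>\<^sup>+ x. k x \<partial>lborel) = (\<integral>\<^sup>+ x. k x * indicator UNIV x \<partial>lborel)" by simp
  also have "\<dots> = emeasure \<mu> (UNIV \<inter> {a..b})" by (rule k_int) simp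
  also have "\<dots> = ennreal (F' b - F' a)" using ab by (simp add: Icc)
  finally have k_fin: "(\<integral>\<^sup>+ x. k x \<partial>lborel) \<noteq> \<infinity>" by simp
  have AE_fin: "AE x in lborel. k x \<noteq> \<infinity>"
    by (rule nn_integral_noteq_infinite[OF k(1) k_fin])
  \<comment> \<open>Where \<open>k\<close> is infinite, which happens only on a null set,
    \<open>h\<close> takes the value \<open>0\<close>.\<close>
  define h where "h x = enn2real (k x)" for x
  have h_meas: "h \<in> borel_measurable lborel" unfolding h_def using k(1) by measurable
  have h_nn: "h x \<ge> 0" for x by (simp add: h_def)
  have h_eq: "AE x in lborel. ennreal (h x) = k x"
    using AE_fin by eventually_elim (auto simp: h_def less_top)
  have h_int: "integrable lborel h"
  proof (rule integrableI_nonneg[OF h_meas])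
    have "(\<integral>\<^sup>+ x. ennreal (h x) \<partial>lborel) = (\<integral>\<^sup>+ x. k x \<partial>lborel)"
      by (intro nn_integral_cong_AE h_eq)
    then show "(\<integral>\<^sup>+ x. ennreal (h x) \<partial>lborel) < \<infinity>" using k_fin by (simp add: less_top)
  qed (simp add: h_nn)
  show thesis
  proof (rule that[of h])
    show "h absolutely_integrable_on UNIV"
      using h_int by (simp add: set_integrable_def integrable_completion)
    fix t assume t: "t \<in> {a..b}"
    have "ennreal (F t - F a) = emeasure \<mu> {a..t}" using Icc[of a t] F'_eq t by auto
    also have "\<dots> = (\<integral>\<^sup>+ x. k x * indicator {a..t} x \<partial>lborel)"
      using k_int[of "{a..t}"] t by (simp add: Int_absorb2)
    also have "\<dots> = (\<integral>\<^sup>+ x. ennreal (h x * indicator {a..t} x) \<partial>lborel)"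
      using h_eq by (intro nn_integral_cong_AE) (auto elim!: eventually_mono simp: indicator_def)
    also have "\<dots> = ennreal (\<integral> x. h x * indicator {a..t} x \<partial>lborel)"
      using h_nn h_int
      by (intro nn_integral_eq_integral integrable_real_mult_indicator) auto
    also have "(\<integral> x. h x * indicator {a..t} x \<partial>lborel) = integral {a..t} h"
      using set_borel_integral_eq_integral(2)[of "{a..t}" h] integrable_mult_indicator[OF _ h_int, of "{a..t}"]
      by (simp add: set_integrable_def set_lebesgue_integral_def mult.commute)
    finally have "ennreal (F t - F a) = ennreal (integral {a..t} h)" .
    moreover have "F t - F a \<ge> 0" using mono_onD[OF mono, of a t] t by auto
    moreover have "integral {a..t} h \<ge> 0"
      using h_nn by (intro Henstock_Kurzweil_Integration.integral_nonneg integrable_on_subinterval[of h UNIV])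
        (use h_int in \<open>auto intro!: set_borel_integral_eq_integral simp: set_integrable_def\<close>)
    ultimately show "F t - F a = integral {a..t} h" by simp
  qed
qed

text \<open>\<open>integrable_ccontinuous_explicit\<close> controls the right difference quotients.
  The left ones at \<open>x\<close> are right ones of \<open>\<lambda>x. h (- x)\<close> at
  \<open>- x\<close>, so the second exceptional set is reflected. One null set serves all lower
  limits \<open>a\<close>.\<close>

lemma has_real_derivative_indefinite_integral:
  fixes h :: "real \<Rightarrow> real"
  assumes h: "h absolutely_integrable_on UNIV"
  obtains N where "negligible N"
    "\<And>a x. x \<notin> N \<Longrightarrow> a < x \<Longrightarrow> ((\<lambda>t. integral {a..t} h) has_real_derivative h x) (at x)"
proof -
  have int: "h integrable_on {c..d}" for c d
    by (rule integrable_on_subinterval[OF set_lebesgue_integral_eq_integral(1)[OF h]]) auto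
  have int': "(\<lambda>x. h (- x)) integrable_on {c..d}" for c d
  proof -
    have "(\<lambda>x. h (- x)) integrable_on {- (- c)..- (- d)}"
      by (subst Henstock_Kurzweil_Integration.integrable_reflect_real) (rule int)
    then show ?thesis by simp
  qed
  obtain N1 where N1: "negligible N1" "\<And>x e. x \<notin> N1 \<Longrightarrow> 0 < e \<Longrightarrow>
     \<exists>d>0. \<forall>k. 0 < k \<and> k < d \<longrightarrow> norm (integral (cbox x (x + k *\<^sub>R One)) h /\<^sub>R k ^ DIM(real) - h x) < e"
    using integrable_ccontinuous_explicit[of h] int by (metis box_real(2))
  obtain N2 where N2: "negligible N2" "\<And>x e. x \<notin> N2 \<Longrightarrow> 0 < e \<Longrightarrow>
     \<exists>d>0. \<forall>k. 0 < k \<and> k < d \<longrightarrow>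
       norm (integral (cbox x (x + k *\<^sub>R One)) (\<lambda>x. h (- x)) /\<^sub>R k ^ DIM(real) - h (- x)) < e"
    using integrable_ccontinuous_explicit[of "\<lambda>x. h (- x)"] int' by (metis box_real(2))
  have neg: "negligible (uminus ` N2)"
    by (rule negligible_differentiable_image_negligible[OF _ N2(1)])
    (auto simp: differentiable_on_def intro!: derivative_intros)
  show thesis
  proof (rule that[of "N1 \<union> uminus ` N2"])
    show "negligible (N1 \<union> uminus ` N2)" using N1(1) neg by (rule negligible_Un)
    fix a x :: real assume x: "x \<notin> N1 \<union> uminus ` N2" and ax: "a < x"
    let ?I = "\<lambda>t. integral {a..t} h"
    show "(?I has_real_derivative h x) (at x)"
      unfolding DERIV_def LIM_eq
    proof (intro allI impI)
      fix e :: real assume e: "e > 0"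
      obtain d1 where d1: "d1 > 0" "\<And>k. 0 < k \<Longrightarrow> k < d1 \<Longrightarrow> \<bar>integral {x..x + k} h / k - h x\<bar> < e"
        using N1(2)[of x e] x e by (auto simp: divide_inverse mult.commute)
      have "- x \<notin> N2" using x by (metis Un_iff image_eqI minus_minus)
      then obtain d2 where d2: "d2 > 0" "\<And>k. 0 < k \<Longrightarrow> k < d2 \<Longrightarrow>
          \<bar>integral {- x..- x + k} (\<lambda>x. h (- x)) / k - h x\<bar> < e"
        using N2(2)[of "- x" e] e by (auto simp: divide_inverse mult.commute)
      have right: "?I (x + k) - ?I x = integral {x..x + k} h" if "k > 0" for k
        using Henstock_Kurzweil_Integration.integral_combine[of a x "x + k" h] int ax that by simp
      have left: "?I x - ?I (x - k) = integral {- x..- x + k} (\<lambda>x. h (- x))"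
        if "k > 0" "a < x - k" for k
      proof -
        have "integral {- x..- (x - k)} (\<lambda>x. h (- x)) = integral {x - k..x} h"
          by (rule Henstock_Kurzweil_Integration.integral_reflect_real)
        then show ?thesis
          using Henstock_Kurzweil_Integration.integral_combine[of a "x - k" x h] int that by simp
      qed
      show "\<exists>s>0. \<forall>k. k \<noteq> 0 \<and> norm (k - 0) < s \<longrightarrow> norm ((?I (x + k) - ?I x) / k - h x) < e"
      proof (intro exI[of _ "min (min d1 d2) (x - a)"] conjI allI impI)
        show "0 < min (min d1 d2) (x - a)" using d1(1) d2(1) ax by simp
        fix k :: real assume k: "k \<noteq> 0 \<and> norm (k - 0) < min (min d1 d2) (x - a)"
        show "norm ((?I (x + k) - ?I x) / k - h x) < e"
        proof (cases "k > 0")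
          case True
          then show ?thesis using right[OF True] d1(2)[OF True] k by simp
        next
          case False
          then have k': "- k > 0" using k by simp
          have "(?I (x + k) - ?I x) / k = (?I x - ?I (x - (- k))) / (- k)"
            by (simp add: field_simps minus_divide_left)
          then show ?thesis using left[OF k'] d2(2)[OF k'] k k' by simp
        qed
      qed
    qed
  qed
qed


lemma mono_absolutely_continuous_derivative:
  assumes "mono_on {a..b} F" "absolutely_continuous_on {a..b} F" "a < b"
  obtains h N where "h absolutely_integrable_on UNIV" "negligible N"
    "\<And>t. t \<in> {a..b} \<Longrightarrow> F t - F a = integral {a..t} h"
    "\<And>x. x \<in> {a<..<b} - N \<Longrightarrow> (F has_real_derivative h x) (at x)"
proof -
  obtain h where h: "h absolutely_integrable_on UNIV"
    "\<And>t. t \<in> {a..b} \<Longrightarrow> F t - F a = integral {a..t} h"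
    using mono_absolutely_continuous_density[OF assms] by metis
  obtain N where N: "negligible N"
    "\<And>a x. x \<notin> N \<Longrightarrow> a < x \<Longrightarrow> ((\<lambda>t. integral {a..t} h) has_real_derivative h x) (at x)"
    using has_real_derivative_indefinite_integral[OF h(1)] by metis
  have "(F has_real_derivative h x) (at x)" if x: "x \<in> {a<..<b} - N" for x
  proof -
    have "((\<lambda>t. F a + integral {a..t} h) has_real_derivative h x) (at x)"
      using N(2)[of x a] x by (auto intro!: derivative_eq_intros)
    then show ?thesis
    proof (rule has_field_derivative_transform_within_open[of _ _ _ "{a<..<b}"])
      show "F a + integral {a..t} h = F t" if "t \<in> {a<..<b}" for t
        using h(2)[of t] that by (simp add: algebra_simps)
    qed (use x in auto)
  qed
  with h N(1) show thesis by (intro that)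
qed

text \<open>Jordan decomposition: \<open>f\<close> is the difference of \<open>variation f a\<close>
  and \<open>variation f a - f\<close>, which are both nondecreasing and absolutely continuous, so
  each is an indefinite integral.\<close>

proposition absolutely_continuous_derivative:
  assumes ac: "absolutely_continuous_on {a..b} f" and "a < b"
  shows "AE x in lebesgue_on {a..b}. (f has_real_derivative deriv f x) (at x)"
    and "integrable (lebesgue_on {a..b}) (deriv f)"
    and "integral\<^sup>L (lebesgue_on {a..b}) (deriv f) = f b - f a"
proof -
  let ?V = "variation f a"
  have V_mono: "mono_on {a..b} ?V"
    using variation_superadditive[OF ac] by (intro mono_onI) fastforce
  have D_mono: "mono_on {a..b} (\<lambda>x. ?V x - f x)"
  proof (intro mono_onI)
    fix r s assume "r \<in> {a..b}" "s \<in> {a..b}" "r \<le> s"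
    then show "?V r - f r \<le> ?V s - f s" using variation_superadditive[OF ac, of r s] by force
  qed
  have V_ac: "absolutely_continuous_on {a..b} ?V" by (rule variation_absolutely_continuous[OF ac])
  obtain h1 N1 where 1: "h1 absolutely_integrable_on UNIV" "negligible N1"
    "\<And>t. t \<in> {a..b} \<Longrightarrow> ?V t - ?V a = integral {a..t} h1"
    "\<And>x. x \<in> {a<..<b} - N1 \<Longrightarrow> (?V has_real_derivative h1 x) (at x)"
    by (rule mono_absolutely_continuous_derivative[OF V_mono V_ac \<open>a < b\<close>]) (rule that)
  obtain h2 N2 where 2: "h2 absolutely_integrable_on UNIV" "negligible N2"
    "\<And>t. t \<in> {a..b} \<Longrightarrow> (?V t - f t) - (?V a - f a) = integral {a..t} h2"
    "\<And>x. x \<in> {a<..<b} - N2 \<Longrightarrow> ((\<lambda>x. ?V x - f x) has_real_derivative h2 x) (at x)"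
    by (rule mono_absolutely_continuous_derivative[OF D_mono absolutely_continuous_on_diff[OF V_ac ac] \<open>a < b\<close>]) (rule that)
  \<comment> \<open>The end points are excluded because the derivatives obtained above are two-sided
    and hold only in the interior.\<close>
  let ?N = "N1 \<union> N2 \<union> {a, b}"
  have d: "(f has_real_derivative h1 x - h2 x) (at x)" if "x \<in> {a..b} - ?N" for x
  proof -
    have "((\<lambda>x. ?V x - (?V x - f x)) has_real_derivative h1 x - h2 x) (at x)"
      using that by (intro DERIV_diff 1(4) 2(4)) auto
    then show ?thesis by simp
  qed
  have "negligible ?N" using 1(2) 2(2) by simp
  then have "AE x in lebesgue. x \<notin> ?N"
    unfolding negligible_iff_null_sets by (rule AE_not_in)
  then have AE_N: "AE x in lebesgue_on {a..b}. x \<in> {a..b} - ?N"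
    by (subst AE_restrict_space_iff) auto
  then show "AE x in lebesgue_on {a..b}. (f has_real_derivative deriv f x) (at x)"
    by eventually_elim (use d DERIV_imp_deriv in metis)
  have neg: "negligible ?N" using 1(2) 2(2) by simp
  have eq: "deriv f x = h1 x - h2 x" if "x \<in> {a..b} - ?N" for x
    using d[OF that] by (rule DERIV_imp_deriv)
  have sub: "h1 absolutely_integrable_on {a..b}" "h2 absolutely_integrable_on {a..b}"
    using 1(1) 2(1) by (auto intro: set_integrable_subset)
  have "deriv f absolutely_integrable_on {a..b}"
    using absolutely_integrable_spike[OF set_integral_diff(1)[OF sub] neg eq] .
  then show int: "integrable (lebesgue_on {a..b}) (deriv f)"
    by (rule absolutely_integrable_imp_integrable) auto
  have "integral\<^sup>L (lebesgue_on {a..b}) (deriv f) = integral {a..b} (deriv f)"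
    using int by (intro lebesgue_integral_eq_integral) auto
  also have "\<dots> = integral {a..b} (\<lambda>x. h1 x - h2 x)"
    using eq by (intro integral_spike[OF neg]) auto
  also have "\<dots> = integral {a..b} h1 - integral {a..b} h2"
    using sub by (intro Henstock_Kurzweil_Integration.integral_diff set_lebesgue_integral_eq_integral(1))
  also have "\<dots> = f b - f a" using 1(3)[of b] 2(3)[of b] \<open>a < b\<close> by simp
  finally show "integral\<^sup>L (lebesgue_on {a..b}) (deriv f) = f b - f a" .
qed

section \<open>Integration by parts against a C1 factor\<close>

lemma has_real_derivative_interior:
  assumes "(f has_real_derivative D) (at t within {a..b})" "a < t" "t < b"
  shows "(f has_real_derivative D) (at t)"
  using assms at_within_Icc_at[of a t b] by simp

lemma AE_interior: "AE t in lebesgue_on {a..b::real}. a < t \<and> t < b"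
proof -
  have "negligible {a, b}" by simp
  then have "AE t in lebesgue. t \<notin> {a, b}"
    unfolding negligible_iff_null_sets by (rule AE_not_in)
  then show ?thesis by (subst AE_restrict_space_iff) (auto elim: eventually_mono)
qed

lemma continuous_imp_integrable_lebesgue_on:
  fixes g :: "real \<Rightarrow> real"
  assumes "continuous_on {a..b} g"
  shows "integrable (lebesgue_on {a..b}) g"
  using absolutely_integrable_continuous_real[OF assms] by (rule absolutely_integrable_imp_integrable) simp

lemma lipschitz_of_continuous_derivative:
  fixes p :: "real \<Rightarrow> real"
  assumes d: "\<And>t. t \<in> {a..b} \<Longrightarrow> (p has_real_derivative p' t) (at t within {a..b})"
    and c: "continuous_on {a..b} p'"
  obtains B where "\<And>s t. s \<in> {a..b} \<Longrightarrow> t \<in> {a..b} \<Longrightarrow> \<bar>p t - p s\<bar> \<le> B * \<bar>t - s\<bar>"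
proof -
  have "compact (p' ` {a..b})" by (rule compact_continuous_image[OF c]) simp
  from compact_imp_bounded[OF this] obtain B where "\<forall>y\<in>p' ` {a..b}. norm y \<le> B"
    unfolding bounded_iff by blast
  then have B: "norm (p' t) \<le> B" if "t \<in> {a..b}" for t using that by simp
  have "\<bar>p t - p s\<bar> \<le> B * \<bar>t - s\<bar>" if "s \<in> {a..b}" "t \<in> {a..b}" for s t
    using field_differentiable_bound[OF convex_real_interval(5) d B that(2,1)] by simp
  then show thesis by (rule that)
qed

lemma absolutely_continuous_on_C1:
  fixes p :: "real \<Rightarrow> real"
  assumes d: "\<And>t. t \<in> {a..b} \<Longrightarrow> (p has_real_derivative p' t) (at t within {a..b})"
    and c: "continuous_on {a..b} p'" and "a \<le> b"
  shows "absolutely_continuous_on {a..b} p"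
proof -
  obtain B where B: "\<And>s t. s \<in> {a..b} \<Longrightarrow> t \<in> {a..b} \<Longrightarrow> \<bar>p t - p s\<bar> \<le> B * \<bar>t - s\<bar>"
    using lipschitz_of_continuous_derivative[OF d c] by metis
  have one: "absolutely_continuous_on {a..b} (\<lambda>_. 1)"
    by (rule absolutely_continuous_on_systemI) (auto intro: exI[of _ 1])
  show ?thesis using absolutely_continuous_on_lipschitz_mult[OF one \<open>a \<le> b\<close> B] by simp
qed

text \<open>The product \<open>p * f\<close> is absolutely continuous, and its derivative is almost
  everywhere given by the product rule, so the fundamental theorem of calculus applies to
  it.\<close>

lemma absolutely_continuous_integration_by_parts:
  fixes f p :: "real \<Rightarrow> real"
  assumes ac: "absolutely_continuous_on {a..b} f" and "a < b"
    and d: "\<And>t. t \<in> {a..b} \<Longrightarrow> (p has_real_derivative p' t) (at t within {a..b})"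
    and c: "continuous_on {a..b} p'"
  shows "integrable (lebesgue_on {a..b}) (\<lambda>t. p t * deriv f t)"
    and "integral\<^sup>L (lebesgue_on {a..b}) (\<lambda>t. p t * deriv f t)
      + integral\<^sup>L (lebesgue_on {a..b}) (\<lambda>t. p' t * f t) = p b * f b - p a * f a"
proof -
  let ?M = "lebesgue_on {a..b}"
  obtain B where B: "\<And>s t. s \<in> {a..b} \<Longrightarrow> t \<in> {a..b} \<Longrightarrow> \<bar>p t - p s\<bar> \<le> B * \<bar>t - s\<bar>"
    using lipschitz_of_continuous_derivative[OF d c] by metis
  have pf: "absolutely_continuous_on {a..b} (\<lambda>x. p x * f x)"
    using absolutely_continuous_on_lipschitz_mult[OF ac _ B] \<open>a < b\<close> by simp
  have p_cont: "continuous_on {a..b} p" using d by (rule DERIV_continuous_on)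
  have "compact (p ` {a..b})" by (rule compact_continuous_image[OF p_cont]) simp
  from compact_imp_bounded[OF this] obtain C where "\<forall>y\<in>p ` {a..b}. norm y \<le> C"
    unfolding bounded_iff by blast
  then have C: "\<bar>p t\<bar> \<le> C" if "t \<in> {a..b}" for t using that by simp
  note F = absolutely_continuous_derivative[OF ac \<open>a < b\<close>]
  note PF = absolutely_continuous_derivative[OF pf \<open>a < b\<close>]
  have p_meas: "p \<in> borel_measurable ?M"
    using continuous_imp_integrable_lebesgue_on[OF p_cont] by simp
  show int: "integrable ?M (\<lambda>t. p t * deriv f t)"
  proof (rule Bochner_Integration.integrable_bound)
    show "integrable ?M (\<lambda>t. C * deriv f t)" by (rule integrable_mult_right[OF F(2)])
    show "(\<lambda>t. p t * deriv f t) \<in> borel_measurable ?M"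
      by (rule borel_measurable_times[OF p_meas borel_measurable_integrable[OF F(2)]])
    have "AE t in ?M. t \<in> {a..b}" using AE_space[of ?M] by simp
    then show "AE t in ?M. norm (p t * deriv f t) \<le> norm (C * deriv f t)"
    proof eventually_elim
      case (elim t)
      then have "\<bar>p t\<bar> \<le> \<bar>C\<bar>" using C[of t] by simp
      then show ?case by (simp add: abs_mult mult_right_mono)
    qed
  qed
  have f_cont: "continuous_on {a..b} f" by (rule absolutely_continuous_on_continuous[OF ac])
  have int': "integrable ?M (\<lambda>t. p' t * f t)"
    by (rule continuous_imp_integrable_lebesgue_on[OF continuous_on_mult[OF c f_cont]])
  have "AE t in ?M. p t * deriv f t + p' t * f t = deriv (\<lambda>x. p x * f x) t"
    using F(1) AE_interior
  proof eventually_elim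
    case (elim t)
    have "(p has_real_derivative p' t) (at t)"
      by (rule has_real_derivative_interior[OF d]) (use elim in auto)
    from DERIV_mult[OF this elim(1)] have "deriv (\<lambda>x. p x * f x) t = p' t * f t + deriv f t * p t"
      by (rule DERIV_imp_deriv)
    then show ?case by simp
  qed
  then have "integral\<^sup>L ?M (\<lambda>t. p t * deriv f t + p' t * f t) = integral\<^sup>L ?M (deriv (\<lambda>x. p x * f x))"
    by (intro integral_cong_AE borel_measurable_integrable Bochner_Integration.integrable_add int int' PF(2))
  then show "integral\<^sup>L ?M (\<lambda>t. p t * deriv f t) + integral\<^sup>L ?M (\<lambda>t. p' t * f t) = p b * f b - p a * f a"
    unfolding PF(3) Bochner_Integration.integral_add[OF int int'] .
qed

text \<open>Turns almost everywhere equality of velocities into equality of trajectories in the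
  uniqueness proof.\<close>

lemma absolutely_continuous_deriv_zero:
  assumes ac: "absolutely_continuous_on {a..b} f" and z: "AE t in lebesgue_on {a..b}. deriv f t = 0"
    and t: "t \<in> {a..b}"
  shows "f t = f a"
proof (cases "t = a")
  case False
  then have "a < t" using t by simp
  have ac': "absolutely_continuous_on {a..t} f"
    by (rule absolutely_continuous_on_subinterval[OF ac]) (use t in auto)
  note F = absolutely_continuous_derivative[OF ac' \<open>a < t\<close>]
  have "AE s in lebesgue. s \<in> {a..b} \<longrightarrow> deriv f s = 0"
    using z by (subst (asm) AE_restrict_space_iff) auto
  then have "AE s in lebesgue. s \<in> {a..t} \<longrightarrow> deriv f s = 0"
    by eventually_elim (use t in auto)
  then have "AE s in lebesgue_on {a..t}. deriv f s = 0"
    by (subst AE_restrict_space_iff) auto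
  then have "integral\<^sup>L (lebesgue_on {a..t}) (deriv f) = 0" by (rule integral_eq_zero_AE)
  then show ?thesis using F(3) by simp
qed simp

text \<open>\<open>nn_integral\<close> is monotone for arbitrary functions, measurable or not. This
  permits comparison with the cost of any competitor as it stands.\<close>

lemma extended_integral_mono:
  assumes "AE s in M. f s \<le> g s"
  shows "extended_integral M f \<le> extended_integral M g"
proof -
  have "(\<integral>\<^sup>+ s. e2ennreal (f s) \<partial>M) \<le> (\<integral>\<^sup>+ s. e2ennreal (g s) \<partial>M)"
    by (rule nn_integral_mono_AE) (use assms in \<open>auto elim!: eventually_mono intro: e2ennreal_mono\<close>)
  moreover have "(\<integral>\<^sup>+ s. e2ennreal (- g s) \<partial>M) \<le> (\<integral>\<^sup>+ s. e2ennreal (- f s) \<partial>M)"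
    by (rule nn_integral_mono_AE) (use assms in \<open>auto elim!: eventually_mono intro: e2ennreal_mono\<close>)
  ultimately show ?thesis
    unfolding extended_integral_def by (intro ereal_minus_mono) (simp_all add: less_eq_ennreal.rep_eq)
qed

lemma extended_integral_ereal:
  assumes "integrable M r"
  shows "extended_integral M (\<lambda>s. ereal (r s)) = ereal (integral\<^sup>L M r)"
proof -
  have e: "e2ennreal (ereal x) = ennreal x" for x by (simp add: ennreal.abs_eq)
  have fin: "(\<integral>\<^sup>+ s. ennreal (r s) \<partial>M) \<noteq> \<infinity>" "(\<integral>\<^sup>+ s. ennreal (- r s) \<partial>M) \<noteq> \<infinity>"
    using assms by (auto simp: real_integrable_def)
  have "enn2ereal A - enn2ereal B = ereal (enn2real A - enn2real B)" if "A \<noteq> \<infinity>" "B \<noteq> \<infinity>" for A B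
    using that by (cases A; cases B) (auto simp: enn2ereal_ennreal)
  from this[OF fin] show ?thesis
    unfolding extended_integral_def uminus_ereal.simps e real_lebesgue_integral_def[OF assms] .
qed

lemma extended_integral_cong_AE:
  "AE s in M. f s = g s \<Longrightarrow> extended_integral M f = extended_integral M g"
  by (intro antisym extended_integral_mono) (auto elim: eventually_mono)

subsection \<open>Minimization over bounded velocities\<close>

text \<open>Legendre duality between momentum \<open>p\<close> and velocity \<open>v\<close>,
  restricted to velocities in \<open>S\<close>: \<open>L u - p * u\<close> is minimal at
  \<open>v\<close>, with a quadratic margin. The margin yields the Lipschitz dependence of
  \<open>v\<close> on \<open>p\<close> and, at the end, uniqueness.\<close>

definition strong_minimizer :: "(real \<Rightarrow> real) \<Rightarrow> real \<Rightarrow> real set \<Rightarrow> real \<Rightarrow> real \<Rightarrow> bool" where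
  "strong_minimizer L \<theta> S p v \<longleftrightarrow>
     v \<in> S \<and> (\<forall>u\<in>S. L v - p * v + \<theta> * (u - v)\<^sup>2 \<le> L u - p * u)"

lemma strong_minimizerD:
  "strong_minimizer L \<theta> S p v \<Longrightarrow> u \<in> S \<Longrightarrow> L v - p * v + \<theta> * (u - v)\<^sup>2 \<le> L u - p * u"
  by (simp add: strong_minimizer_def)

text \<open>Each minimizer is tested with the other one and the two inequalities are added. The
  values of \<open>L\<close> cancel.\<close>

lemma strong_minimizer_monotone:
  assumes "strong_minimizer L \<theta> S p v" "strong_minimizer L \<theta> S q w"
  shows "2 * \<theta> * (v - w)\<^sup>2 \<le> (p - q) * (v - w)"
proof -
  have "L v - p * v + \<theta> * (w - v)\<^sup>2 \<le> L w - p * w" "L w - q * w + \<theta> * (v - w)\<^sup>2 \<le> L v - q * v"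
    using assms by (auto simp: strong_minimizer_def)
  moreover have "(w - v)\<^sup>2 = (v - w)\<^sup>2" by (rule power2_commute)
  ultimately show ?thesis by (simp add: algebra_simps)
qed

lemma strong_minimizer_lipschitz:
  assumes "strong_minimizer L \<theta> S p v" "strong_minimizer L \<theta> S q w" "\<theta> > 0"
  shows "\<bar>v - w\<bar> \<le> \<bar>p - q\<bar> / (2 * \<theta>)"
proof (cases "v = w")
  case False
  have "2 * \<theta> * \<bar>v - w\<bar> * \<bar>v - w\<bar> \<le> \<bar>p - q\<bar> * \<bar>v - w\<bar>"
    using strong_minimizer_monotone[OF assms(1,2)] abs_ge_self[of "(p - q) * (v - w)"]
    by (simp add: power2_eq_square abs_mult[symmetric] mult.assoc)
  then have "2 * \<theta> * \<bar>v - w\<bar> \<le> \<bar>p - q\<bar>" using False by simp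
  then show ?thesis using assms(3) by (simp add: field_simps)
qed (use assms(3) in simp)

text \<open>The Cauchy-Schwarz inequality in time, obtained from the nonnegative variance of
  \<open>g\<close> about its mean. It converts square-integral closeness of velocities into uniform
  closeness of paths.\<close>

lemma integral_square_le:
  fixes g :: "real \<Rightarrow> real"
  assumes g: "continuous_on {0..T} g" and t: "t \<in> {0..T}"
  shows "(integral {0..t} g)\<^sup>2 \<le> T * integral {0..T} (\<lambda>s. (g s)\<^sup>2)"
proof -
  have gt: "continuous_on {0..t} g" using g t by (auto intro: continuous_on_subset)
  have mono: "integral {0..t} (\<lambda>s. (g s)\<^sup>2) \<le> integral {0..T} (\<lambda>s. (g s)\<^sup>2)"
    using t g gt
    by (intro integral_subset_le integrable_continuous_real continuous_intros) auto
  have nonneg: "0 \<le> integral {0..t} (\<lambda>s. (g s)\<^sup>2)"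
    using gt by (intro Henstock_Kurzweil_Integration.integral_nonneg integrable_continuous_real
        continuous_intros) auto
  have "(integral {0..t} g)\<^sup>2 \<le> t * integral {0..t} (\<lambda>s. (g s)\<^sup>2)"
  proof (cases "t = 0")
    case False
    then have "t > 0" using t by simp
    define m where "m = integral {0..t} g"
    have "0 \<le> integral {0..t} (\<lambda>s. (g s - m / t)\<^sup>2)"
      using gt by (intro Henstock_Kurzweil_Integration.integral_nonneg integrable_continuous_real
          continuous_intros) auto
    also have "(\<lambda>s. (g s - m / t)\<^sup>2) = (\<lambda>s. (g s)\<^sup>2 - 2 * (m / t) * g s + (m / t)\<^sup>2)"
      by (simp add: fun_eq_iff power2_diff algebra_simps)
    also have "integral {0..t} \<dots> = integral {0..t} (\<lambda>s. (g s)\<^sup>2) - 2 * (m / t) * m + t * (m / t)\<^sup>2"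
    proof -
      have i: "(\<lambda>s. (g s)\<^sup>2) integrable_on {0..t}" "(\<lambda>s. 2 * (m / t) * g s) integrable_on {0..t}"
        by (intro integrable_continuous_real continuous_intros gt)+
      show ?thesis
        unfolding Henstock_Kurzweil_Integration.integral_add[OF
            Henstock_Kurzweil_Integration.integrable_diff[OF i] integrable_const_ivl]
          Henstock_Kurzweil_Integration.integral_diff[OF i]
        using \<open>t > 0\<close> by (simp add: m_def)
    qed
    also have "\<dots> = integral {0..t} (\<lambda>s. (g s)\<^sup>2) - m\<^sup>2 / t"
      using \<open>t > 0\<close> by (simp add: power2_eq_square field_simps)
    finally show ?thesis using \<open>t > 0\<close> by (simp add: m_def field_simps)
  qed simp
  also have "\<dots> \<le> T * integral {0..T} (\<lambda>s. (g s)\<^sup>2)"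
    using t mono nonneg by (intro mult_mono) auto
  finally show ?thesis .
qed

lemma abs_integral_le:
  fixes g :: "real \<Rightarrow> real"
  assumes "continuous_on {0..t} g" "\<And>s. s \<in> {0..t} \<Longrightarrow> \<bar>g s\<bar> \<le> B" "0 \<le> t"
  shows "\<bar>integral {0..t} g\<bar> \<le> B * t"
  using integral_bound[OF assms(3,1), of B] assms(2) by simp

lemma tendsto_integral_uniform_limit:
  fixes g :: "nat \<Rightarrow> real \<Rightarrow> real"
  assumes "uniform_limit {0..T} g h sequentially" "\<And>n. continuous_on {0..T} (g n)" "t \<in> {0..T}"
  shows "(\<lambda>n. integral {0..t} (g n)) \<longlonglongrightarrow> integral {0..t} h"
proof -
  have u: "uniform_limit (cbox 0 t) g h sequentially"
    using assms(1,3) by (auto intro: uniform_limit_on_subset simp: box_real)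
  have c: "continuous_on (cbox 0 t) (g n)" for n
    using assms(2)[of n] assms(3) by (auto intro: continuous_on_subset simp: box_real)
  obtain J K where J: "\<And>n. (g n has_integral J n) (cbox 0 t)" and K: "(h has_integral K) (cbox 0 t)"
    and lim: "J \<longlonglongrightarrow> K"
    by (rule uniform_limit_integral_cbox[OF u c]) auto
  have "integral {0..t} (g n) = J n" for n using J by (simp add: integral_unique box_real)
  moreover have "integral {0..t} h = K" using K by (simp add: integral_unique box_real)
  ultimately show ?thesis using lim by simp
qed

locale uniformly_convex_cost =
  fixes L :: "real \<Rightarrow> real" and \<theta> :: real
  assumes theta_pos: "\<theta> > 0"
    and L_cont: "continuous_on UNIV L"
    and L_convex: "\<And>u v c. c \<in> {0..1} \<Longrightarrow>
        L (c * u + (1 - c) * v) \<le> c * L u + (1 - c) * L v - \<theta> * c * (1 - c) * (u - v)\<^sup>2"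
begin

text \<open>Minimality is needed only near \<open>v\<close> on the segment towards \<open>u\<close>.
  Combined with \<open>L_convex\<close> it gives \<open>(1 - c) * K \<le> D\<close> for small
  \<open>c\<close>, where \<open>D\<close> is the gain from \<open>v\<close> to \<open>u\<close> and
  \<open>K\<close> the desired margin; then \<open>c\<close> tends to \<open>0\<close>.\<close>

lemma quadratic_growth:
  assumes c0: "0 < c0" "c0 \<le> 1"
    and min: "\<And>c. 0 < c \<Longrightarrow> c < c0 \<Longrightarrow> L v - p * v \<le> L (c * u + (1 - c) * v) - p * (c * u + (1 - c) * v)"
  shows "L v - p * v + \<theta> * (u - v)\<^sup>2 \<le> L u - p * u"
proof (rule ccontr)
  define D where "D = L u - p * u - (L v - p * v)"
  define K where "K = \<theta> * (u - v)\<^sup>2"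
  assume "\<not> ?thesis"
  then have KD: "D < K" by (simp add: D_def K_def)
  have *: "(1 - c) * K \<le> D" if "0 < c" "c < c0" for c
  proof -
    have "c * ((1 - c) * K) \<le> c * D"
      using min[OF that] L_convex[of c u v] that c0 by (simp add: D_def K_def algebra_simps)
    then show ?thesis using that by simp
  qed
  have K0: "K \<ge> 0" using theta_pos by (simp add: K_def)
  \<comment> \<open>If \<open>D < K\<close>, this \<open>c\<close> satisfies
    \<open>c * K < K - D\<close>, contradicting \<open>(1 - c) * K \<le> D\<close>.\<close>
  define c where "c = min (c0 / 2) ((K - D) / (2 * (K + 1)))"
  have c: "0 < c" "c < c0" using c0 KD K0 by (auto simp: c_def)
  have "c * K \<le> (K - D) / (2 * (K + 1)) * K" using K0 by (intro mult_right_mono) (auto simp: c_def)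
  also have "\<dots> < K - D" using KD K0 by (simp add: field_simps) (sos)
  finally show False using *[OF c] by (simp add: algebra_simps)
qed

lemma strong_minimizerI:
  assumes "convex S" "v \<in> S" "\<And>u. u \<in> S \<Longrightarrow> L v - p * v \<le> L u - p * u"
  shows "strong_minimizer L \<theta> S p v"
  unfolding strong_minimizer_def
proof (intro conjI ballI)
  fix u assume "u \<in> S"
  then have "c * u + (1 - c) * v \<in> S" if "0 < c" "c < 1" for c
    using convexD[OF assms(1) \<open>u \<in> S\<close> assms(2), of c "1 - c"] that by simp
  then show "L v - p * v + \<theta> * (u - v)\<^sup>2 \<le> L u - p * u"
    by (intro quadratic_growth[of 1]) (auto intro: assms(3))
qed (rule assms(2))

text \<open>From an interior point a short step towards any \<open>u\<close> stays in the interval,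
  so \<open>quadratic_growth\<close> applies to all real \<open>u\<close>. This removes the velocity
  bound once it is inactive.\<close>

lemma strong_minimizer_interior:
  assumes "strong_minimizer L \<theta> {- R..R} p v" "\<bar>v\<bar> < R"
  shows "strong_minimizer L \<theta> UNIV p v"
  unfolding strong_minimizer_def
proof (intro conjI ballI)
  fix u
  \<comment> \<open>Ensures that \<open>v + c * (u - v)\<close> stays in \<open>{- R..R}\<close> for
    \<open>c < c0\<close>.\<close>
  define c0 where "c0 = min 1 ((R - \<bar>v\<bar>) / (\<bar>u - v\<bar> + 1))"
  show "L v - p * v + \<theta> * (u - v)\<^sup>2 \<le> L u - p * u"
  proof (rule quadratic_growth)
    show "0 < c0" "c0 \<le> 1" using assms(2) by (auto simp: c0_def)
    fix c assume c: "0 < c" "c < c0"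
    have "c * \<bar>u - v\<bar> \<le> c * (\<bar>u - v\<bar> + 1)" using c by simp
    also have "\<dots> < (R - \<bar>v\<bar>) / (\<bar>u - v\<bar> + 1) * (\<bar>u - v\<bar> + 1)"
      using c by (intro mult_strict_right_mono) (auto simp: c0_def)
    also have "\<dots> = R - \<bar>v\<bar>" by simp
    finally have "\<bar>c * (u - v)\<bar> < R - \<bar>v\<bar>" using c by (simp add: abs_mult)
    moreover have "c * u + (1 - c) * v = v + c * (u - v)" by (simp add: algebra_simps)
    ultimately have "c * u + (1 - c) * v \<in> {- R..R}" by auto
    from strong_minimizerD[OF assms(1) this]
    show "L v - p * v \<le> L (c * u + (1 - c) * v) - p * (c * u + (1 - c) * v)"
      using theta_pos by (smt (verit) mult_nonneg_nonneg zero_le_power2)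
  qed
qed simp

lemma strong_minimizer_exists:
  assumes "R > 0"
  obtains \<phi> where "\<And>p. strong_minimizer L \<theta> {- R..R} p (\<phi> p)"
proof -
  have "\<exists>v. strong_minimizer L \<theta> {- R..R} p v" for p
  proof -
    have "continuous_on {- R..R} (\<lambda>u. L u - p * u)"
      by (intro continuous_intros continuous_on_subset[OF L_cont]) auto
    then obtain v where "v \<in> {- R..R}" "\<And>u. u \<in> {- R..R} \<Longrightarrow> L v - p * v \<le> L u - p * u"
      using continuous_attains_inf[of "{- R..R}" "\<lambda>u. L u - p * u"] assms by auto
    then show ?thesis using strong_minimizerI[of "{- R..R}"] by auto
  qed
  then show thesis using that by metis
qed

lemma continuous_on_L: "continuous_on S g \<Longrightarrow> continuous_on S (\<lambda>x. L (g x))"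
  by (rule continuous_on_compose2[OF L_cont]) auto

lemma strong_minimizer_continuous:
  assumes \<phi>: "\<And>p. strong_minimizer L \<theta> S p (\<phi> p)"
  shows "continuous_on UNIV \<phi>"
proof -
  have lip: "\<bar>\<phi> p - \<phi> q\<bar> \<le> \<bar>p - q\<bar> / (2 * \<theta>)" for p q
    by (rule strong_minimizer_lipschitz[OF \<phi> \<phi> theta_pos])
  have "isCont \<phi> p" for p
    unfolding isCont_def LIM_eq
  proof (intro allI impI)
    fix r :: real assume "0 < r"
    show "\<exists>s>0. \<forall>x. x \<noteq> p \<and> norm (x - p) < s \<longrightarrow> norm (\<phi> x - \<phi> p) < r"
    proof (intro exI[of _ "2 * \<theta> * r"] conjI allI impI)
      fix x assume "x \<noteq> p \<and> norm (x - p) < 2 * \<theta> * r"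
      then have "\<bar>x - p\<bar> / (2 * \<theta>) < r" using theta_pos by (simp add: field_simps)
      then show "norm (\<phi> x - \<phi> p) < r" using lip[of x p] by simp
    qed (use theta_pos \<open>0 < r\<close> in simp)
  qed
  then show ?thesis by (simp add: continuous_at_imp_continuous_on)
qed

text \<open>For a large multiplier the minimizing velocity is close to the end of the interval, so that
  by the intermediate value theorem every mean velocity below the bound is attained.\<close>

lemma multiplier_exists:
  assumes R: "R > 0" and T: "T > 0" and d: "\<bar>d\<bar> < R * T"
    and \<phi>: "\<And>p. strong_minimizer L \<theta> {- R..R} p (\<phi> p)"
  obtains M where "\<And>(g :: real \<Rightarrow> real) B. continuous_on {0..T} g \<Longrightarrow> (\<And>t. t \<in> {0..T} \<Longrightarrow> \<bar>g t\<bar> \<le> B) \<Longrightarrow>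
     \<exists>c. \<bar>c\<bar> \<le> B + M \<and> integral {0..T} (\<lambda>t. \<phi> (g t + c)) = d"
proof -
  have lip: "\<bar>\<phi> p - \<phi> q\<bar> \<le> \<bar>p - q\<bar> / (2 * \<theta>)" for p q
    by (rule strong_minimizer_lipschitz[OF \<phi> \<phi> theta_pos])
  have \<phi>_cont: "continuous_on UNIV \<phi>" by (rule strong_minimizer_continuous[OF \<phi>])
  have "bounded (L ` {- R..R})"
    by (intro compact_imp_bounded compact_continuous_image continuous_on_subset[OF L_cont]) auto
  then obtain K where K: "K > 0" "\<And>u. u \<in> {- R..R} \<Longrightarrow> \<bar>L u\<bar> \<le> K" by (auto simp: bounded_pos)
  have \<phi>R: "\<phi> p \<in> {- R..R}" for p using \<phi>[of p] by (simp add: strong_minimizer_def)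
  have opt: "L (\<phi> p) - p * \<phi> p \<le> L u - p * u" if "u \<in> {- R..R}" for p u
    using strong_minimizerD[OF \<phi> that, of p] theta_pos
    by (smt (verit) mult_nonneg_nonneg zero_le_power2)
  have upper: "p * (R - \<phi> p) \<le> 2 * K" "p * (\<phi> (- p) + R) \<le> 2 * K" for p
    using opt[of R p] opt[of "- R" "- p"] K(2)[of R] K(2)[of "- R"] K(2)[OF \<phi>R, of p] K(2)[OF \<phi>R, of "- p"] R
    by (auto simp: algebra_simps)
  \<comment> \<open>The estimate \<open>upper\<close> gives
    \<open>R - \<phi> p \<le> 2 * K / M\<close> for \<open>p \<ge> M\<close>. With this
    \<open>M\<close> the right side is \<open>R - \<bar>d\<bar> / T\<close>, hence
    \<open>\<phi> p \<ge> \<bar>d\<bar> / T\<close>. The value of \<open>M\<close> does not depend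
    on \<open>g\<close>.\<close>
  define M where "M = 2 * K * T / (R * T - \<bar>d\<bar>)"
  have M: "M > 0" using K(1) T d by (simp add: M_def)
  have end_val: "R - \<phi> p \<le> (R * T - \<bar>d\<bar>) / T" "\<phi> (- p) + R \<le> (R * T - \<bar>d\<bar>) / T" if "p \<ge> M" for p
  proof -
    have p: "p > 0" using M that by simp
    have KM: "2 * K = M * ((R * T - \<bar>d\<bar>) / T)" using T d by (simp add: M_def)
    have "M * (R - \<phi> p) \<le> p * (R - \<phi> p)" "M * (\<phi> (- p) + R) \<le> p * (\<phi> (- p) + R)"
      using that \<phi>R[of p] \<phi>R[of "- p"] by (auto intro!: mult_right_mono)
    then have "M * (R - \<phi> p) \<le> M * ((R * T - \<bar>d\<bar>) / T)"
      "M * (\<phi> (- p) + R) \<le> M * ((R * T - \<bar>d\<bar>) / T)" using upper[of p] KM by linarith+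
    then show "R - \<phi> p \<le> (R * T - \<bar>d\<bar>) / T" "\<phi> (- p) + R \<le> (R * T - \<bar>d\<bar>) / T"
      using M by (simp_all only: mult_le_cancel_left_pos)
  qed
  show thesis
  proof (rule that[of M])
    fix g :: "real \<Rightarrow> real" and B assume g: "continuous_on {0..T} g" and B: "\<And>t. t \<in> {0..T} \<Longrightarrow> \<bar>g t\<bar> \<le> B"
    have B0: "B \<ge> 0" using B[of 0] T by force
    define F where "F c = integral {0..T} (\<lambda>t. \<phi> (g t + c))" for c
    have cont: "continuous_on {0..T} (\<lambda>t. \<phi> (g t + c))" for c
      by (intro continuous_on_compose2[OF \<phi>_cont] continuous_intros g) auto
    have int: "(\<lambda>t. \<phi> (g t + c)) integrable_on {0..T}" for c
      by (rule integrable_continuous_real[OF cont])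
    have F_diff: "\<bar>F c - F c'\<bar> \<le> \<bar>c - c'\<bar> / (2 * \<theta>) * T" for c c'
    proof -
      have "F c - F c' = integral {0..T} (\<lambda>t. \<phi> (g t + c) - \<phi> (g t + c'))"
        unfolding F_def using int by (simp add: Henstock_Kurzweil_Integration.integral_diff)
      also have "\<bar>\<dots>\<bar> \<le> \<bar>c - c'\<bar> / (2 * \<theta>) * T"
        using T lip by (intro abs_integral_le continuous_intros cont) (auto simp: add_diff_cancel_left[symmetric] intro: order_trans[OF lip])
      finally show ?thesis .
    qed
    have F_cont: "continuous_on {- (B + M)..B + M} F"
      unfolding continuous_on_iff
    proof (intro ballI allI impI)
      fix x e :: real assume "0 < e"
      show "\<exists>d>0. \<forall>x'\<in>{- (B + M)..B + M}. dist x' x < d \<longrightarrow> dist (F x') (F x) < e"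
      proof (intro exI[of _ "2 * \<theta> * e / T"] conjI ballI impI)
        fix x' assume "dist x' x < 2 * \<theta> * e / T"
        then have "\<bar>x' - x\<bar> / (2 * \<theta>) * T < e" using T theta_pos by (simp add: dist_real_def field_simps)
        then show "dist (F x') (F x) < e" using F_diff[of x' x] by (simp add: dist_real_def)
      qed (use \<open>0 < e\<close> T theta_pos in simp)
    qed
    have "d \<le> F (B + M)"
    proof -
      have "integral {0..T} (\<lambda>t. \<bar>d\<bar> / T) \<le> F (B + M)" unfolding F_def
      proof (intro integral_le int)
        fix t assume "t \<in> {0..T}"
        then show "\<bar>d\<bar> / T \<le> \<phi> (g t + (B + M))"
          using end_val(1)[of "g t + (B + M)"] B[of t] T by (simp add: diff_divide_distrib abs_le_iff)
      qed auto
      then show ?thesis using T by simp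
    qed
    moreover have "F (- (B + M)) \<le> d"
    proof -
      have "F (- (B + M)) \<le> integral {0..T} (\<lambda>t. - \<bar>d\<bar> / T)" unfolding F_def
      proof (intro integral_le int)
        fix t assume "t \<in> {0..T}"
        then show "\<phi> (g t + - (B + M)) \<le> - \<bar>d\<bar> / T"
          using end_val(2)[of "- g t + (B + M)"] B[of t] T
          by (simp add: diff_divide_distrib abs_le_iff algebra_simps)
      qed auto
      then show ?thesis using T by simp
    qed
    ultimately obtain c where "- (B + M) \<le> c" "c \<le> B + M" "F c = d"
      using IVT'[of F "- (B + M)" d "B + M"] F_cont B0 M by auto
    then show "\<exists>c. \<bar>c\<bar> \<le> B + M \<and> integral {0..T} (\<lambda>t. \<phi> (g t + c)) = d"
      by (intro exI[of _ c]) (auto simp: F_def)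
  qed
qed

end

section \<open>Existence for an abstract convex potential\<close>

lemma uniform_limit_sum_zero:
  fixes g :: "'i \<Rightarrow> 'n \<Rightarrow> 'x \<Rightarrow> real"
  assumes "finite I" "\<And>i. i \<in> I \<Longrightarrow> uniform_limit S (g i) (\<lambda>_. 0) F"
  shows "uniform_limit S (\<lambda>n x. \<Sum>i\<in>I. g i n x) (\<lambda>_. 0) F"
  using assms
proof (induction I rule: finite_induct)
  case (insert i I)
  then have "uniform_limit S (\<lambda>n x. g i n x + (\<Sum>i\<in>I. g i n x)) (\<lambda>x. 0 + 0) F"
    by (intro uniform_limit_add) auto
  then show ?case using insert by simp
qed (simp add: uniform_limit_const)

text \<open>\<open>U\<close> is convex in the configuration and \<open>f\<close> is a subgradient of
  it, so the equations sought are \<open>p' = f\<close> together with the pointwise minimization of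
  \<open>L u - p * u\<close>. The strict inequality in \<open>mean_velocity\<close> leaves the room
  that \<open>multiplier_exists\<close> needs. Continuity is demanded along curves, and only in the
  components in \<open>I\<close>.\<close>

locale bounded_velocity_problem = uniformly_convex_cost +
  fixes I :: "'i set" and T R :: real
    and U :: "('i \<Rightarrow> real) \<Rightarrow> real \<Rightarrow> real" and f :: "'i \<Rightarrow> ('i \<Rightarrow> real) \<Rightarrow> real \<Rightarrow> real"
    and a b :: "'i \<Rightarrow> real"
  assumes fin: "finite I" and T_pos: "T > 0" and R_pos: "R > 0"
    and mean_velocity: "\<And>i. i \<in> I \<Longrightarrow> \<bar>b i - a i\<bar> < R * T"
    and U_gradient: "\<And>x y t. t \<in> {0..T} \<Longrightarrow> U x t + (\<Sum>i\<in>I. f i x t * (y i - x i)) \<le> U y t"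
    and U_cont: "\<And>X. (\<And>i. i \<in> I \<Longrightarrow> continuous_on {0..T} (\<lambda>t. X t i)) \<Longrightarrow>
        continuous_on {0..T} (\<lambda>t. U (X t) t)"
    and f_cont: "\<And>X i. (\<And>j. j \<in> I \<Longrightarrow> continuous_on {0..T} (\<lambda>t. X t j)) \<Longrightarrow> i \<in> I \<Longrightarrow>
        continuous_on {0..T} (\<lambda>t. f i (X t) t)"
    and f_limit: "\<And>Xn X i. (\<And>j n. j \<in> I \<Longrightarrow> continuous_on {0..T} (\<lambda>t. Xn n t j)) \<Longrightarrow>
        (\<And>j. j \<in> I \<Longrightarrow> uniform_limit {0..T} (\<lambda>n t. Xn n t j) (\<lambda>t. X t j) sequentially) \<Longrightarrow>
        i \<in> I \<Longrightarrow>
        uniform_limit {0..T} (\<lambda>n t. f i (Xn n t) t) (\<lambda>t. f i (X t) t) sequentially"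
    and f_bound: "\<And>r. \<exists>B. \<forall>i\<in>I. \<forall>t\<in>{0..T}. \<forall>x. (\<forall>j\<in>I. \<bar>x j - a j\<bar> \<le> r) \<longrightarrow> \<bar>f i x t\<bar> \<le> B"
begin

definition traj :: "(real \<Rightarrow> 'i \<Rightarrow> real) \<Rightarrow> real \<Rightarrow> 'i \<Rightarrow> real" where
  "traj v t i = a i + integral {0..t} (\<lambda>s. v s i)"

text \<open>Continuity keeps all integrals elementary, but the set is not complete for
  \<open>sq_dist\<close>. The infimum of the cost is therefore only approached, and the limit has to
  be recovered from its equations.\<close>

definition velocities :: "(real \<Rightarrow> 'i \<Rightarrow> real) set" where
  "velocities = {v. \<forall>i\<in>I. continuous_on {0..T} (\<lambda>t. v t i) \<and> (\<forall>t\<in>{0..T}. \<bar>v t i\<bar> \<le> R) \<and>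
     integral {0..T} (\<lambda>t. v t i) = b i - a i}"

definition kinetic :: "(real \<Rightarrow> 'i \<Rightarrow> real) \<Rightarrow> real" where
  "kinetic v = (\<Sum>i\<in>I. integral {0..T} (\<lambda>t. L (v t i)))"

definition cost :: "(real \<Rightarrow> 'i \<Rightarrow> real) \<Rightarrow> real" where
  "cost v = kinetic v + integral {0..T} (\<lambda>t. U (traj v t) t)"

definition sq_dist :: "(real \<Rightarrow> 'i \<Rightarrow> real) \<Rightarrow> (real \<Rightarrow> 'i \<Rightarrow> real) \<Rightarrow> real" where
  "sq_dist v w = (\<Sum>i\<in>I. integral {0..T} (\<lambda>t. (v t i - w t i)\<^sup>2))"

definition mix :: "real \<Rightarrow> (real \<Rightarrow> 'i \<Rightarrow> real) \<Rightarrow> (real \<Rightarrow> 'i \<Rightarrow> real) \<Rightarrow> real \<Rightarrow> 'i \<Rightarrow> real" where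
  "mix c v w t i = c * w t i + (1 - c) * v t i"

lemma velocitiesD:
  assumes "v \<in> velocities" "i \<in> I"
  shows "continuous_on {0..T} (\<lambda>t. v t i)" "\<And>t. t \<in> {0..T} \<Longrightarrow> \<bar>v t i\<bar> \<le> R"
    "integral {0..T} (\<lambda>t. v t i) = b i - a i"
  using assms by (auto simp: velocities_def)

lemma traj_0 [simp]: "traj v 0 i = a i" by (simp add: traj_def)

lemma traj_T: "v \<in> velocities \<Longrightarrow> i \<in> I \<Longrightarrow> traj v T i = b i"
  by (simp add: traj_def velocitiesD)

lemma traj_deriv:
  assumes "v \<in> velocities" "i \<in> I" "t \<in> {0..T}"
  shows "((\<lambda>t. traj v t i) has_real_derivative v t i) (at t within {0..T})"
  unfolding traj_def using integral_has_real_derivative[OF velocitiesD(1)[OF assms(1,2)] assms(3)]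
  by (auto intro!: derivative_eq_intros)

lemma traj_cont: "v \<in> velocities \<Longrightarrow> i \<in> I \<Longrightarrow> continuous_on {0..T} (\<lambda>t. traj v t i)"
  using traj_deriv by (rule DERIV_continuous_on)

lemma velocities_sub_cont:
  "v \<in> velocities \<Longrightarrow> i \<in> I \<Longrightarrow> t \<in> {0..T} \<Longrightarrow> continuous_on {0..t} (\<lambda>t. v t i)"
  using velocitiesD(1) by (fastforce intro: continuous_on_subset)

lemma traj_bound:
  assumes "v \<in> velocities" "i \<in> I" "t \<in> {0..T}"
  shows "\<bar>traj v t i - a i\<bar> \<le> R * T"
proof -
  have "\<bar>integral {0..t} (\<lambda>s. v s i)\<bar> \<le> R * t"
    using assms velocitiesD(2) by (intro abs_integral_le velocities_sub_cont) auto
  also have "\<dots> \<le> R * T" using assms(3) R_pos by simp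
  finally show ?thesis by (simp add: traj_def)
qed

lemma traj_diff_bound:
  assumes "v \<in> velocities" "w \<in> velocities" "i \<in> I" "t \<in> {0..T}"
  shows "\<bar>traj v t i - traj w t i\<bar> \<le> 2 * R * T"
  using traj_bound[OF assms(1,3,4)] traj_bound[OF assms(2-4)] by linarith

lemma traj_mix:
  assumes "v \<in> velocities" "w \<in> velocities" "i \<in> I" "t \<in> {0..T}"
  shows "traj (mix c v w) t i = c * traj w t i + (1 - c) * traj v t i"
proof -
  have "(\<lambda>s. v s i) integrable_on {0..t}" "(\<lambda>s. w s i) integrable_on {0..t}"
    using assms by (auto intro!: integrable_continuous_real velocities_sub_cont)
  then have "integral {0..t} (\<lambda>s. c * w s i + (1 - c) * v s i)
      = c * integral {0..t} (\<lambda>s. w s i) + (1 - c) * integral {0..t} (\<lambda>s. v s i)"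
    by (subst Henstock_Kurzweil_Integration.integral_add) (auto intro: integrable_on_mult_right)
  then show ?thesis by (simp add: traj_def mix_def algebra_simps)
qed

lemma mix_velocities:
  assumes v: "v \<in> velocities" and w: "w \<in> velocities" and c: "c \<in> {0..1}"
  shows "mix c v w \<in> velocities"
  unfolding velocities_def
proof (intro CollectI ballI conjI)
  fix i assume i: "i \<in> I"
  show "continuous_on {0..T} (\<lambda>t. mix c v w t i)"
    unfolding mix_def by (intro continuous_intros velocitiesD(1) v w i)
  show "integral {0..T} (\<lambda>t. mix c v w t i) = b i - a i"
  proof -
    have "traj (mix c v w) T i = b i"
      using traj_mix[OF v w i, of T c] traj_T[OF v i] traj_T[OF w i] T_pos by (simp add: algebra_simps)
    then show ?thesis by (simp add: traj_def)
  qed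
  fix t assume t: "t \<in> {0..T}"
  have "\<bar>mix c v w t i\<bar> \<le> c * \<bar>w t i\<bar> + (1 - c) * \<bar>v t i\<bar>"
    unfolding mix_def using c by (intro order_trans[OF abs_triangle_ineq]) (simp add: abs_mult)
  also have "\<dots> \<le> c * R + (1 - c) * R"
    using velocitiesD(2)[OF v i t] velocitiesD(2)[OF w i t] c by (intro add_mono mult_left_mono) auto
  finally show "\<bar>mix c v w t i\<bar> \<le> R" by (simp add: algebra_simps)
qed

lemma int_L: "v \<in> velocities \<Longrightarrow> i \<in> I \<Longrightarrow> (\<lambda>t. L (v t i)) integrable_on {0..T}"
  by (intro integrable_continuous_real continuous_on_L velocitiesD(1))

lemma int_sq:
  "v \<in> velocities \<Longrightarrow> w \<in> velocities \<Longrightarrow> i \<in> I \<Longrightarrow> (\<lambda>t. (v t i - w t i)\<^sup>2) integrable_on {0..T}"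
  by (intro integrable_continuous_real continuous_intros velocitiesD(1))

lemma int_U: "v \<in> velocities \<Longrightarrow> (\<lambda>t. U (traj v t) t) integrable_on {0..T}"
  by (intro integrable_continuous_real U_cont traj_cont)

lemma f_traj_cont:
  "u \<in> velocities \<Longrightarrow> i \<in> I \<Longrightarrow> continuous_on {0..T} (\<lambda>t. f i (traj u t) t)"
  by (intro f_cont traj_cont)

lemma int_f:
  "u \<in> velocities \<Longrightarrow> v \<in> velocities \<Longrightarrow> w \<in> velocities \<Longrightarrow>
    (\<lambda>t. \<Sum>i\<in>I. f i (traj u t) t * (traj w t i - traj v t i)) integrable_on {0..T}"
  by (intro integrable_continuous_real continuous_intros f_traj_cont traj_cont)

lemma kinetic_mix:
  assumes v: "v \<in> velocities" and w: "w \<in> velocities" and c: "c \<in> {0..1}"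
  shows "kinetic (mix c v w) \<le> c * kinetic w + (1 - c) * kinetic v - \<theta> * c * (1 - c) * sq_dist v w"
proof -
  have "integral {0..T} (\<lambda>t. L (mix c v w t i))
      \<le> c * integral {0..T} (\<lambda>t. L (w t i)) + (1 - c) * integral {0..T} (\<lambda>t. L (v t i))
        - \<theta> * c * (1 - c) * integral {0..T} (\<lambda>t. (v t i - w t i)\<^sup>2)" if i: "i \<in> I" for i
  proof -
    have "integral {0..T} (\<lambda>t. L (mix c v w t i)) \<le> integral {0..T} (\<lambda>t. c * L (w t i)
        + (1 - c) * L (v t i) - \<theta> * c * (1 - c) * (v t i - w t i)\<^sup>2)"
    proof (rule integral_le)
      show "L (mix c v w t i) \<le> c * L (w t i) + (1 - c) * L (v t i)
          - \<theta> * c * (1 - c) * (v t i - w t i)\<^sup>2" for t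
        unfolding mix_def using L_convex[OF c, of "w t i" "v t i"] by (simp add: power2_commute)
      show "(\<lambda>t. c * L (w t i) + (1 - c) * L (v t i) - \<theta> * c * (1 - c) * (v t i - w t i)\<^sup>2)
          integrable_on {0..T}"
        using int_L[OF v i] int_L[OF w i] int_sq[OF v w i]
        by (intro Henstock_Kurzweil_Integration.integrable_diff
            Henstock_Kurzweil_Integration.integrable_add integrable_on_mult_right)
    qed (rule int_L[OF mix_velocities[OF v w c] i])
    also have "\<dots> = c * integral {0..T} (\<lambda>t. L (w t i)) + (1 - c) * integral {0..T} (\<lambda>t. L (v t i))
        - \<theta> * c * (1 - c) * integral {0..T} (\<lambda>t. (v t i - w t i)\<^sup>2)"
      using int_L[OF v i] int_L[OF w i] int_sq[OF v w i]
      by (simp add: Henstock_Kurzweil_Integration.integral_diff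
          Henstock_Kurzweil_Integration.integral_add Henstock_Kurzweil_Integration.integrable_add
          integrable_on_mult_right)
    finally show ?thesis .
  qed
  then have "kinetic (mix c v w) \<le> (\<Sum>i\<in>I. c * integral {0..T} (\<lambda>t. L (w t i))
      + (1 - c) * integral {0..T} (\<lambda>t. L (v t i))
      - \<theta> * c * (1 - c) * integral {0..T} (\<lambda>t. (v t i - w t i)\<^sup>2))"
    unfolding kinetic_def by (intro sum_mono)
  then show ?thesis
    by (simp add: kinetic_def sq_dist_def sum.distrib sum_subtractf sum_distrib_left)
qed

lemma sq_dist_nonneg: "v \<in> velocities \<Longrightarrow> w \<in> velocities \<Longrightarrow> 0 \<le> sq_dist v w"
  unfolding sq_dist_def
  by (intro sum_nonneg Henstock_Kurzweil_Integration.integral_nonneg int_sq) auto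

text \<open>Makes near minimizers close to each other in \<open>sq_dist\<close>. The factor
  \<open>\<theta> / 4\<close> is \<open>\<theta> * c * (1 - c)\<close> at \<open>c = 1/2\<close>;
  for \<open>U\<close> the two gradient inequalities at the midpoint are added, and their linear
  terms cancel.\<close>

lemma cost_midpoint:
  assumes v: "v \<in> velocities" and w: "w \<in> velocities"
  shows "cost (mix (1/2) v w) + \<theta> / 4 * sq_dist v w \<le> (cost v + cost w) / 2"
proof -
  let ?m = "mix (1/2) v w"
  have m: "?m \<in> velocities" using v w by (rule mix_velocities) auto
  have "integral {0..T} (\<lambda>t. U (traj ?m t) t)
      \<le> integral {0..T} (\<lambda>t. (1/2) * U (traj v t) t + (1/2) * U (traj w t) t)"
  proof (rule integral_le[OF int_U[OF m]])
    show "(\<lambda>t. (1/2) * U (traj v t) t + (1/2) * U (traj w t) t) integrable_on {0..T}"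
      using int_U[OF v] int_U[OF w]
      by (intro Henstock_Kurzweil_Integration.integrable_add integrable_on_mult_right)
    fix t assume t: "t \<in> {0..T}"
    let ?g = "\<lambda>i. f i (traj ?m t) t"
    have "(\<Sum>i\<in>I. ?g i * (traj v t i - traj ?m t i)) + (\<Sum>i\<in>I. ?g i * (traj w t i - traj ?m t i)) = 0"
      unfolding sum.distrib[symmetric]
    proof (rule sum.neutral, rule ballI)
      fix i assume i: "i \<in> I"
      show "?g i * (traj v t i - traj ?m t i) + ?g i * (traj w t i - traj ?m t i) = 0"
        unfolding traj_mix[OF v w i t] by (simp add: field_simps)
    qed
    then show "U (traj ?m t) t \<le> (1/2) * U (traj v t) t + (1/2) * U (traj w t) t"
      using U_gradient[OF t, of "traj ?m t" "traj v t"] U_gradient[OF t, of "traj ?m t" "traj w t"]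
      by linarith
  qed
  also have "\<dots> = (1/2) * integral {0..T} (\<lambda>t. U (traj v t) t) + (1/2) * integral {0..T} (\<lambda>t. U (traj w t) t)"
    using int_U[OF v] int_U[OF w]
    by (subst Henstock_Kurzweil_Integration.integral_add) (auto simp: integrable_on_mult_right)
  finally show ?thesis
    using kinetic_mix[OF v w, of "1/2"] by (simp add: cost_def field_simps)
qed

text \<open>A first-order upper bound for moving from \<open>v\<close> towards \<open>w\<close>.
  Convexity gives an upper bound only if the gradient is taken at the mixed path; replacing it by
  the gradient at \<open>v\<close> is the error \<open>E\<close> in
  \<open>constrained_solution\<close>.\<close>

lemma cost_mix:
  assumes v: "v \<in> velocities" and w: "w \<in> velocities" and c: "c \<in> {0..1}"
  shows "cost (mix c v w) \<le> cost v + c * (kinetic w - kinetic v +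
    integral {0..T} (\<lambda>t. \<Sum>i\<in>I. f i (traj (mix c v w) t) t * (traj w t i - traj v t i)))"
proof -
  let ?m = "mix c v w"
  let ?h = "\<lambda>t. \<Sum>i\<in>I. f i (traj ?m t) t * (traj w t i - traj v t i)"
  have m: "?m \<in> velocities" using v w c by (rule mix_velocities)
  have "integral {0..T} (\<lambda>t. U (traj ?m t) t) \<le> integral {0..T} (\<lambda>t. U (traj v t) t + c * ?h t)"
  proof (rule integral_le[OF int_U[OF m]])
    show "(\<lambda>t. U (traj v t) t + c * ?h t) integrable_on {0..T}"
      by (intro Henstock_Kurzweil_Integration.integrable_add integrable_on_mult_right int_U int_f v w m)
    fix t assume t: "t \<in> {0..T}"
    have "(\<Sum>i\<in>I. f i (traj ?m t) t * (traj v t i - traj ?m t i)) = - c * ?h t"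
      unfolding sum_distrib_left
    proof (rule sum.cong[OF refl])
      fix i assume i: "i \<in> I"
      show "f i (traj ?m t) t * (traj v t i - traj ?m t i)
          = - c * (f i (traj ?m t) t * (traj w t i - traj v t i))"
        by (subst traj_mix[OF v w i t]) (simp add: algebra_simps)
    qed
    then show "U (traj ?m t) t \<le> U (traj v t) t + c * ?h t"
      using U_gradient[OF t, of "traj ?m t" "traj v t"] by simp
  qed
  also have "\<dots> = integral {0..T} (\<lambda>t. U (traj v t) t) + c * integral {0..T} ?h"
    using int_U[OF v] int_f[OF m v w]
    by (subst Henstock_Kurzweil_Integration.integral_add) (auto simp: integrable_on_mult_right)
  finally have "integral {0..T} (\<lambda>t. U (traj ?m t) t)
    \<le> integral {0..T} (\<lambda>t. U (traj v t) t) + c * integral {0..T} ?h" .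
  moreover have "kinetic ?m \<le> c * kinetic w + (1 - c) * kinetic v"
    using kinetic_mix[OF v w c] sq_dist_nonneg[OF v w] c theta_pos
    by (smt (verit) atLeastAtMost_iff mult_nonneg_nonneg)
  ultimately show ?thesis by (simp add: cost_def algebra_simps)
qed

text \<open>The linearized problem at \<open>v\<close> is solved by the velocities \<open>z\<close> that minimize \<open>L u - p u\<close>
  pointwise, where \<open>p\<close> integrates the forces along the path of \<open>v\<close>.\<close>

lemma kinetic_calibration:
  assumes v: "v \<in> velocities" and z: "z \<in> velocities"
    and p: "\<And>t i. t \<in> {0..T} \<Longrightarrow> i \<in> I \<Longrightarrow>
        ((\<lambda>t. p t i) has_real_derivative f i (traj v t) t) (at t within {0..T})"
    and opt: "\<And>t i. t \<in> {0..T} \<Longrightarrow> i \<in> I \<Longrightarrow> strong_minimizer L \<theta> {- R..R} (p t i) (z t i)"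
  shows "kinetic z + \<theta> * sq_dist v z
      + integral {0..T} (\<lambda>t. \<Sum>i\<in>I. f i (traj v t) t * (traj z t i - traj v t i)) \<le> kinetic v"
proof -
  have p_cont: "continuous_on {0..T} (\<lambda>t. p t i)" if "i \<in> I" for i
    using p[OF _ that] by (rule DERIV_continuous_on)
  have one: "integral {0..T} (\<lambda>t. L (z t i)) + \<theta> * integral {0..T} (\<lambda>t. (v t i - z t i)\<^sup>2)
      + integral {0..T} (\<lambda>t. f i (traj v t) t * (traj z t i - traj v t i))
      \<le> integral {0..T} (\<lambda>t. L (v t i))" if i: "i \<in> I" for i
  proof -
    let ?F = "\<lambda>t. f i (traj v t) t * (traj z t i - traj v t i)"
    let ?q = "\<lambda>t. p t i * (z t i - v t i)"
    have intF: "?F integrable_on {0..T}"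
      by (intro integrable_continuous_real continuous_intros f_traj_cont traj_cont v z i)
    have intq: "?q integrable_on {0..T}"
      by (intro integrable_continuous_real continuous_intros p_cont velocitiesD(1) v z i)
    \<comment> \<open>Integration by parts: the two paths share their end points, so
      \<open>p * (traj z - traj v)\<close> has no boundary values.\<close>
    have "((\<lambda>t. ?F t + ?q t) has_integral
        p T i * (traj z T i - traj v T i) - p 0 i * (traj z 0 i - traj v 0 i)) {0..T}"
    proof (rule fundamental_theorem_of_calculus)
      fix t assume t: "t \<in> {0..T}"
      show "((\<lambda>t. p t i * (traj z t i - traj v t i)) has_vector_derivative ?F t + ?q t) (at t within {0..T})"
        unfolding has_real_derivative_iff_has_vector_derivative[symmetric]
        by (rule derivative_eq_intros p[OF t i] traj_deriv v z i t refl)+ (simp add: algebra_simps)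
    qed (use T_pos in simp)
    then have "((\<lambda>t. ?F t + ?q t) has_integral 0) {0..T}" using traj_T[OF v i] traj_T[OF z i] by simp
    then have ibp: "integral {0..T} ?F = - integral {0..T} ?q"
      using intF intq Henstock_Kurzweil_Integration.integral_add[OF intF intq] by (simp add: integral_unique)
    have "integral {0..T} (\<lambda>t. L (z t i) + \<theta> * (v t i - z t i)\<^sup>2 - ?q t) \<le> integral {0..T} (\<lambda>t. L (v t i))"
    proof (rule integral_le)
      show "(\<lambda>t. L (z t i) + \<theta> * (v t i - z t i)\<^sup>2 - ?q t) integrable_on {0..T}"
        using int_L[OF z i] int_sq[OF v z i] intq
        by (intro Henstock_Kurzweil_Integration.integrable_diff
            Henstock_Kurzweil_Integration.integrable_add integrable_on_mult_right)
      show "(\<lambda>t. L (v t i)) integrable_on {0..T}" by (rule int_L[OF v i])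
      fix t assume t: "t \<in> {0..T}"
      have "v t i \<in> {- R..R}" using velocitiesD(2)[OF v i t] by auto
      from strong_minimizerD[OF opt[OF t i] this]
      show "L (z t i) + \<theta> * (v t i - z t i)\<^sup>2 - ?q t \<le> L (v t i)" by (simp add: algebra_simps)
    qed
    also have "integral {0..T} (\<lambda>t. L (z t i) + \<theta> * (v t i - z t i)\<^sup>2 - ?q t)
      = integral {0..T} (\<lambda>t. L (z t i)) + \<theta> * integral {0..T} (\<lambda>t. (v t i - z t i)\<^sup>2) - integral {0..T} ?q"
      using int_L[OF z i] int_sq[OF v z i] intq
      by (simp add: Henstock_Kurzweil_Integration.integral_diff
          Henstock_Kurzweil_Integration.integral_add Henstock_Kurzweil_Integration.integrable_add
          integrable_on_mult_right)
    finally show ?thesis using ibp by simp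
  qed
  have "integral {0..T} (\<lambda>t. \<Sum>i\<in>I. f i (traj v t) t * (traj z t i - traj v t i))
      = (\<Sum>i\<in>I. integral {0..T} (\<lambda>t. f i (traj v t) t * (traj z t i - traj v t i)))"
    by (intro integral_sum fin integrable_continuous_real continuous_intros f_traj_cont traj_cont v z)
  then show ?thesis
    using sum_mono[OF one, of I "\<lambda>i. i"] unfolding kinetic_def sq_dist_def
    by (simp add: sum.distrib sum_distrib_left)
qed

lemma traj_sq_dist:
  assumes v: "v \<in> velocities" and w: "w \<in> velocities" and i: "i \<in> I" and t: "t \<in> {0..T}"
  shows "(traj v t i - traj w t i)\<^sup>2 \<le> T * sq_dist v w"
proof -
  let ?g = "\<lambda>s. v s i - w s i"
  have "traj v t i - traj w t i = integral {0..t} ?g"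
    unfolding traj_def using velocities_sub_cont[OF _ i t] v w
    by (subst Henstock_Kurzweil_Integration.integral_diff) (auto intro: integrable_continuous_real)
  then have "(traj v t i - traj w t i)\<^sup>2 \<le> T * integral {0..T} (\<lambda>s. (?g s)\<^sup>2)"
    using integral_square_le[of T ?g t] t v w i by (simp add: continuous_on_diff velocitiesD(1))
  also have "\<dots> \<le> T * sq_dist v w"
    unfolding sq_dist_def using T_pos i
    by (intro mult_left_mono member_le_sum fin Henstock_Kurzweil_Integration.integral_nonneg int_sq v w) auto
  finally show ?thesis .
qed

text \<open>Velocities are bounded, so the kinetic part is. The potential lies above its
  linearization at the constant path \<open>a\<close>, on which the gradient is bounded.\<close>

lemma cost_bdd_below: "bdd_below (cost ` velocities)"
proof -
  obtain B where B: "\<And>i t x. i \<in> I \<Longrightarrow> t \<in> {0..T} \<Longrightarrow> (\<forall>j\<in>I. \<bar>x j - a j\<bar> \<le> R * T) \<Longrightarrow> \<bar>f i x t\<bar> \<le> B"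
    using f_bound[of "R * T"] by blast
  have "bounded (L ` {- R..R})"
    by (intro compact_imp_bounded compact_continuous_image continuous_on_subset[OF L_cont]) auto
  then obtain K where "\<forall>x\<in>L ` {- R..R}. norm x \<le> K" unfolding bounded_iff by blast
  then have K: "\<bar>L u\<bar> \<le> K" if "u \<in> {- R..R}" for u using that by auto
  have int: "(\<lambda>t. U a t) integrable_on {0..T}"
    by (intro integrable_continuous_real U_cont) auto
  have "(\<Sum>i\<in>I. - (K * T)) + (integral {0..T} (\<lambda>t. U a t) - real (card I) * B * (R * T) * T) \<le> cost v"
    if v: "v \<in> velocities" for v
    unfolding cost_def kinetic_def
  proof (intro add_mono sum_mono)
    fix i assume i: "i \<in> I"
    have "\<bar>integral {0..T} (\<lambda>t. L (v t i))\<bar> \<le> K * T"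
    proof (rule abs_integral_le)
      show "\<bar>L (v t i)\<bar> \<le> K" if "t \<in> {0..T}" for t
        using velocitiesD(2)[OF v i that] by (intro K) auto
    qed (use T_pos continuous_on_L[OF velocitiesD(1)[OF v i]] in auto)
    then show "- (K * T) \<le> integral {0..T} (\<lambda>t. L (v t i))" by linarith
  next
    have "integral {0..T} (\<lambda>t. U a t - real (card I) * B * (R * T)) \<le> integral {0..T} (\<lambda>t. U (traj v t) t)"
    proof (rule integral_le)
      show "(\<lambda>t. U a t - real (card I) * B * (R * T)) integrable_on {0..T}"
        by (intro Henstock_Kurzweil_Integration.integrable_diff int) auto
      fix t assume t: "t \<in> {0..T}"
      have "\<bar>\<Sum>i\<in>I. f i a t * (traj v t i - a i)\<bar> \<le> (\<Sum>i\<in>I. B * (R * T))"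
      proof (intro order_trans[OF sum_abs] sum_mono)
        fix i assume i: "i \<in> I"
        have "\<bar>f i a t\<bar> \<le> B" using i t T_pos R_pos by (intro B) auto
        then show "\<bar>f i a t * (traj v t i - a i)\<bar> \<le> B * (R * T)"
          using traj_bound[OF v i t] unfolding abs_mult by (intro mult_mono) auto
      qed
      then show "U a t - real (card I) * B * (R * T) \<le> U (traj v t) t"
        using U_gradient[OF t, of a "traj v t"] by (simp add: mult.assoc)
    qed (rule int_U[OF v])
    then show "integral {0..T} (\<lambda>t. U a t) - real (card I) * B * (R * T) * T
        \<le> integral {0..T} (\<lambda>t. U (traj v t) t)"
      unfolding Henstock_Kurzweil_Integration.integral_diff[OF int integrable_const_ivl]
      using T_pos by (simp add: mult_ac)
  qed
  then show ?thesis by (auto simp: bdd_below_def)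
qed

lemma velocities_nonempty: "velocities \<noteq> {}"
proof -
  have "(\<lambda>t i. (b i - a i) / T) \<in> velocities"
    using T_pos mean_velocity unfolding velocities_def
    by (auto simp: abs_divide pos_divide_le_eq less_imp_le)
  then show ?thesis by blast
qed

text \<open>\<open>V n\<close> are near minimizers and \<open>Z n\<close> solves the problem
  linearized at \<open>V n\<close>. A step of size \<open>s n\<close> from \<open>V n\<close>
  towards \<open>Z n\<close> lowers the cost by less than \<open>\<epsilon> n\<close>, whereas
  \<open>kinetic_calibration\<close> predicts a decrease of
  \<open>s n * \<theta> * sq_dist (V n) (Z n)\<close> up to a small error. So both sequences of
  paths have the same limit, and the explicit velocities of \<open>Z n\<close> identify it.\<close>

theorem constrained_solution:
  obtains X p v where
    "\<And>i. i \<in> I \<Longrightarrow> X 0 i = a i" "\<And>i. i \<in> I \<Longrightarrow> X T i = b i"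
    "\<And>i t. i \<in> I \<Longrightarrow> t \<in> {0..T} \<Longrightarrow>
       ((\<lambda>t. X t i) has_real_derivative v t i) (at t within {0..T})"
    "\<And>i t. i \<in> I \<Longrightarrow> t \<in> {0..T} \<Longrightarrow>
       ((\<lambda>t. p t i) has_real_derivative f i (X t) t) (at t within {0..T})"
    "\<And>i. i \<in> I \<Longrightarrow> continuous_on {0..T} (\<lambda>t. v t i)"
    "\<And>i t. i \<in> I \<Longrightarrow> t \<in> {0..T} \<Longrightarrow> strong_minimizer L \<theta> {- R..R} (p t i) (v t i)"
proof -
  obtain \<phi> where \<phi>: "\<And>p. strong_minimizer L \<theta> {- R..R} p (\<phi> p)"
    using strong_minimizer_exists[OF R_pos] by metis
  have \<phi>_cont: "continuous_on UNIV \<phi>" by (rule strong_minimizer_continuous[OF \<phi>])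
  have \<phi>R: "\<bar>\<phi> p\<bar> \<le> R" for p using \<phi>[of p] by (auto simp: strong_minimizer_def)
  define m where "m = Inf (cost ` velocities)"
  have low: "m \<le> cost u" if "u \<in> velocities" for u
    unfolding m_def using that by (intro cInf_lower cost_bdd_below) auto
  \<comment> \<open>The square of the step size \<open>s n\<close> used below: after division by
    \<open>s n\<close> the error is still \<open>s n\<close>, which tends to
    \<open>0\<close>.\<close>
  define \<epsilon> :: "nat \<Rightarrow> real" where "\<epsilon> n = inverse (real (Suc n)) ^ 2" for n
  have "\<exists>u\<in>velocities. cost u < m + \<epsilon> n" for n
    using cInf_lessD[of "cost ` velocities" "m + \<epsilon> n"] velocities_nonempty
    by (auto simp: m_def \<epsilon>_def)
  then obtain V where V: "\<And>n. V n \<in> velocities" "\<And>n. cost (V n) < m + \<epsilon> n" by metis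
  have \<epsilon>_le: "\<epsilon> n \<le> inverse (real (Suc n))" for n
    unfolding \<epsilon>_def power2_eq_square
    by (rule mult_left_le_one_le) (auto simp: inverse_le_1_iff)
  have V_close: "sq_dist (V n) (V k) \<le> 2 / \<theta> * (\<epsilon> n + \<epsilon> k)" for n k
  proof -
    have "mix (1/2) (V n) (V k) \<in> velocities" using V(1) V(1) by (rule mix_velocities) auto
    then have "\<theta> / 4 * sq_dist (V n) (V k) \<le> (\<epsilon> n + \<epsilon> k) / 2"
      using low cost_midpoint[OF V(1) V(1), of n k] V(2)[of n] V(2)[of k] by fastforce
    then show ?thesis using theta_pos by (simp add: field_simps)
  qed
  have "uniformly_convergent_on {0..T} (\<lambda>n t. traj (V n) t i)" if i: "i \<in> I" for i
  proof (intro Cauchy_uniformly_convergent uniformly_Cauchy_onI')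
    fix e :: real assume e: "e > 0"
    \<comment> \<open>From \<open>V_close\<close> and \<open>traj_sq_dist\<close>, squared distances
      beyond \<open>N\<close> are at most \<open>T * (2 / \<theta>) * (2 / (N + 1))\<close>, which
      is now below \<open>e\<^sup>2\<close>.\<close>
    obtain N where N: "real N > 4 * T / (\<theta> * e\<^sup>2)" using reals_Archimedean2 by blast
    have "dist (traj (V k) t i) (traj (V n) t i) < e" if "t \<in> {0..T}" "k \<ge> N" "n > k" for t k n
    proof -
      have "\<epsilon> j \<le> inverse (real (Suc N))" if "j \<ge> N" for j
        using \<epsilon>_le[of j] that by (intro order_trans[OF \<epsilon>_le]) (auto simp: field_simps)
      then have "\<epsilon> k + \<epsilon> n \<le> 2 * inverse (real (Suc N))" using that(2,3) by (smt (verit) less_imp_le_nat order_trans)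
      then have "(traj (V k) t i - traj (V n) t i)\<^sup>2 \<le> T * (2 / \<theta> * (2 * inverse (real (Suc N))))"
        using V_close[of k n] T_pos theta_pos
        by (intro order_trans[OF traj_sq_dist[OF V(1) V(1) i that(1)]] mult_left_mono
            order_trans[OF V_close]) auto
      also have "\<dots> < e\<^sup>2"
      proof -
        have "4 * T / (\<theta> * e\<^sup>2) < real (Suc N)" using N by simp
        then have "4 * T < real (Suc N) * (\<theta> * e\<^sup>2)"
          using theta_pos e by (subst (asm) pos_divide_less_eq) simp_all
        then have "4 * T < e\<^sup>2 * (\<theta> * real (Suc N))" by (simp add: mult_ac)
        then have "4 * T / (\<theta> * real (Suc N)) < e\<^sup>2"
          using theta_pos by (subst pos_divide_less_eq) simp_all
        then show ?thesis by (simp add: divide_inverse mult_ac)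
      qed
      finally have "\<bar>traj (V k) t i - traj (V n) t i\<bar>\<^sup>2 < e\<^sup>2" by simp
      then have "\<bar>traj (V k) t i - traj (V n) t i\<bar> < e"
        by (rule power2_less_imp_less) (use e in simp)
      then show ?thesis by (simp add: dist_real_def)
    qed
    then show "\<exists>M. \<forall>x\<in>{0..T}. \<forall>m\<ge>M. \<forall>n>m. dist (traj (V m) x i) (traj (V n) x i) < e" by blast
  qed
  then have "\<forall>i\<in>I. \<exists>l. uniform_limit {0..T} (\<lambda>n t. traj (V n) t i) l sequentially"
    unfolding uniformly_convergent_on_def by blast
  then obtain X0 where X0: "\<And>i. i \<in> I \<Longrightarrow> uniform_limit {0..T} (\<lambda>n t. traj (V n) t i) (X0 i) sequentially"
    by metis
  define X where "X t i = X0 i t" for t i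
  have X: "uniform_limit {0..T} (\<lambda>n t. traj (V n) t i) (\<lambda>t. X t i) sequentially" if "i \<in> I" for i
    using X0[OF that] by (simp add: X_def)
  have X_cont: "continuous_on {0..T} (\<lambda>t. X t i)" if "i \<in> I" for i
    by (rule uniform_limit_theorem[OF _ X[OF that]]) (auto intro: always_eventually traj_cont V that)
  define P where "P n t i = integral {0..t} (\<lambda>s. f i (traj (V n) s) s)" for n t i
  obtain B where B: "\<And>i t x. i \<in> I \<Longrightarrow> t \<in> {0..T} \<Longrightarrow> (\<forall>j\<in>I. \<bar>x j - a j\<bar> \<le> R * T) \<Longrightarrow> \<bar>f i x t\<bar> \<le> B"
    using f_bound[of "R * T"] by blast
  have fV: "continuous_on {0..T} (\<lambda>s. f i (traj (V n) s) s)" if "i \<in> I" for i n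
    by (intro f_traj_cont V that)
  have P_deriv: "((\<lambda>t. P n t i) has_real_derivative f i (traj (V n) t) t) (at t within {0..T})"
    if "i \<in> I" "t \<in> {0..T}" for n t i
    unfolding P_def by (rule integral_has_real_derivative[OF fV[OF that(1)] that(2)])
  have P_cont: "continuous_on {0..T} (\<lambda>t. P n t i)" if "i \<in> I" for n i
    using P_deriv[OF that] by (rule DERIV_continuous_on)
  have P_bound: "\<bar>P n t i\<bar> \<le> \<bar>B\<bar> * T" if i: "i \<in> I" and t: "t \<in> {0..T}" for n t i
  proof -
    have "\<bar>P n t i\<bar> \<le> \<bar>B\<bar> * t" unfolding P_def
    proof (rule abs_integral_le)
      show "continuous_on {0..t} (\<lambda>s. f i (traj (V n) s) s)"
        by (rule continuous_on_subset[OF fV[OF i]]) (use t in auto)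
      show "\<bar>f i (traj (V n) s) s\<bar> \<le> \<bar>B\<bar>" if "s \<in> {0..t}" for s
        using that t i by (intro order_trans[OF B]) (auto intro: traj_bound V)
    qed (use t in auto)
    also have "\<dots> \<le> \<bar>B\<bar> * T" using t by (intro mult_left_mono) auto
    finally show ?thesis .
  qed
  \<comment> \<open>The constant \<open>c\<close> fixes the mean velocity. Its bound is uniform in
    \<open>n\<close>, since \<open>M\<close> is the same for all forces and \<open>P n\<close> is
    uniformly bounded; this gives a convergent subsequence of multipliers later.\<close>
  let ?mult = "\<lambda>M n i c. \<bar>c\<bar> \<le> \<bar>B\<bar> * T + M \<and> integral {0..T} (\<lambda>t. \<phi> (P n t i + c)) = b i - a i"
  have "\<exists>M. \<forall>n. \<exists>c. ?mult M n i c" if i: "i \<in> I" for i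
  proof -
    obtain M where "\<And>(g :: real \<Rightarrow> real) B. continuous_on {0..T} g \<Longrightarrow> (\<And>t. t \<in> {0..T} \<Longrightarrow> \<bar>g t\<bar> \<le> B) \<Longrightarrow>
        \<exists>c. \<bar>c\<bar> \<le> B + M \<and> integral {0..T} (\<lambda>t. \<phi> (g t + c)) = b i - a i"
      by (rule multiplier_exists[OF R_pos T_pos mean_velocity[OF i] \<phi>]) (rule that, blast)
    from this[OF P_cont[OF i] P_bound[OF i]] show ?thesis by blast
  qed
  then have "\<forall>i\<in>I. \<exists>M. \<forall>n. \<exists>c. ?mult M n i c" by blast
  then obtain M where M: "\<forall>i\<in>I. \<forall>n. \<exists>c. ?mult (M i) n i c" by (rule bchoice[THEN exE])
  have "\<forall>i\<in>I. \<exists>c. \<forall>n. ?mult (M i) n i (c n)"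
  proof
    fix i assume "i \<in> I"
    then have "\<forall>n. \<exists>c. ?mult (M i) n i c" by (rule M[THEN bspec])
    then show "\<exists>c. \<forall>n. ?mult (M i) n i (c n)" by (rule choice)
  qed
  then obtain c' where c': "\<forall>i\<in>I. \<forall>n. ?mult (M i) n i (c' i n)" by (rule bchoice[THEN exE])
  define c where "c n i = c' i n" for n i
  have c0: "?mult (M i) n i (c n i)" if "i \<in> I" for n i
    unfolding c_def by (rule c'[THEN bspec, OF that, THEN spec])
  have c: "\<bar>c n i\<bar> \<le> \<bar>B\<bar> * T + M i"
    "integral {0..T} (\<lambda>t. \<phi> (P n t i + c n i)) = b i - a i" if "i \<in> I" for n i
    by (rule c0[OF that, THEN conjunct1], rule c0[OF that, THEN conjunct2])
  define Z where "Z n t i = \<phi> (P n t i + c n i)" for n t i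
  have Z: "Z n \<in> velocities" for n
    unfolding velocities_def Z_def using c(2) \<phi>R
    by (auto intro!: continuous_on_compose2[OF \<phi>_cont] continuous_intros P_cont)
  define s :: "nat \<Rightarrow> real" where "s n = inverse (real (Suc n))" for n
  have s: "s n \<in> {0..1}" "s n > 0" for n by (auto simp: s_def inverse_le_1_iff)
  have s_lim: "s \<longlonglongrightarrow> 0" unfolding s_def by (rule LIMSEQ_inverse_real_of_nat)
  let ?Y = "\<lambda>n. mix (s n) (V n) (Z n)"
  have Y: "?Y n \<in> velocities" for n by (intro mix_velocities V Z s)
  have Y_lim: "uniform_limit {0..T} (\<lambda>n t. traj (?Y n) t i) (\<lambda>t. X t i) sequentially" if i: "i \<in> I" for i
  proof -
    have "uniform_limit {0..T} (\<lambda>n t. s n * (traj (Z n) t i - traj (V n) t i)) (\<lambda>t. 0) sequentially"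
    proof (rule uniform_limit_null_comparison)
      show "\<forall>\<^sub>F n in sequentially. \<forall>t\<in>{0..T}. norm (s n * (traj (Z n) t i - traj (V n) t i)) \<le> s n * (2 * R * T)"
      proof (intro always_eventually allI ballI)
        fix n t assume "t \<in> {0..T}"
        then show "norm (s n * (traj (Z n) t i - traj (V n) t i)) \<le> s n * (2 * R * T)"
          unfolding real_norm_def abs_mult abs_of_pos[OF s(2)]
          using s(2)[of n] by (intro mult_left_mono traj_diff_bound Z V i) auto
      qed
      have "(\<lambda>n. s n * (2 * R * T)) \<longlonglongrightarrow> 0" by (rule tendsto_mult_left_zero[OF s_lim])
      then show "uniform_limit {0..T} (\<lambda>n t. s n * (2 * R * T)) (\<lambda>t. 0) sequentially"
        by (intro uniform_limitI) (auto dest: tendstoD elim: eventually_mono)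
    qed
    from uniform_limit_add[OF X[OF i] this]
    have "uniform_limit {0..T} (\<lambda>n t. traj (V n) t i + s n * (traj (Z n) t i - traj (V n) t i))
       (\<lambda>t. X t i) sequentially" by simp
    then show ?thesis
      by (rule uniform_limit_cong'[THEN iffD1, rotated 2]) (auto simp: traj_mix[OF V(1) Z i] algebra_simps)
  qed
  \<comment> \<open>The error of evaluating the force along the mixed path rather than along
    \<open>V n\<close>. Both paths converge uniformly to \<open>X\<close>, because the step
    \<open>s n\<close> tends to \<open>0\<close>, so the error vanishes in the limit.\<close>
  define E where "E n t = (\<Sum>i\<in>I. (f i (traj (?Y n) t) t - f i (traj (V n) t) t)
      * (traj (Z n) t i - traj (V n) t i))" for n t
  have E_cont: "continuous_on {0..T} (E n)" for n
    unfolding E_def by (intro continuous_intros f_traj_cont traj_cont Y V Z)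
  have E_lim: "uniform_limit {0..T} E (\<lambda>t. 0) sequentially"
  proof (rule uniform_limit_null_comparison)
    show "\<forall>\<^sub>F n in sequentially. \<forall>t\<in>{0..T}. norm (E n t)
      \<le> (\<Sum>i\<in>I. \<bar>f i (traj (?Y n) t) t - f i (traj (V n) t) t\<bar> * (2 * R * T))"
    proof (intro always_eventually allI ballI)
      fix n t assume "t \<in> {0..T}"
      then show "norm (E n t) \<le> (\<Sum>i\<in>I. \<bar>f i (traj (?Y n) t) t - f i (traj (V n) t) t\<bar> * (2 * R * T))"
        unfolding E_def real_norm_def
        by (intro order_trans[OF sum_abs] sum_mono, unfold abs_mult)
          (intro mult_left_mono traj_diff_bound Z V abs_ge_zero)
    qed
    have "uniform_limit {0..T} (\<lambda>n t. \<bar>f i (traj (?Y n) t) t - f i (traj (V n) t) t\<bar> * (2 * R * T)) (\<lambda>t. 0) sequentially"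
      if i: "i \<in> I" for i
    proof -
      have "uniform_limit {0..T} (\<lambda>n t. f i (traj (?Y n) t) t - f i (traj (V n) t) t)
          (\<lambda>t. f i (X t) t - f i (X t) t) sequentially"
        by (intro uniform_limit_minus f_limit i X Y_lim traj_cont Y V)
      from bounded_linear.uniform_limit[OF bounded_linear_mult_left uniform_limit_norm[OF this], of "2 * R * T"]
      show ?thesis by simp
    qed
    from uniform_limit_sum_zero[OF fin this]
    show "uniform_limit {0..T} (\<lambda>n t. \<Sum>i\<in>I. \<bar>f i (traj (?Y n) t) t - f i (traj (V n) t) t\<bar> * (2 * R * T))
       (\<lambda>t. 0) sequentially" .
  qed
  have "(\<lambda>n. integral {0..T} (E n)) \<longlonglongrightarrow> integral {0..T} (\<lambda>t. 0)"
    using T_pos by (intro tendsto_integral_uniform_limit[OF E_lim E_cont]) auto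
  then have E_int: "(\<lambda>n. s n + integral {0..T} (E n)) \<longlonglongrightarrow> 0"
    using tendsto_add[OF s_lim] by fastforce
  have D_bound: "\<theta> * sq_dist (V n) (Z n) \<le> s n + integral {0..T} (E n)" for n
  proof -
    let ?hY = "\<lambda>t. \<Sum>i\<in>I. f i (traj (?Y n) t) t * (traj (Z n) t i - traj (V n) t i)"
    let ?hV = "\<lambda>t. \<Sum>i\<in>I. f i (traj (V n) t) t * (traj (Z n) t i - traj (V n) t i)"
    have "E n = (\<lambda>t. ?hY t - ?hV t)"
      by (simp add: E_def fun_eq_iff sum_subtractf left_diff_distrib)
    then have IE: "integral {0..T} (E n) = integral {0..T} ?hY - integral {0..T} ?hV"
      using int_f[OF Y V(1) Z] int_f[OF V(1) V(1) Z]
      by (simp add: Henstock_Kurzweil_Integration.integral_diff)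
    have cal: "kinetic (Z n) + \<theta> * sq_dist (V n) (Z n) + integral {0..T} ?hV \<le> kinetic (V n)"
    proof (rule kinetic_calibration[OF V(1) Z, of "\<lambda>t i. P n t i + c n i"])
      show "((\<lambda>t. P n t i + c n i) has_real_derivative f i (traj (V n) t) t) (at t within {0..T})"
        if "t \<in> {0..T}" "i \<in> I" for t i
        using P_deriv[OF that(2,1), of n] by (auto intro!: derivative_eq_intros)
    qed (simp add: Z_def \<phi>)
    have "- \<epsilon> n \<le> s n * (kinetic (Z n) - kinetic (V n) + integral {0..T} ?hY)"
      using cost_mix[OF V(1) Z s(1), of n n n] low[OF Y, of n] V(2)[of n] by linarith
    also have "\<dots> \<le> s n * (integral {0..T} (E n) - \<theta> * sq_dist (V n) (Z n))"
      using cal IE s(2)[of n] by (intro mult_left_mono) auto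
    finally have "s n * (\<theta> * sq_dist (V n) (Z n)) \<le> s n * (s n + integral {0..T} (E n))"
      by (simp add: \<epsilon>_def s_def power2_eq_square algebra_simps)
    then show ?thesis using s(2)[of n] by simp
  qed
  have "(\<lambda>n. \<theta> * sq_dist (V n) (Z n)) \<longlonglongrightarrow> 0"
    using D_bound theta_pos sq_dist_nonneg[OF V(1) Z]
    by (intro tendsto_sandwich[OF _ _ tendsto_const E_int]) auto
  then have D_lim: "(\<lambda>n. sq_dist (V n) (Z n)) \<longlonglongrightarrow> 0"
    using tendsto_mult_left[of "\<lambda>n. \<theta> * sq_dist (V n) (Z n)" 0 sequentially "1 / \<theta>"] theta_pos by simp
  have close: "(\<lambda>n. traj (V n) t i - traj (Z n) t i) \<longlonglongrightarrow> 0" if i: "i \<in> I" and t: "t \<in> {0..T}" for i t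
  proof -
    have TD: "(\<lambda>n. T * sq_dist (V n) (Z n)) \<longlonglongrightarrow> 0" using tendsto_mult_left[OF D_lim, of T] by simp
    have "(\<lambda>n. (traj (V n) t i - traj (Z n) t i)\<^sup>2) \<longlonglongrightarrow> 0"
      using traj_sq_dist[OF V(1) Z i t] by (intro tendsto_sandwich[OF _ _ tendsto_const TD]) auto
    then show ?thesis by simp
  qed
  define Q where "Q t i = integral {0..t} (\<lambda>s. f i (X s) s)" for t i
  have f_lim: "uniform_limit {0..T} (\<lambda>n t. f i (traj (V n) t) t) (\<lambda>t. f i (X t) t) sequentially" if "i \<in> I" for i
    by (rule f_limit[where Xn = "\<lambda>n. traj (V n)"]) (use that in \<open>auto intro: traj_cont V X\<close>)
  have P_lim: "(\<lambda>n. P n t i) \<longlonglongrightarrow> Q t i" if "i \<in> I" "t \<in> {0..T}" for t i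
    unfolding P_def Q_def by (rule tendsto_integral_uniform_limit[OF f_lim[OF that(1)] fV[OF that(1)] that(2)])
  \<comment> \<open>Only the multipliers need a subsequence. It may depend on \<open>i\<close>,
    because the limits \<open>X\<close> and \<open>Q\<close> are already fixed by the full
    sequence.\<close>
  have "\<exists>d. \<forall>t\<in>{0..T}. X t i = a i + integral {0..t} (\<lambda>s. \<phi> (Q s i + d))" if i: "i \<in> I" for i
  proof -
    have "bounded (range (\<lambda>n. c n i))" unfolding bounded_iff using c(1)[OF i] by auto
    then obtain d r where r: "strict_mono (r :: nat \<Rightarrow> nat)" "((\<lambda>n. c n i) \<circ> r) \<longlonglongrightarrow> d"
      using bounded_imp_convergent_subsequence by blast
    have "X t i = a i + integral {0..t} (\<lambda>s. \<phi> (Q s i + d))" if t: "t \<in> {0..T}" for t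
    proof -
      have "(\<lambda>n. integral {0..t} (\<lambda>s. Z (r n) s i)) \<longlonglongrightarrow> integral {0..t} (\<lambda>s. \<phi> (Q s i + d))"
      proof (rule dominated_convergence(2)[where h = "\<lambda>_. R"])
        show "(\<lambda>s. Z (r n) s i) integrable_on {0..t}" for n
          by (intro integrable_continuous_real velocities_sub_cont Z i t)
        show "norm (Z (r n) s i) \<le> R" if "s \<in> {0..t}" for n s using \<phi>R by (simp add: Z_def)
        show "(\<lambda>n. Z (r n) s i) \<longlonglongrightarrow> \<phi> (Q s i + d)" if "s \<in> {0..t}" for s
        proof -
          have "s \<in> {0..T}" using that t by auto
          from LIMSEQ_subseq_LIMSEQ[OF P_lim[OF i this] r(1)] r(2)
          have "(\<lambda>n. P (r n) s i + c (r n) i) \<longlonglongrightarrow> Q s i + d"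
            by (intro tendsto_add) (simp_all add: o_def)
          moreover have "isCont \<phi> (Q s i + d)" using \<phi>_cont by (simp add: continuous_on_eq_continuous_at)
          ultimately show ?thesis unfolding Z_def by (rule isCont_tendsto_compose[rotated])
        qed
      qed auto
      then have "(\<lambda>n. traj (Z (r n)) t i) \<longlonglongrightarrow> a i + integral {0..t} (\<lambda>s. \<phi> (Q s i + d))"
        unfolding traj_def by (intro tendsto_add tendsto_const)
      moreover have "(\<lambda>n. traj (V (r n)) t i - (traj (V (r n)) t i - traj (Z (r n)) t i)) \<longlonglongrightarrow> X t i - 0"
      proof (rule tendsto_diff)
        show "(\<lambda>n. traj (V (r n)) t i) \<longlonglongrightarrow> X t i"
          using LIMSEQ_subseq_LIMSEQ[OF tendsto_uniform_limitI[OF X[OF i] t] r(1)] by (simp add: o_def)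
        show "(\<lambda>n. traj (V (r n)) t i - traj (Z (r n)) t i) \<longlonglongrightarrow> 0"
          using LIMSEQ_subseq_LIMSEQ[OF close[OF i t] r(1)] by (simp add: o_def)
      qed
      ultimately show ?thesis using LIMSEQ_unique by fastforce
    qed
    then show ?thesis by blast
  qed
  then obtain d where d: "\<And>i t. i \<in> I \<Longrightarrow> t \<in> {0..T} \<Longrightarrow>
      X t i = a i + integral {0..t} (\<lambda>s. \<phi> (Q s i + d i))"
    by metis
  have Q_deriv: "((\<lambda>t. Q t i) has_real_derivative f i (X t) t) (at t within {0..T})"
    if "i \<in> I" "t \<in> {0..T}" for t i
    unfolding Q_def using integral_has_real_derivative[OF f_cont[OF X_cont that(1)] that(2)] .
  have Q_cont: "continuous_on {0..T} (\<lambda>t. Q t i)" if "i \<in> I" for i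
    using Q_deriv[OF that] by (rule DERIV_continuous_on)
  have v_cont: "continuous_on {0..T} (\<lambda>t. \<phi> (Q t i + d i))" if "i \<in> I" for i
    by (intro continuous_on_compose2[OF \<phi>_cont] continuous_intros Q_cont that) auto
  show thesis
  proof (rule that[of X "\<lambda>t i. \<phi> (Q t i + d i)" "\<lambda>t i. Q t i + d i"])
    fix i assume i: "i \<in> I"
    show "X 0 i = a i" using d[OF i, of 0] T_pos by simp
    have "(\<lambda>n. traj (V n) T i) \<longlonglongrightarrow> X T i" using T_pos by (intro tendsto_uniform_limitI[OF X[OF i]]) auto
    then show "X T i = b i" using traj_T[OF V(1) i] LIMSEQ_unique[OF _ tendsto_const] by simp
    show "continuous_on {0..T} (\<lambda>t. \<phi> (Q t i + d i))" by (rule v_cont[OF i])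
    fix t assume t: "t \<in> {0..T}"
    have "((\<lambda>t. a i + integral {0..t} (\<lambda>s. \<phi> (Q s i + d i))) has_real_derivative \<phi> (Q t i + d i)) (at t within {0..T})"
      using integral_has_real_derivative[OF v_cont[OF i] t] by (auto intro!: derivative_eq_intros)
    then show "((\<lambda>t. X t i) has_real_derivative \<phi> (Q t i + d i)) (at t within {0..T})"
      by (rule has_field_derivative_transform_within[OF _ zero_less_one t]) (simp add: d i)
    show "((\<lambda>t. Q t i + d i) has_real_derivative f i (X t) t) (at t within {0..T})"
      using Q_deriv[OF i t] by (auto intro!: derivative_eq_intros)
    show "strong_minimizer L \<theta> {- R..R} (Q t i + d i) (\<phi> (Q t i + d i))" by (rule \<phi>)
  qed
qed

end

subsection \<open>Chains of interacting particles\<close>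

text \<open>\<open>F\<close> is uniformly continuous on the part of \<open>C\<close> within distance
  \<open>1\<close> of a ball containing the image of \<open>h\<close>, and eventually all
  \<open>g n t\<close> lie there.\<close>

lemma uniform_limit_compose_continuous:
  fixes F :: "'a::euclidean_space \<Rightarrow> real"
  assumes g: "uniform_limit S g h A" and h: "compact (h ` S)"
    and F: "continuous_on C F" "closed C"
    and C: "\<And>n t. t \<in> S \<Longrightarrow> g n t \<in> C" "\<And>t. t \<in> S \<Longrightarrow> h t \<in> C"
  shows "uniform_limit S (\<lambda>n t. F (g n t)) (\<lambda>t. F (h t)) A"
proof -
  obtain r where r: "\<And>t. t \<in> S \<Longrightarrow> norm (h t) \<le> r"
    using compact_imp_bounded[OF h] unfolding bounded_iff by blast
  let ?D = "C \<inter> cball 0 (r + 1)"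
  have "compact ?D" using F(2) by (rule closed_Int_compact) simp
  then have uc: "uniformly_continuous_on ?D F"
    by (rule compact_uniformly_continuous[rotated]) (rule continuous_on_subset[OF F(1)], blast)
  show ?thesis
  proof (rule uniform_limitI)
    fix e :: real assume "e > 0"
    then obtain d where d: "d > 0" "\<And>x y. x \<in> ?D \<Longrightarrow> y \<in> ?D \<Longrightarrow> dist y x < d \<Longrightarrow> dist (F y) (F x) < e"
      using uc unfolding uniformly_continuous_on_def by metis
    have "\<forall>\<^sub>F n in A. \<forall>t\<in>S. dist (g n t) (h t) < min d 1"
      using uniform_limitD[OF g, of "min d 1"] d(1) by simp
    then show "\<forall>\<^sub>F n in A. \<forall>t\<in>S. dist (F (g n t)) (F (h t)) < e"
    proof eventually_elim
      case (elim n)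
      show ?case
      proof
        fix t assume t: "t \<in> S"
        have dt: "dist (g n t) (h t) < min d 1" using elim t by blast
        have "norm (g n t) \<le> norm (h t) + dist (g n t) (h t)"
          by (metis add.commute dist_norm norm_triangle_sub)
        then have "g n t \<in> ?D" "h t \<in> ?D" using r[OF t] dt C[OF t] by auto
        then show "dist (F (g n t)) (F (h t)) < e" using dt by (intro d(2)) auto
      qed
    qed
  qed
qed

text \<open>\<open>K i\<close> is a continuous subgradient of the convex function
  \<open>H i\<close>, and its sign means repulsion. The index \<open>i\<close> allows the first
  particle on the line to have no interaction while the others share one.\<close>

definition interaction :: "(nat \<Rightarrow> real \<Rightarrow> real) \<Rightarrow> (nat \<Rightarrow> real \<Rightarrow> real) \<Rightarrow> bool" where
  "interaction H K \<longleftrightarrow> (\<forall>i. continuous_on UNIV (H i) \<and> continuous_on UNIV (K i) \<and>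
     (\<forall>d. K i d \<le> 0) \<and> (\<forall>d e. H i d + K i d * (e - d) \<le> H i e))"

text \<open>One cyclic chain covers both domains. \<open>W\<close> plays the role of
  \<open>\<partial>V/\<partial>x\<close>, and \<open>V_gradient\<close> is concavity of
  \<open>V\<close> in its tangent form.\<close>

locale particle_data = uniformly_convex_cost +
  fixes N :: nat and T :: real and V W :: "real \<Rightarrow> real \<Rightarrow> real"
    and \<kappa> x0 xT :: "nat \<Rightarrow> real" and \<delta> Lmin :: real
  assumes N_pos: "N \<ge> 1" and T_pos: "T > 0"
    and L_below: "\<And>u. Lmin \<le> L u"
    and V_cont: "continuous_on (UNIV \<times> {0..T}) (\<lambda>(x, t). V x t)"
    and W_cont: "continuous_on (UNIV \<times> {0..T}) (\<lambda>(x, t). W x t)"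
    and V_gradient: "\<And>x y t. t \<in> {0..T} \<Longrightarrow> V y t \<le> V x t + W x t * (y - x)"
    and delta_pos: "\<delta> > 0"
    and gap_data: "\<And>i. i \<in> {1..N} \<Longrightarrow>
        \<delta> \<le> x0 i - x0 (if i = 1 then N else i - 1) + \<kappa> i \<and>
        \<delta> \<le> xT i - xT (if i = 1 then N else i - 1) + \<kappa> i"
begin

definition prev :: "nat \<Rightarrow> nat" where "prev i = (if i = 1 then N else i - 1)"
definition succ :: "nat \<Rightarrow> nat" where "succ i = (if i = N then 1 else i + 1)"

text \<open>On the torus \<open>gap x 1\<close> measures the distance to \<open>x\<^sub>0 = x\<^sub>N - 1\<close>, with \<open>\<kappa> 1 = 1\<close>.  On the line
  the first particle has no left neighbour; there \<open>\<kappa> 1\<close> is a dummy and \<open>H 1\<close> is constant.\<close>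

definition gap :: "(nat \<Rightarrow> real) \<Rightarrow> nat \<Rightarrow> real" where "gap x i = x i - x (prev i) + \<kappa> i"

definition energy :: "(nat \<Rightarrow> real \<Rightarrow> real) \<Rightarrow> (nat \<Rightarrow> real) \<Rightarrow> real \<Rightarrow> real" where
  "energy H x t = (\<Sum>i=1..N. H i (gap x i) - V (x i) t)"

text \<open>The partial derivative of \<open>energy\<close> with respect to \<open>x i\<close>, not
  its negative: \<open>x i\<close> enters its own gap with sign plus and the next gap with sign
  minus. This is the sign in the equation \<open>p' = force\<close>.\<close>

definition force :: "(nat \<Rightarrow> real \<Rightarrow> real) \<Rightarrow> nat \<Rightarrow> (nat \<Rightarrow> real) \<Rightarrow> real \<Rightarrow> real" where
  "force K i x t = K i (gap x i) - K (succ i) (gap x (succ i)) - W (x i) t"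

text \<open>The two-point boundary value problem in Hamiltonian form. \<open>S\<close> is
  \<open>{- R..R}\<close> for the constrained problem and \<open>UNIV\<close> for the actual
  one.\<close>

definition orbit :: "(nat \<Rightarrow> real \<Rightarrow> real) \<Rightarrow> real set \<Rightarrow> (real \<Rightarrow> nat \<Rightarrow> real) \<Rightarrow> (real \<Rightarrow> nat \<Rightarrow> real) \<Rightarrow>
    (real \<Rightarrow> nat \<Rightarrow> real) \<Rightarrow> bool" where
  "orbit K S x p v \<longleftrightarrow> (\<forall>i\<in>{1..N}. x 0 i = x0 i \<and> x T i = xT i \<and>
     continuous_on {0..T} (\<lambda>t. v t i) \<and>
     (\<forall>t\<in>{0..T}. ((\<lambda>t. x t i) has_real_derivative v t i) (at t within {0..T}) \<and>
        ((\<lambda>t. p t i) has_real_derivative force K i (x t) t) (at t within {0..T}) \<and>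
        strong_minimizer L \<theta> S (p t i) (v t i)))"

lemma prev_in: "i \<in> {1..N} \<Longrightarrow> prev i \<in> {1..N}" using N_pos by (auto simp: prev_def)
lemma succ_in: "i \<in> {1..N} \<Longrightarrow> succ i \<in> {1..N}" using N_pos by (auto simp: succ_def)
lemma prev_succ: "i \<in> {1..N} \<Longrightarrow> prev (succ i) = i" using N_pos by (auto simp: prev_def succ_def)
lemma succ_prev: "i \<in> {1..N} \<Longrightarrow> succ (prev i) = i" using N_pos by (auto simp: prev_def succ_def)

text \<open>Summation by parts on a cycle: \<open>succ\<close> permutes \<open>{1..N}\<close>, so no
  boundary terms appear.\<close>

lemma sum_shift:
  fixes k w :: "nat \<Rightarrow> real"
  shows "(\<Sum>i=1..N. k i * (w i - w (prev i))) = (\<Sum>i=1..N. (k i - k (succ i)) * w i)"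
proof -
  have "bij_betw succ {1..N} {1..N}"
    by (rule bij_betwI[where g = prev]) (use prev_in succ_in prev_succ succ_prev in auto)
  from sum.reindex_bij_betw[OF this, of "\<lambda>i. k i * w (prev i)"]
  have "(\<Sum>i=1..N. k i * w (prev i)) = (\<Sum>i=1..N. k (succ i) * w (prev (succ i)))" by simp
  also have "\<dots> = (\<Sum>i=1..N. k (succ i) * w i)" by (intro sum.cong) (auto simp: prev_succ)
  finally show ?thesis by (simp only: right_diff_distrib left_diff_distrib sum_subtractf)
qed

text \<open>Rewrites the work of the forces in terms of gaps, where convexity of each
  \<open>H i\<close> can be used separately. Needed for the gradient inequality, for the comparison
  with straight lines and for optimality.\<close>

lemma sum_force:
  "(\<Sum>i=1..N. force K i x t * (y i - x i))
    = (\<Sum>i=1..N. K i (gap x i) * (gap y i - gap x i) - W (x i) t * (y i - x i))"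
proof -
  have "(\<Sum>i=1..N. K i (gap x i) * (gap y i - gap x i))
      = (\<Sum>i=1..N. K i (gap x i) * ((y i - x i) - (y (prev i) - x (prev i))))"
    by (intro sum.cong) (auto simp: gap_def)
  also have "\<dots> = (\<Sum>i=1..N. (K i (gap x i) - K (succ i) (gap x (succ i))) * (y i - x i))"
    by (rule sum_shift)
  finally show ?thesis by (simp add: force_def left_diff_distrib sum_subtractf)
qed

lemma interactionD:
  assumes "interaction H K"
  shows "continuous_on S g \<Longrightarrow> continuous_on S (\<lambda>t. H i (g t))"
    "continuous_on S g \<Longrightarrow> continuous_on S (\<lambda>t. K i (g t))"
    "K i d \<le> 0" "H i d + K i d * (e - d) \<le> H i e"
proof -
  have c: "continuous_on UNIV (H i)" "continuous_on UNIV (K i)"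
    using assms by (simp_all add: interaction_def)
  show "continuous_on S g \<Longrightarrow> continuous_on S (\<lambda>t. H i (g t))"
    by (rule continuous_on_compose2[OF c(1)]) simp_all
  show "continuous_on S g \<Longrightarrow> continuous_on S (\<lambda>t. K i (g t))"
    by (rule continuous_on_compose2[OF c(2)]) simp_all
  show "K i d \<le> 0" "H i d + K i d * (e - d) \<le> H i e"
    using assms by (simp_all add: interaction_def)
qed

lemma energy_gradient:
  assumes "interaction H K" "t \<in> {0..T}"
  shows "energy H x t + (\<Sum>i=1..N. force K i x t * (y i - x i)) \<le> energy H y t"
  unfolding sum_force energy_def sum.distrib[symmetric]
proof (rule sum_mono)
  fix i
  show "H i (gap x i) - V (x i) t + (K i (gap x i) * (gap y i - gap x i) - W (x i) t * (y i - x i))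
      \<le> H i (gap y i) - V (y i) t"
    using interactionD(4)[OF assms(1), of i "gap x i" "gap y i"] V_gradient[OF assms(2), of "y i" "x i"]
    by linarith
qed

lemma V_path_cont: "continuous_on {0..T} g \<Longrightarrow> continuous_on {0..T} (\<lambda>t. V (g t) t)"
proof -
  assume "continuous_on {0..T} g"
  then have "continuous_on {0..T} (\<lambda>t. (g t, t))" by (intro continuous_intros)
  from continuous_on_compose2[OF V_cont this] show ?thesis by (simp add: image_subset_iff)
qed

lemma W_path_cont: "continuous_on {0..T} g \<Longrightarrow> continuous_on {0..T} (\<lambda>t. W (g t) t)"
proof -
  assume "continuous_on {0..T} g"
  then have "continuous_on {0..T} (\<lambda>t. (g t, t))" by (intro continuous_intros)
  from continuous_on_compose2[OF W_cont this] show ?thesis by (simp add: image_subset_iff)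
qed

lemma gap_cont:
  assumes "\<And>j. j \<in> {1..N} \<Longrightarrow> continuous_on {0..T} (\<lambda>t. X t j)" "i \<in> {1..N}"
  shows "continuous_on {0..T} (\<lambda>t. gap (X t) i)"
  unfolding gap_def by (intro continuous_intros assms(1) assms(2) prev_in)

lemma force_cont:
  assumes "interaction H K" "\<And>j. j \<in> {1..N} \<Longrightarrow> continuous_on {0..T} (\<lambda>t. X t j)" "i \<in> {1..N}"
  shows "continuous_on {0..T} (\<lambda>t. force K i (X t) t)"
  unfolding force_def
  by (intro continuous_on_diff W_path_cont assms(2,3)
      interactionD(2)[OF assms(1) gap_cont[OF assms(2) assms(3)]]
      interactionD(2)[OF assms(1) gap_cont[OF assms(2) succ_in[OF assms(3)]]])

lemma energy_cont:
  assumes "interaction H K" "\<And>j. j \<in> {1..N} \<Longrightarrow> continuous_on {0..T} (\<lambda>t. X t j)"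
  shows "continuous_on {0..T} (\<lambda>t. energy H (X t) t)"
  unfolding energy_def
proof (intro continuous_on_sum continuous_on_diff V_path_cont assms(2))
  show "continuous_on {0..T} (\<lambda>t. H i (gap (X t) i))" if "i \<in> {1..N}" for i
    by (rule interactionD(1)[OF assms(1) gap_cont[OF assms(2) that]])
qed

lemma gap_limit:
  assumes "\<And>j. j \<in> {1..N} \<Longrightarrow> uniform_limit {0..T} (\<lambda>n t. Xn n t j) (\<lambda>t. X t j) sequentially"
    and "i \<in> {1..N}"
  shows "uniform_limit {0..T} (\<lambda>n t. gap (Xn n t) i) (\<lambda>t. gap (X t) i) sequentially"
  unfolding gap_def
  by (intro uniform_limit_add uniform_limit_minus uniform_limit_const assms(1) prev_in assms(2))

lemma force_limit:
  assumes inter: "interaction H K"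
    and c: "\<And>j n. j \<in> {1..N} \<Longrightarrow> continuous_on {0..T} (\<lambda>t. Xn n t j)"
    and lim: "\<And>j. j \<in> {1..N} \<Longrightarrow> uniform_limit {0..T} (\<lambda>n t. Xn n t j) (\<lambda>t. X t j) sequentially"
    and i: "i \<in> {1..N}"
  shows "uniform_limit {0..T} (\<lambda>n t. force K i (Xn n t) t) (\<lambda>t. force K i (X t) t) sequentially"
proof -
  have X_cont: "continuous_on {0..T} (\<lambda>t. X t j)" if "j \<in> {1..N}" for j
    by (rule uniform_limit_theorem[OF _ lim[OF that]]) (auto intro: always_eventually c[OF that])
  have K_lim: "uniform_limit {0..T} (\<lambda>n t. K j (gap (Xn n t) j)) (\<lambda>t. K j (gap (X t) j)) sequentially"
    if j: "j \<in> {1..N}" for j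
  proof (rule uniform_limit_compose_continuous[OF gap_limit[OF lim j]])
    show "compact ((\<lambda>t. gap (X t) j) ` {0..T})"
      by (intro compact_continuous_image gap_cont X_cont j) auto
    show "continuous_on UNIV (K j)" using inter by (simp add: interaction_def)
  qed auto
  have "uniform_limit {0..T} (\<lambda>n t. (Xn n t i, t)) (\<lambda>t. (X t i, t)) sequentially"
    using lim[OF i] by (auto simp: uniform_limit_iff dist_Pair_Pair)
  then have "uniform_limit {0..T} (\<lambda>n t. (\<lambda>(x, t). W x t) (Xn n t i, t)) (\<lambda>t. (\<lambda>(x, t). W x t) (X t i, t)) sequentially"
  proof (rule uniform_limit_compose_continuous[OF _ _ W_cont])
    show "compact ((\<lambda>t. (X t i, t)) ` {0..T})"
      by (intro compact_continuous_image continuous_intros X_cont i) auto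
  qed (auto intro: closed_Times)
  then have W_lim: "uniform_limit {0..T} (\<lambda>n t. W (Xn n t i) t) (\<lambda>t. W (X t i) t) sequentially" by simp
  show ?thesis
    unfolding force_def by (intro uniform_limit_minus K_lim W_lim i succ_in)
qed

lemma W_bounded: "\<exists>B\<ge>0. \<forall>x t. \<bar>x\<bar> \<le> r \<longrightarrow> t \<in> {0..T} \<longrightarrow> \<bar>W x t\<bar> \<le> B"
proof -
  have "compact ((\<lambda>(x, t). W x t) ` ({- r..r} \<times> {0..T}))"
    by (intro compact_continuous_image continuous_on_subset[OF W_cont] compact_Times) auto
  from compact_imp_bounded[OF this]
  obtain B where B: "B > 0" "\<forall>y\<in>(\<lambda>(x, t). W x t) ` ({- r..r} \<times> {0..T}). norm y \<le> B"
    unfolding bounded_pos by blast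
  have "\<bar>W x t\<bar> \<le> B" if "\<bar>x\<bar> \<le> r" "t \<in> {0..T}" for x t
    using B(2)[rule_format, OF imageI[of "(x, t)" "{- r..r} \<times> {0..T}"]] that by (simp add: abs_le_iff)
  then show ?thesis using B(1) by (intro exI[of _ B]) auto
qed

lemma force_bounded:
  assumes inter: "interaction H K"
  shows "\<exists>B. \<forall>i\<in>{1..N}. \<forall>t\<in>{0..T}. \<forall>x. (\<forall>j\<in>{1..N}. \<bar>x j - x0 j\<bar> \<le> r) \<longrightarrow> \<bar>force K i x t\<bar> \<le> B"
proof -
  define c where "c = (\<Sum>i=1..N. \<bar>x0 i\<bar>) + \<bar>r\<bar>"
  define c' where "c' = 2 * c + (\<Sum>i=1..N. \<bar>\<kappa> i\<bar>)"
  have "\<exists>B\<ge>0. \<forall>d. \<bar>d\<bar> \<le> c' \<longrightarrow> \<bar>K i d\<bar> \<le> B" for i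
  proof -
    have "continuous_on UNIV (K i)" using inter by (simp add: interaction_def)
    then have "continuous_on {- c'..c'} (K i)" by (rule continuous_on_subset) simp
    then have "compact (K i ` {- c'..c'})" by (rule compact_continuous_image) simp
    from compact_imp_bounded[OF this]
    obtain B where B: "B > 0" "\<forall>y\<in>K i ` {- c'..c'}. norm y \<le> B"
      unfolding bounded_pos by blast
    have "\<bar>K i d\<bar> \<le> B" if "\<bar>d\<bar> \<le> c'" for d
      using B(2)[rule_format, OF imageI[of d "{- c'..c'}" "K i"]] that by (simp add: abs_le_iff)
    then show ?thesis using B(1) by (intro exI[of _ B]) auto
  qed
  then have "\<forall>i. \<exists>B\<ge>0. \<forall>d. \<bar>d\<bar> \<le> c' \<longrightarrow> \<bar>K i d\<bar> \<le> B" by blast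
  then obtain BK where "\<forall>i. BK i \<ge> 0 \<and> (\<forall>d. \<bar>d\<bar> \<le> c' \<longrightarrow> \<bar>K i d\<bar> \<le> BK i)"
    by (rule choice[THEN exE])
  then have BK: "\<And>i. BK i \<ge> 0" "\<And>i d. \<bar>d\<bar> \<le> c' \<Longrightarrow> \<bar>K i d\<bar> \<le> BK i" by simp_all
  obtain BW where "\<forall>x t. \<bar>x\<bar> \<le> c \<longrightarrow> t \<in> {0..T} \<longrightarrow> \<bar>W x t\<bar> \<le> BW" using W_bounded[of c] by blast
  then have BW: "\<bar>W x t\<bar> \<le> BW" if "\<bar>x\<bar> \<le> c" "t \<in> {0..T}" for x t using that by blast
  have "\<bar>force K i x t\<bar> \<le> 2 * (\<Sum>i=1..N. BK i) + BW"
    if i: "i \<in> {1..N}" and t: "t \<in> {0..T}" and x: "\<forall>j\<in>{1..N}. \<bar>x j - x0 j\<bar> \<le> r" for i t x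
  proof -
    have xc: "\<bar>x j\<bar> \<le> c" if "j \<in> {1..N}" for j
    proof -
      have "\<bar>x0 j\<bar> \<le> (\<Sum>i=1..N. \<bar>x0 i\<bar>)" using that by (intro member_le_sum) auto
      moreover have "\<bar>x j - x0 j\<bar> \<le> r" using x that by blast
      ultimately show ?thesis unfolding c_def by linarith
    qed
    have g: "\<bar>gap x j\<bar> \<le> c'" if "j \<in> {1..N}" for j
    proof -
      have "\<bar>\<kappa> j\<bar> \<le> (\<Sum>i=1..N. \<bar>\<kappa> i\<bar>)" using that by (intro member_le_sum) auto
      then show ?thesis
        using xc[OF that] xc[OF prev_in[OF that]] unfolding gap_def c'_def by linarith
    qed
    have "\<bar>K j (gap x j)\<bar> \<le> (\<Sum>i=1..N. BK i)" if "j \<in> {1..N}" for j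
    proof -
      have "BK j \<le> (\<Sum>i=1..N. BK i)" using that BK(1) by (intro member_le_sum) auto
      then show ?thesis using BK(2)[OF g[OF that], of j] by linarith
    qed
    from this[OF i] this[OF succ_in[OF i]] BW[OF xc[OF i] t] show ?thesis
      unfolding force_def by linarith
  qed
  then show ?thesis by blast
qed

lemma orbit_exists:
  assumes inter: "interaction H K" and R: "\<And>i. i \<in> {1..N} \<Longrightarrow> \<bar>xT i - x0 i\<bar> < R * T"
  obtains x p v where "orbit K {- R..R} x p v"
proof -
  have "\<bar>xT 1 - x0 1\<bar> < R * T" using N_pos by (intro R) simp
  then have "0 < R * T" by linarith
  then have "R > 0" using T_pos by (rule zero_less_mult_pos2)
  interpret bounded_velocity_problem L \<theta> "{1..N}" T R "energy H" "force K" x0 xT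
  proof unfold_locales
    show "finite {1..N}" by simp
    show "0 < T" by (rule T_pos)
    show "0 < R" by fact
    show "\<bar>xT i - x0 i\<bar> < R * T" if "i \<in> {1..N}" for i using that by (rule R)
    show "energy H x t + (\<Sum>i=1..N. force K i x t * (y i - x i)) \<le> energy H y t"
      if "t \<in> {0..T}" for x y t by (rule energy_gradient[OF inter that])
    show "continuous_on {0..T} (\<lambda>t. energy H (X t) t)"
      if "\<And>i. i \<in> {1..N} \<Longrightarrow> continuous_on {0..T} (\<lambda>t. X t i)" for X
      by (rule energy_cont[OF inter that])
    show "continuous_on {0..T} (\<lambda>t. force K i (X t) t)"
      if "\<And>j. j \<in> {1..N} \<Longrightarrow> continuous_on {0..T} (\<lambda>t. X t j)" "i \<in> {1..N}" for X i
      by (rule force_cont[OF inter that])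
    show "uniform_limit {0..T} (\<lambda>n t. force K i (Xn n t) t) (\<lambda>t. force K i (X t) t) sequentially"
      if "\<And>j n. j \<in> {1..N} \<Longrightarrow> continuous_on {0..T} (\<lambda>t. Xn n t j)"
        "\<And>j. j \<in> {1..N} \<Longrightarrow> uniform_limit {0..T} (\<lambda>n t. Xn n t j) (\<lambda>t. X t j) sequentially"
        "i \<in> {1..N}" for Xn X i
      by (rule force_limit[OF inter that])
    show "\<exists>B. \<forall>i\<in>{1..N}. \<forall>t\<in>{0..T}. \<forall>x. (\<forall>j\<in>{1..N}. \<bar>x j - x0 j\<bar> \<le> r) \<longrightarrow> \<bar>force K i x t\<bar> \<le> B" for r
      by (rule force_bounded[OF inter])
  qed
  show thesis
  proof (rule constrained_solution)
    fix x p v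
    assume A: "\<And>i. i \<in> {1..N} \<Longrightarrow> x 0 i = x0 i" "\<And>i. i \<in> {1..N} \<Longrightarrow> x T i = xT i"
      "\<And>i t. i \<in> {1..N} \<Longrightarrow> t \<in> {0..T} \<Longrightarrow>
         ((\<lambda>t. x t i) has_real_derivative v t i) (at t within {0..T})"
      "\<And>i t. i \<in> {1..N} \<Longrightarrow> t \<in> {0..T} \<Longrightarrow>
         ((\<lambda>t. p t i) has_real_derivative force K i (x t) t) (at t within {0..T})"
      "\<And>i. i \<in> {1..N} \<Longrightarrow> continuous_on {0..T} (\<lambda>t. v t i)"
      "\<And>i t. i \<in> {1..N} \<Longrightarrow> t \<in> {0..T} \<Longrightarrow> strong_minimizer L \<theta> {- R..R} (p t i) (v t i)"
    have "orbit K {- R..R} x p v"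
      unfolding orbit_def
      by (intro ballI conjI; (rule A(1) A(2) A(5) | rule A(3) | rule A(4) | rule A(6)); assumption)
    then show thesis by (rule that)
  qed
qed

end

section \<open>A priori bounds and removal of the velocity bound\<close>

lemma (in uniformly_convex_cost) superlinear:
  assumes L_below: "\<And>u. Lmin \<le> L u"
  obtains B where "\<And>u. A * \<bar>u\<bar> - B \<le> L u"
proof -
  define B where "B = A\<^sup>2 / (2 * \<theta>) - 2 * Lmin + L 0"
  have "A * \<bar>u\<bar> - B \<le> L u" for u
  proof -
    \<comment> \<open>Uniform convexity between \<open>u\<close> and \<open>0\<close> bounds
      \<open>L u\<close> below by a quadratic function; completing the square then absorbs any
      linear growth.\<close>
    have "L (u / 2) \<le> L u / 2 + L 0 / 2 - \<theta> / 4 * u\<^sup>2"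
      using L_convex[of "1/2" u 0] by (simp add: field_simps)
    then have "2 * Lmin - L 0 + \<theta> / 2 * u\<^sup>2 \<le> L u" using L_below[of "u / 2"] by linarith
    moreover have "A * \<bar>u\<bar> \<le> \<theta> / 2 * u\<^sup>2 + A\<^sup>2 / (2 * \<theta>)"
    proof -
      have "0 \<le> (\<theta> * \<bar>u\<bar> - A)\<^sup>2 / (2 * \<theta>)" using theta_pos by simp
      also have "\<dots> = \<theta> / 2 * u\<^sup>2 + A\<^sup>2 / (2 * \<theta>) - A * \<bar>u\<bar>"
        using theta_pos by (simp add: power2_eq_square field_simps)
      finally show ?thesis by linarith
    qed
    ultimately show ?thesis unfolding B_def by linarith
  qed
  then show thesis by (rule that)
qed

context particle_data
begin

definition mean :: "nat \<Rightarrow> real" where "mean i = (xT i - x0 i) / T"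
definition line :: "real \<Rightarrow> nat \<Rightarrow> real" where "line t i = x0 i + t * mean i"

lemma orbitD:
  assumes "orbit K S x p v" "i \<in> {1..N}"
  shows "x 0 i = x0 i" "x T i = xT i" "continuous_on {0..T} (\<lambda>t. v t i)"
    "\<And>t. t \<in> {0..T} \<Longrightarrow> ((\<lambda>t. x t i) has_real_derivative v t i) (at t within {0..T})"
    "\<And>t. t \<in> {0..T} \<Longrightarrow> ((\<lambda>t. p t i) has_real_derivative force K i (x t) t) (at t within {0..T})"
    "\<And>t. t \<in> {0..T} \<Longrightarrow> strong_minimizer L \<theta> S (p t i) (v t i)"
    "continuous_on {0..T} (\<lambda>t. x t i)" "continuous_on {0..T} (\<lambda>t. p t i)"
proof -
  note o = assms(1)[unfolded orbit_def, THEN bspec, OF assms(2)]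
  show "x 0 i = x0 i" "x T i = xT i" "continuous_on {0..T} (\<lambda>t. v t i)" using o by simp_all
  show d: "((\<lambda>t. x t i) has_real_derivative v t i) (at t within {0..T})"
    "((\<lambda>t. p t i) has_real_derivative force K i (x t) t) (at t within {0..T})"
    "strong_minimizer L \<theta> S (p t i) (v t i)" if "t \<in> {0..T}" for t
    using o that by blast+
  show "continuous_on {0..T} (\<lambda>t. x t i)" using d(1) by (rule DERIV_continuous_on)
  show "continuous_on {0..T} (\<lambda>t. p t i)" using d(2) by (rule DERIV_continuous_on)
qed

lemma orbit_force_cont:
  assumes "interaction H K" "orbit K S x p v" "i \<in> {1..N}"
  shows "continuous_on {0..T} (\<lambda>t. force K i (x t) t)"
  by (rule force_cont[OF assms(1) orbitD(7)[OF assms(2)] assms(3)])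

text \<open>Along the straight line each gap is affine in time, hence a convex combination of its
  two end values.\<close>

lemma line_gap:
  assumes "i \<in> {1..N}" "t \<in> {0..T}"
  shows "\<delta> \<le> gap (line t) i"
proof -
  have "gap (line t) i = (1 - t / T) * gap x0 i + (t / T) * gap xT i"
    unfolding gap_def line_def mean_def using T_pos by (simp add: field_simps)
  moreover have "(1 - t / T) * \<delta> + (t / T) * \<delta> \<le> (1 - t / T) * gap x0 i + (t / T) * gap xT i"
    using gap_data[OF assms(1)] assms(2) T_pos
    by (intro add_mono mult_left_mono) (auto simp: gap_def prev_def)
  moreover have "(1 - t / T) * \<delta> + (t / T) * \<delta> = \<delta>" by (simp add: algebra_simps)
  ultimately show ?thesis by linarith
qed

text \<open>A concave function lies below its tangent at \<open>0\<close>, so it grows at most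
  linearly from above; from below a bound is needed only along the straight lines.\<close>

lemma V_bounds:
  obtains c where "c \<ge> 0" "\<And>x t. t \<in> {0..T} \<Longrightarrow> V x t \<le> c * (1 + \<bar>x\<bar>)"
    "\<And>i t. i \<in> {1..N} \<Longrightarrow> t \<in> {0..T} \<Longrightarrow> - c \<le> V (line t i) t"
proof -
  have bd: "\<exists>B\<ge>0. \<forall>t\<in>{0..T}. \<bar>g t\<bar> \<le> B" if "continuous_on {0..T} g" for g :: "real \<Rightarrow> real"
  proof -
    have "compact (g ` {0..T})" using that by (rule compact_continuous_image) simp
    from compact_imp_bounded[OF this] obtain B where "B > 0" "\<forall>y\<in>g ` {0..T}. norm y \<le> B"
      unfolding bounded_pos by blast
    then show ?thesis by (intro exI[of _ B]) simp
  qed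
  obtain c1 where c1: "c1 \<ge> 0" "\<forall>t\<in>{0..T}. \<bar>V 0 t\<bar> \<le> c1" using bd[OF V_path_cont[OF continuous_on_const]] by blast
  obtain c2 where c2: "c2 \<ge> 0" "\<forall>t\<in>{0..T}. \<bar>W 0 t\<bar> \<le> c2" using bd[OF W_path_cont[OF continuous_on_const]] by blast
  have "\<forall>i. \<exists>B\<ge>0. \<forall>t\<in>{0..T}. \<bar>V (line t i) t\<bar> \<le> B"
    by (intro allI bd V_path_cont) (auto simp: line_def intro!: continuous_intros)
  then obtain c3 where c3: "\<forall>i. c3 i \<ge> 0 \<and> (\<forall>t\<in>{0..T}. \<bar>V (line t i) t\<bar> \<le> c3 i)"
    by (rule choice[THEN exE])
  define c where "c = c1 + c2 + (\<Sum>i=1..N. c3 i)"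
  have s: "0 \<le> (\<Sum>i=1..N. c3 i)" using c3 by (intro sum_nonneg) auto
  show thesis
  proof (rule that[of c])
    show "c \<ge> 0" using c1 c2 s by (simp add: c_def)
    show "V x t \<le> c * (1 + \<bar>x\<bar>)" if t: "t \<in> {0..T}" for x t
    proof -
      have "V x t \<le> V 0 t + W 0 t * x" using V_gradient[OF t, of x 0] by simp
      also have "\<dots> \<le> c1 + c2 * \<bar>x\<bar>"
      proof (rule add_mono)
        show "V 0 t \<le> c1" using c1(2) t by (meson abs_le_D1)
        have "W 0 t * x \<le> \<bar>W 0 t\<bar> * \<bar>x\<bar>" by (metis abs_ge_self abs_mult)
        also have "\<dots> \<le> c2 * \<bar>x\<bar>" using c2(2) t by (intro mult_right_mono) auto
        finally show "W 0 t * x \<le> c2 * \<bar>x\<bar>" .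
      qed
      also have "\<dots> \<le> c + c * \<bar>x\<bar>"
        using c1(1) c2(1) s by (intro add_mono mult_right_mono) (auto simp: c_def)
      finally show ?thesis by (simp add: algebra_simps)
    qed
    show "- c \<le> V (line t i) t" if i: "i \<in> {1..N}" and t: "t \<in> {0..T}" for i t
    proof -
      have "c3 i \<le> (\<Sum>i=1..N. c3 i)" using i c3 by (intro member_le_sum) auto
      moreover have "\<bar>V (line t i) t\<bar> \<le> c3 i" using c3 t by blast
      ultimately show ?thesis using c1(1) c2(1) unfolding c_def by linarith
    qed
  qed
qed

text \<open>The pointwise minimality of \<open>v t i\<close> is tested with the constant velocity
  \<open>mean i\<close>, and the momentum term is integrated by parts into the work of the force
  along \<open>line - x\<close>.\<close>

lemma orbit_action_le:
  assumes inter: "interaction H K" and o: "orbit K {- R..R} x p v"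
    and R: "\<And>i. i \<in> {1..N} \<Longrightarrow> \<bar>mean i\<bar> \<le> R"
  shows "(\<Sum>i=1..N. integral {0..T} (\<lambda>t. L (v t i)))
    \<le> T * (\<Sum>i=1..N. L (mean i))
      + integral {0..T} (\<lambda>t. \<Sum>i=1..N. force K i (x t) t * (line t i - x t i))"
proof -
  have one: "integral {0..T} (\<lambda>t. L (v t i))
      \<le> T * L (mean i) + integral {0..T} (\<lambda>t. force K i (x t) t * (line t i - x t i))"
    if i: "i \<in> {1..N}" for i
  proof -
    let ?F = "\<lambda>t. force K i (x t) t * (line t i - x t i)"
    let ?q = "\<lambda>t. p t i * (mean i - v t i)"
    have line_cont: "continuous_on {0..T} (\<lambda>t. line t i)"
      unfolding line_def by (intro continuous_intros)
    have intF: "?F integrable_on {0..T}"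
      by (intro integrable_continuous_real continuous_on_mult continuous_on_diff line_cont
          orbitD(7)[OF o i] orbit_force_cont[OF inter o i])
    have intq: "?q integrable_on {0..T}"
      by (intro integrable_continuous_real continuous_on_mult continuous_on_diff continuous_on_const
          orbitD(3,8)[OF o i])
    have intL: "(\<lambda>t. L (v t i)) integrable_on {0..T}"
      by (intro integrable_continuous_real continuous_on_L orbitD(3)[OF o i])
    have "((\<lambda>t. ?F t + ?q t) has_integral p T i * (line T i - x T i) - p 0 i * (line 0 i - x 0 i)) {0..T}"
    proof (rule fundamental_theorem_of_calculus)
      fix t assume t: "t \<in> {0..T}"
      have "((\<lambda>t. line t i) has_real_derivative mean i) (at t within {0..T})"
        unfolding line_def by (auto intro!: derivative_eq_intros)
      from DERIV_mult[OF orbitD(5)[OF o i t] DERIV_diff[OF this orbitD(4)[OF o i t]]]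
      show "((\<lambda>t. p t i * (line t i - x t i)) has_vector_derivative ?F t + ?q t) (at t within {0..T})"
        unfolding has_real_derivative_iff_has_vector_derivative[symmetric]
        by (simp add: algebra_simps)
    qed (use T_pos in simp)
    moreover have "line T i = x T i" "line 0 i = x 0 i"
      using orbitD(1,2)[OF o i] T_pos by (simp_all add: line_def mean_def)
    ultimately have "((\<lambda>t. ?F t + ?q t) has_integral 0) {0..T}" by simp
    then have ibp: "integral {0..T} ?F = - integral {0..T} ?q"
      using Henstock_Kurzweil_Integration.integral_add[OF intF intq] by (simp add: integral_unique)
    have "integral {0..T} (\<lambda>t. L (v t i)) \<le> integral {0..T} (\<lambda>t. L (mean i) - ?q t)"
    proof (rule integral_le[OF intL])
      show "(\<lambda>t. L (mean i) - ?q t) integrable_on {0..T}"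
        by (rule Henstock_Kurzweil_Integration.integrable_diff[OF integrable_const_ivl intq])
      fix t assume t: "t \<in> {0..T}"
      have "mean i \<in> {- R..R}" using R[OF i] by (simp add: abs_le_iff)
      from strong_minimizerD[OF orbitD(6)[OF o i t] this]
      have "L (v t i) - p t i * v t i + \<theta> * (mean i - v t i)\<^sup>2 \<le> L (mean i) - p t i * mean i" .
      moreover have "0 \<le> \<theta> * (mean i - v t i)\<^sup>2" using theta_pos by simp
      ultimately show "L (v t i) \<le> L (mean i) - ?q t" by (simp add: algebra_simps)
    qed
    also have "\<dots> = T * L (mean i) - integral {0..T} ?q"
      unfolding Henstock_Kurzweil_Integration.integral_diff[OF integrable_const_ivl intq]
      using T_pos by simp
    finally show ?thesis using ibp by simp
  qed
  have "integral {0..T} (\<lambda>t. \<Sum>i=1..N. force K i (x t) t * (line t i - x t i))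
      = (\<Sum>i=1..N. integral {0..T} (\<lambda>t. force K i (x t) t * (line t i - x t i)))"
  proof (rule integral_sum)
    fix i assume i: "i \<in> {1..N}"
    have "continuous_on {0..T} (\<lambda>t. line t i)" unfolding line_def by (intro continuous_intros)
    then show "(\<lambda>t. force K i (x t) t * (line t i - x t i)) integrable_on {0..T}"
      by (intro integrable_continuous_real continuous_on_mult continuous_on_diff
          orbitD(7)[OF o i] orbit_force_cont[OF inter o i])
  qed simp
  moreover have "(\<Sum>i=1..N. integral {0..T} (\<lambda>t. L (v t i)))
    \<le> (\<Sum>i=1..N. T * L (mean i) + integral {0..T} (\<lambda>t. force K i (x t) t * (line t i - x t i)))"
    by (rule sum_mono[OF one])
  ultimately show ?thesis by (simp add: sum.distrib sum_distrib_left)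
qed

text \<open>Along the orbit the force pushes towards the straight line at a rate proportional to its
  strength, because the gaps of the line are at least \<open>\<delta>\<close>.\<close>

lemma force_towards_line:
  assumes inter: "interaction H K" and m: "\<And>i d. m \<le> H i d" and B: "\<And>i. H i (\<delta> / 2) \<le> B"
    and c: "\<And>x t. t \<in> {0..T} \<Longrightarrow> V x t \<le> c * (1 + \<bar>x\<bar>)"
      "\<And>i t. i \<in> {1..N} \<Longrightarrow> t \<in> {0..T} \<Longrightarrow> - c \<le> V (line t i) t"
    and t: "t \<in> {0..T}"
  shows "(\<Sum>i=1..N. force K i y t * (line t i - y i))
    \<le> (\<Sum>i=1..N. B - m - \<delta> / 2 * \<bar>K i (gap y i)\<bar> + c * (2 + \<bar>y i\<bar>))"
  unfolding sum_force
proof (rule sum_mono)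
  fix i assume i: "i \<in> {1..N}"
  note I = interactionD[OF inter]
  \<comment> \<open>The tangent inequality is used at distance \<open>\<delta> / 2\<close>. The line
    has gap at least \<open>\<delta>\<close>, and the spare \<open>\<delta> / 2\<close> is what
    multiplies the size of the force.\<close>
  have "K i (gap y i) * (gap (line t) i - \<delta> / 2) \<le> K i (gap y i) * (\<delta> / 2)"
    using line_gap[OF i t] I(3)[of i "gap y i"] by (intro mult_left_mono_neg) auto
  moreover have "H i (gap y i) + K i (gap y i) * (\<delta> / 2 - gap y i) \<le> H i (\<delta> / 2)" by (rule I(4))
  moreover have "K i (gap y i) * (\<delta> / 2) = - (\<delta> / 2 * \<bar>K i (gap y i)\<bar>)"
    using I(3)[of i "gap y i"] by simp
  moreover have "K i (gap y i) * (gap (line t) i - gap y i)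
     = K i (gap y i) * (gap (line t) i - \<delta> / 2) + K i (gap y i) * (\<delta> / 2 - gap y i)"
    by (simp add: algebra_simps)
  ultimately have "K i (gap y i) * (gap (line t) i - gap y i) \<le> B - m - \<delta> / 2 * \<bar>K i (gap y i)\<bar>"
    using m[of i "gap y i"] B[of i] by linarith
  moreover have "- (W (y i) t * (line t i - y i)) \<le> c * (2 + \<bar>y i\<bar>)"
  proof -
    have "c * (2 + \<bar>y i\<bar>) = c * (1 + \<bar>y i\<bar>) + c" by (simp add: algebra_simps)
    then show ?thesis using V_gradient[OF t, of "line t i" "y i"] c(1)[OF t, of "y i"] c(2)[OF i t] by linarith
  qed
  ultimately show "K i (gap y i) * (gap (line t) i - gap y i) - W (y i) t * (line t i - y i)
    \<le> B - m - \<delta> / 2 * \<bar>K i (gap y i)\<bar> + c * (2 + \<bar>y i\<bar>)" by linarith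
qed

lemma orbit_position_bound:
  assumes o: "orbit K S x p v" and i: "i \<in> {1..N}" and t: "t \<in> {0..T}"
  shows "\<bar>x t i\<bar> \<le> \<bar>x0 i\<bar> + integral {0..T} (\<lambda>t. \<bar>v t i\<bar>)"
proof -
  have sub: "{0..t} \<subseteq> {0..T}" using t by auto
  have vt: "continuous_on {0..t} (\<lambda>t. v t i)" by (rule continuous_on_subset[OF orbitD(3)[OF o i] sub])
  have "((\<lambda>t. v t i) has_integral x t i - x 0 i) {0..t}"
  proof (rule fundamental_theorem_of_calculus)
    fix s assume "s \<in> {0..t}"
    then show "((\<lambda>t. x t i) has_vector_derivative v s i) (at s within {0..t})"
      unfolding has_real_derivative_iff_has_vector_derivative[symmetric]
      using sub by (intro has_field_derivative_subset[OF orbitD(4)[OF o i] sub]) auto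
  qed (use t in simp)
  then have "x t i = x0 i + integral {0..t} (\<lambda>t. v t i)"
    using orbitD(1)[OF o i] by (simp add: integral_unique)
  moreover have "\<bar>integral {0..t} (\<lambda>t. v t i)\<bar> \<le> integral {0..t} (\<lambda>t. \<bar>v t i\<bar>)"
    using integral_norm_bound_integral[of "\<lambda>t. v t i" "{0..t}" "\<lambda>t. \<bar>v t i\<bar>"] vt
    by (simp add: integrable_continuous_real continuous_on_rabs)
  moreover have "integral {0..t} (\<lambda>t. \<bar>v t i\<bar>) \<le> integral {0..T} (\<lambda>t. \<bar>v t i\<bar>)"
    by (intro integral_subset_le sub integrable_continuous_real continuous_on_rabs vt orbitD(3)[OF o i]) simp
  ultimately show ?thesis by linarith
qed

text \<open>\<open>C\<close> and \<open>R0\<close> are fixed before \<open>H\<close>,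
  \<open>K\<close> and \<open>R\<close>, which enter only through \<open>m\<close> and
  \<open>B\<close>. The chain of estimates: time integrals of speeds and of interaction forces, then
  positions, oscillation of the momenta, size of the momenta, and finally pointwise
  velocities.\<close>

proposition a_priori_bounds:
  obtains C R0 where
    "\<And>H K R x p v. interaction H K \<Longrightarrow> (\<And>i d. m \<le> H i d) \<Longrightarrow> (\<And>i. H i (\<delta> / 2) \<le> B) \<Longrightarrow>
      (\<And>i. i \<in> {1..N} \<Longrightarrow> \<bar>mean i\<bar> + 1 \<le> R) \<Longrightarrow> orbit K {- R..R} x p v \<Longrightarrow>
      (\<forall>i\<in>{1..N}. (\<forall>t\<in>{0..T}. \<bar>v t i\<bar> \<le> R0) \<and> integral {0..T} (\<lambda>t. \<bar>K i (gap (x t) i)\<bar>) \<le> C)"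
proof -
  obtain c where c: "c \<ge> 0" "\<And>x t. t \<in> {0..T} \<Longrightarrow> V x t \<le> c * (1 + \<bar>x\<bar>)"
    "\<And>i t. i \<in> {1..N} \<Longrightarrow> t \<in> {0..T} \<Longrightarrow> - c \<le> V (line t i) t"
    using V_bounds by metis
  \<comment> \<open>The linear growth of \<open>V\<close> costs \<open>c * T\<close> times the total
    path length. Slope \<open>A\<close> in the lower bound for \<open>L\<close> absorbs this and
    leaves the path length with coefficient \<open>1\<close>.\<close>
  define A where "A = c * T + 1"
  obtain bA where bA: "\<And>u. A * \<bar>u\<bar> - bA \<le> L u" using superlinear[OF L_below] by metis
  define C3 where "C3 = T * (\<Sum>i=1..N. L (mean i)) + real N * T * bA
      + T * (\<Sum>i=1..N. B - m + c * (2 + \<bar>x0 i\<bar>))"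
  define X where "X = (\<Sum>i=1..N. \<bar>x0 i\<bar>) + C3"
  have "\<exists>B\<ge>0. \<forall>x t. \<bar>x\<bar> \<le> X \<longrightarrow> t \<in> {0..T} \<longrightarrow> \<bar>W x t\<bar> \<le> B" by (rule W_bounded)
  then obtain C5 where C5: "C5 \<ge> 0" "\<forall>x t. \<bar>x\<bar> \<le> X \<longrightarrow> t \<in> {0..T} \<longrightarrow> \<bar>W x t\<bar> \<le> C5" by blast
  define C where "C = 2 * C3 / \<delta>"
  \<comment> \<open>A bound for the momentum: its oscillation, from two neighbouring interactions
    and the potential, plus its size at a time when the velocity equals
    \<open>mean i\<close>.\<close>
  define C8 where "C8 = 2 * C + C5 * T + (\<Sum>i=1..N. \<bar>L (mean i + 1)\<bar> + \<bar>L (mean i)\<bar> + \<bar>L (mean i - 1)\<bar>)"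
  \<comment> \<open>Slope \<open>C8 + 1\<close> exceeds the momentum bound by \<open>1\<close>:
    testing \<open>v\<close> with velocity \<open>0\<close> then gives
    \<open>\<bar>v\<bar> \<le> L 0 + b8\<close>.\<close>
  obtain b8 where b8: "\<And>u. (C8 + 1) * \<bar>u\<bar> - b8 \<le> L u" using superlinear[OF L_below] by metis
  show thesis
  proof (rule that[of "L 0 + b8" C])
    fix H K R x p v
    assume inter: "interaction H K" and m: "\<And>i d. m \<le> H i d" and B: "\<And>i. H i (\<delta> / 2) \<le> B"
      and R: "\<And>i. i \<in> {1..N} \<Longrightarrow> \<bar>mean i\<bar> + 1 \<le> R" and o: "orbit K {- R..R} x p v"
    have gap_c: "continuous_on {0..T} (\<lambda>t. gap (x t) i)" if "i \<in> {1..N}" for i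
      by (rule gap_cont[OF orbitD(7)[OF o] that])
    have K_c: "continuous_on {0..T} (\<lambda>t. \<bar>K i (gap (x t) i)\<bar>)" if "i \<in> {1..N}" for i
      by (intro continuous_on_rabs interactionD(2)[OF inter] gap_c that)
    have v_c: "continuous_on {0..T} (\<lambda>t. \<bar>v t i\<bar>)" if "i \<in> {1..N}" for i
      by (intro continuous_on_rabs orbitD(3)[OF o that])
    define y where "y i = integral {0..T} (\<lambda>t. \<bar>v t i\<bar>)" for i
    define k where "k i = integral {0..T} (\<lambda>t. \<bar>K i (gap (x t) i)\<bar>)" for i
    have y0: "0 \<le> y i" if "i \<in> {1..N}" for i
      unfolding y_def by (intro Henstock_Kurzweil_Integration.integral_nonneg integrable_continuous_real v_c that) simp
    have k0: "0 \<le> k i" if "i \<in> {1..N}" for i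
      unfolding k_def by (intro Henstock_Kurzweil_Integration.integral_nonneg integrable_continuous_real K_c that) simp
    have pos: "\<bar>x t i\<bar> \<le> \<bar>x0 i\<bar> + y i" if "i \<in> {1..N}" "t \<in> {0..T}" for i t
      unfolding y_def by (rule orbit_position_bound[OF o that])
    have lower: "A * y i - T * bA \<le> integral {0..T} (\<lambda>t. L (v t i))" if i: "i \<in> {1..N}" for i
    proof -
      have Ay: "(\<lambda>t. A * \<bar>v t i\<bar>) integrable_on {0..T}"
        by (intro integrable_continuous_real continuous_on_mult_left v_c i)
      have "integral {0..T} (\<lambda>t. A * \<bar>v t i\<bar> - bA) \<le> integral {0..T} (\<lambda>t. L (v t i))"
      proof (rule integral_le)
        show "(\<lambda>t. A * \<bar>v t i\<bar> - bA) integrable_on {0..T}"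
          by (rule Henstock_Kurzweil_Integration.integrable_diff[OF Ay integrable_const_ivl])
        show "(\<lambda>t. L (v t i)) integrable_on {0..T}"
          by (intro integrable_continuous_real continuous_on_L orbitD(3)[OF o i])
      qed (rule bA)
      then show ?thesis
        unfolding Henstock_Kurzweil_Integration.integral_diff[OF Ay integrable_const_ivl]
        using T_pos by (simp add: y_def)
    qed
    have upper: "integral {0..T} (\<lambda>t. \<Sum>i=1..N. force K i (x t) t * (line t i - x t i))
      \<le> (\<Sum>i=1..N. T * (B - m + c * (2 + \<bar>x0 i\<bar>)) - \<delta> / 2 * k i + c * T * y i)"
    proof -
      let ?h = "\<lambda>i t. (B - m + c * (2 + (\<bar>x0 i\<bar> + y i))) - \<delta> / 2 * \<bar>K i (gap (x t) i)\<bar>"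
      have Ki: "(\<lambda>t. \<delta> / 2 * \<bar>K i (gap (x t) i)\<bar>) integrable_on {0..T}" if "i \<in> {1..N}" for i
        by (intro integrable_continuous_real continuous_on_mult_left K_c that)
      have hi: "?h i integrable_on {0..T}" if "i \<in> {1..N}" for i
        by (rule Henstock_Kurzweil_Integration.integrable_diff[OF integrable_const_ivl Ki[OF that]])
      have "integral {0..T} (\<lambda>t. \<Sum>i=1..N. force K i (x t) t * (line t i - x t i))
          \<le> integral {0..T} (\<lambda>t. \<Sum>i=1..N. ?h i t)"
      proof (rule integral_le)
        show "(\<lambda>t. \<Sum>i=1..N. force K i (x t) t * (line t i - x t i)) integrable_on {0..T}"
        proof (intro integrable_sum integrable_continuous_real continuous_on_mult continuous_on_diff)
          fix i assume i: "i \<in> {1..N}"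
          show "continuous_on {0..T} (\<lambda>t. line t i)" unfolding line_def by (intro continuous_intros)
          show "continuous_on {0..T} (\<lambda>t. x t i)" by (rule orbitD(7)[OF o i])
          show "continuous_on {0..T} (\<lambda>t. force K i (x t) t)" by (rule orbit_force_cont[OF inter o i])
        qed simp
        show "(\<lambda>t. \<Sum>i=1..N. ?h i t) integrable_on {0..T}" by (rule integrable_sum[OF _ hi]) simp
        fix t assume t: "t \<in> {0..T}"
        have "(\<Sum>i=1..N. force K i (x t) t * (line t i - x t i))
          \<le> (\<Sum>i=1..N. B - m - \<delta> / 2 * \<bar>K i (gap (x t) i)\<bar> + c * (2 + \<bar>x t i\<bar>))"
          by (rule force_towards_line[OF inter m B c(2,3) t])
        also have "\<dots> \<le> (\<Sum>i=1..N. ?h i t)"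
        proof (rule sum_mono)
          fix i assume i: "i \<in> {1..N}"
          have "c * (2 + \<bar>x t i\<bar>) \<le> c * (2 + (\<bar>x0 i\<bar> + y i))"
            using pos[OF i t] c(1) by (intro mult_left_mono) auto
          then show "B - m - \<delta> / 2 * \<bar>K i (gap (x t) i)\<bar> + c * (2 + \<bar>x t i\<bar>) \<le> ?h i t" by linarith
        qed
        finally show "(\<Sum>i=1..N. force K i (x t) t * (line t i - x t i)) \<le> (\<Sum>i=1..N. ?h i t)" .
      qed
      also have "\<dots> = (\<Sum>i=1..N. integral {0..T} (?h i))" by (rule integral_sum[OF _ hi]) simp
      also have "\<dots> = (\<Sum>i=1..N. T * (B - m + c * (2 + \<bar>x0 i\<bar>)) - \<delta> / 2 * k i + c * T * y i)"
      proof (rule sum.cong[OF refl])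
        fix i assume i: "i \<in> {1..N}"
        have "integral {0..T} (?h i) = T * (B - m + c * (2 + (\<bar>x0 i\<bar> + y i))) - \<delta> / 2 * k i"
          unfolding Henstock_Kurzweil_Integration.integral_diff[OF integrable_const_ivl Ki[OF i]]
          using T_pos by (simp add: k_def)
        then show "integral {0..T} (?h i) = T * (B - m + c * (2 + \<bar>x0 i\<bar>)) - \<delta> / 2 * k i + c * T * y i"
          by (simp add: algebra_simps)
      qed
      finally show ?thesis .
    qed
    have "(\<Sum>i=1..N. A * y i - T * bA) \<le> (\<Sum>i=1..N. integral {0..T} (\<lambda>t. L (v t i)))"
      by (rule sum_mono[OF lower])
    also have "\<dots> \<le> T * (\<Sum>i=1..N. L (mean i))
      + integral {0..T} (\<lambda>t. \<Sum>i=1..N. force K i (x t) t * (line t i - x t i))"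
    proof (rule orbit_action_le[OF inter o])
      show "\<bar>mean i\<bar> \<le> R" if "i \<in> {1..N}" for i using R[OF that] by simp
    qed
    finally have total: "(\<Sum>i=1..N. A * y i - T * bA) \<le> T * (\<Sum>i=1..N. L (mean i))
      + (\<Sum>i=1..N. T * (B - m + c * (2 + \<bar>x0 i\<bar>)) - \<delta> / 2 * k i + c * T * y i)"
      using upper by linarith
    have "(\<Sum>i=1..N. A * y i - T * bA) = (\<Sum>i=1..N. y i) + c * T * (\<Sum>i=1..N. y i) - real N * T * bA"
    proof -
      have "(\<Sum>i=1..N. A * y i - T * bA) = A * (\<Sum>i=1..N. y i) - real N * (T * bA)"
        by (simp add: sum_subtractf sum_distrib_left)
      then show ?thesis by (simp add: A_def algebra_simps)
    qed
    moreover have "(\<Sum>i=1..N. T * (B - m + c * (2 + \<bar>x0 i\<bar>)) - \<delta> / 2 * k i + c * T * y i)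
      = T * (\<Sum>i=1..N. B - m + c * (2 + \<bar>x0 i\<bar>)) - \<delta> / 2 * (\<Sum>i=1..N. k i) + c * T * (\<Sum>i=1..N. y i)"
    proof -
      have "(\<Sum>i=1..N. r * f i - s * g i + u * h i)
          = r * (\<Sum>i=1..N. f i) - s * (\<Sum>i=1..N. g i) + u * (\<Sum>i=1..N. h i)"
        for r s u :: real and f g h :: "nat \<Rightarrow> real"
        by (simp add: sum_subtractf sum.distrib sum_distrib_left)
      then show ?thesis .
    qed
    ultimately have main: "(\<Sum>i=1..N. y i) + \<delta> / 2 * (\<Sum>i=1..N. k i) \<le> C3"
      using total unfolding C3_def by linarith
    have ysum: "0 \<le> (\<Sum>i=1..N. y i)" by (rule sum_nonneg[OF y0])
    have ksum: "0 \<le> (\<Sum>i=1..N. k i)" by (rule sum_nonneg[OF k0])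
    have yle: "y i \<le> C3" if "i \<in> {1..N}" for i
    proof -
      have "y i \<le> (\<Sum>i=1..N. y i)" using that y0 by (intro member_le_sum) auto
      moreover have "0 \<le> \<delta> / 2 * (\<Sum>i=1..N. k i)" using ksum delta_pos by simp
      ultimately show ?thesis using main by linarith
    qed
    have kle: "k i \<le> C" if "i \<in> {1..N}" for i
    proof -
      have "k i \<le> (\<Sum>i=1..N. k i)" using that k0 by (intro member_le_sum) auto
      moreover have "(\<Sum>i=1..N. k i) \<le> C"
        using main ysum delta_pos unfolding C_def by (simp add: field_simps)
      ultimately show ?thesis by linarith
    qed
    have Wle: "\<bar>W (x t i) t\<bar> \<le> C5" if i: "i \<in> {1..N}" and t: "t \<in> {0..T}" for i t
    proof -
      have "\<bar>x0 i\<bar> \<le> (\<Sum>i=1..N. \<bar>x0 i\<bar>)" using i by (intro member_le_sum) auto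
      then have "\<bar>x t i\<bar> \<le> X" using pos[OF i t] yle[OF i] unfolding X_def by linarith
      then show ?thesis using C5(2) t by simp
    qed
    show "\<forall>i\<in>{1..N}. (\<forall>t\<in>{0..T}. \<bar>v t i\<bar> \<le> L 0 + b8) \<and> integral {0..T} (\<lambda>t. \<bar>K i (gap (x t) i)\<bar>) \<le> C"
    proof (intro ballI conjI)
      fix i assume i: "i \<in> {1..N}"
      show "integral {0..T} (\<lambda>t. \<bar>K i (gap (x t) i)\<bar>) \<le> C" using kle[OF i] by (simp add: k_def)
      let ?F = "\<lambda>t. force K i (x t) t"
      let ?g = "\<lambda>t. \<bar>K i (gap (x t) i)\<bar> + \<bar>K (succ i) (gap (x t) (succ i))\<bar> + C5"
      have Fc: "continuous_on {0..T} ?F" by (rule orbit_force_cont[OF inter o i])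
      have gc: "continuous_on {0..T} ?g" by (intro continuous_on_add K_c i succ_in continuous_on_const)
      have g_int: "integral {0..T} ?g \<le> 2 * C + C5 * T"
      proof -
        have 1: "(\<lambda>t. \<bar>K i (gap (x t) i)\<bar>) integrable_on {0..T}"
          "(\<lambda>t. \<bar>K (succ i) (gap (x t) (succ i))\<bar>) integrable_on {0..T}"
          by (intro integrable_continuous_real K_c i succ_in)+
        have "integral {0..T} ?g = k i + k (succ i) + C5 * T"
          unfolding Henstock_Kurzweil_Integration.integral_add[OF
              Henstock_Kurzweil_Integration.integrable_add[OF 1] integrable_const_ivl]
            Henstock_Kurzweil_Integration.integral_add[OF 1]
          using T_pos by (simp add: k_def)
        then show ?thesis using kle[OF i] kle[OF succ_in[OF i]] by linarith
      qed
      have osc: "\<bar>p t i - p s i\<bar> \<le> 2 * C + C5 * T" if "0 \<le> s" "s \<le> t" "t \<le> T" for s t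
      proof -
        have sub: "{s..t} \<subseteq> {0..T}" using that by auto
        have "(?F has_integral p t i - p s i) {s..t}"
        proof (rule fundamental_theorem_of_calculus)
          fix r assume "r \<in> {s..t}"
          then show "((\<lambda>t. p t i) has_vector_derivative ?F r) (at r within {s..t})"
            unfolding has_real_derivative_iff_has_vector_derivative[symmetric]
            using sub by (intro has_field_derivative_subset[OF orbitD(5)[OF o i] sub]) auto
        qed (use that in simp)
        then have "p t i - p s i = integral {s..t} ?F" by (simp add: integral_unique)
        also have "\<bar>\<dots>\<bar> \<le> integral {s..t} ?g"
        proof -
          have "norm (integral {s..t} ?F) \<le> integral {s..t} ?g"
          proof (rule integral_norm_bound_integral)
            show "?F integrable_on {s..t}"
              by (rule integrable_continuous_real[OF continuous_on_subset[OF Fc sub]])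
            show "?g integrable_on {s..t}"
              by (rule integrable_continuous_real[OF continuous_on_subset[OF gc sub]])
            fix r assume "r \<in> {s..t}"
            then have "r \<in> {0..T}" using sub by auto
            from Wle[OF i this] show "norm (?F r) \<le> ?g r"
              unfolding force_def real_norm_def by linarith
          qed
          then show ?thesis by simp
        qed
        also have "\<dots> \<le> integral {0..T} ?g"
          using C5(1) by (intro integral_subset_le sub integrable_continuous_real
              continuous_on_subset[OF gc sub] gc) auto
        finally show ?thesis using g_int by linarith
      qed
      \<comment> \<open>The mean value theorem supplies a time at which the velocity is known
        explicitly, so that the momentum can be bounded there.\<close>
      obtain s where s: "0 < s" "s < T" "v s i = mean i"
      proof -
        have "\<exists>s\<in>{0<..<T}. x T i - x 0 i = v s i * (T - 0)"
        proof (rule mvt_simple[OF T_pos])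
          fix t assume t: "0 \<le> t" "t \<le> T"
          then have "t \<in> {0..T}" by simp
          from orbitD(4)[OF o i this]
          show "((\<lambda>t. x t i) has_derivative (*) (v t i)) (at t within {0..T})"
            by (simp only: has_field_derivative_def)
        qed
        then obtain s where "0 < s" "s < T" "xT i - x0 i = v s i * T" using orbitD(1,2)[OF o i] by auto
        then show ?thesis using T_pos by (intro that[of s]) (auto simp: mean_def)
      qed
      have sT: "s \<in> {0..T}" using s by simp
      \<comment> \<open>Velocities \<open>mean i + 1\<close> and \<open>mean i - 1\<close> are
        admissible because \<open>R\<close> exceeds \<open>\<bar>mean i\<bar>\<close> by at least
        \<open>1\<close>. Testing with them bounds \<open>p s i\<close> from above and
        below.\<close>
      have ms: "\<bar>p s i\<bar> \<le> \<bar>L (mean i + 1)\<bar> + \<bar>L (mean i)\<bar> + \<bar>L (mean i - 1)\<bar>"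
      proof -
        have R1: "mean i + 1 \<in> {- R..R}" "mean i - 1 \<in> {- R..R}" using R[OF i] by auto
        note D = strong_minimizerD[OF orbitD(6)[OF o i sT], unfolded s(3)]
        have "L (mean i) - p s i * mean i + \<theta> \<le> L (mean i + 1) - p s i * (mean i + 1)"
          "L (mean i) - p s i * mean i + \<theta> \<le> L (mean i - 1) - p s i * (mean i - 1)"
          using D[OF R1(1)] D[OF R1(2)] by simp_all
        moreover have "p s i * (mean i + 1) = p s i * mean i + p s i"
          "p s i * (mean i - 1) = p s i * mean i - p s i"
          by (simp_all add: algebra_simps)
        ultimately show ?thesis using theta_pos by linarith
      qed
      fix t assume t: "t \<in> {0..T}"
      have "\<bar>p t i - p s i\<bar> \<le> 2 * C + C5 * T"
      proof (cases "s \<le> t")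
        case True
        then show ?thesis using osc[of s t] s t by simp
      next
        case False
        then have "\<bar>p s i - p t i\<bar> \<le> 2 * C + C5 * T" using osc[of t s] s t by simp
        then show ?thesis by linarith
      qed
      moreover have "\<bar>L (mean i + 1)\<bar> + \<bar>L (mean i)\<bar> + \<bar>L (mean i - 1)\<bar>
        \<le> (\<Sum>i=1..N. \<bar>L (mean i + 1)\<bar> + \<bar>L (mean i)\<bar> + \<bar>L (mean i - 1)\<bar>)"
        using i by (intro member_le_sum) auto
      ultimately have pt: "\<bar>p t i\<bar> \<le> C8" using ms unfolding C8_def by linarith
      have "0 \<in> {- R..R}" using R[OF i] by auto
      from strong_minimizerD[OF orbitD(6)[OF o i t] this]
      have "L (v t i) - p t i * v t i + \<theta> * (0 - v t i)\<^sup>2 \<le> L 0" by simp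
      moreover have "0 \<le> \<theta> * (0 - v t i)\<^sup>2" using theta_pos by simp
      moreover have "p t i * v t i \<le> C8 * \<bar>v t i\<bar>"
      proof -
        have "p t i * v t i \<le> \<bar>p t i * v t i\<bar>" by (rule abs_ge_self)
        also have "\<dots> = \<bar>p t i\<bar> * \<bar>v t i\<bar>" by (rule abs_mult)
        also have "\<dots> \<le> C8 * \<bar>v t i\<bar>" using pt by (rule mult_right_mono) simp
        finally show ?thesis .
      qed
      moreover have "(C8 + 1) * \<bar>v t i\<bar> = C8 * \<bar>v t i\<bar> + \<bar>v t i\<bar>" by (simp add: algebra_simps)
      ultimately show "\<bar>v t i\<bar> \<le> L 0 + b8" using b8[of "v t i"] by linarith
    qed
  qed
qed

lemma free_orbit_exists:
  obtains C R0 where "R0 \<ge> 0"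
    "\<And>H K. interaction H K \<Longrightarrow> (\<And>i d. m \<le> H i d) \<Longrightarrow> (\<And>i. H i (\<delta> / 2) \<le> B) \<Longrightarrow>
      \<exists>x p v. orbit K UNIV x p v \<and>
        (\<forall>i\<in>{1..N}. (\<forall>t\<in>{0..T}. \<bar>v t i\<bar> \<le> R0) \<and> integral {0..T} (\<lambda>t. \<bar>K i (gap (x t) i)\<bar>) \<le> C)"
proof (rule a_priori_bounds[of m B])
  fix C R0
  assume ap: "\<And>H K R x p v. interaction H K \<Longrightarrow> (\<And>i d. m \<le> H i d) \<Longrightarrow> (\<And>i. H i (\<delta> / 2) \<le> B) \<Longrightarrow>
      (\<And>i. i \<in> {1..N} \<Longrightarrow> \<bar>mean i\<bar> + 1 \<le> R) \<Longrightarrow> orbit K {- R..R} x p v \<Longrightarrow>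
      (\<forall>i\<in>{1..N}. (\<forall>t\<in>{0..T}. \<bar>v t i\<bar> \<le> R0) \<and> integral {0..T} (\<lambda>t. \<bar>K i (gap (x t) i)\<bar>) \<le> C)"
  \<comment> \<open>Strictly above \<open>R0\<close>, so the velocity bound is inactive, and above
    every \<open>\<bar>mean i\<bar>\<close> by at least \<open>1\<close>, as existence and the a
    priori bounds require.\<close>
  define R where "R = \<bar>R0\<bar> + (\<Sum>i=1..N. \<bar>mean i\<bar>) + 1"
  have mean_R: "\<bar>mean i\<bar> + 1 \<le> R" if "i \<in> {1..N}" for i
  proof -
    have "\<bar>mean i\<bar> \<le> (\<Sum>i=1..N. \<bar>mean i\<bar>)" using that by (intro member_le_sum) auto
    then show ?thesis unfolding R_def by linarith
  qed
  have R0R: "\<bar>R0\<bar> < R"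
  proof -
    have "0 \<le> (\<Sum>i=1..N. \<bar>mean i\<bar>)" by (intro sum_nonneg) simp
    then show ?thesis unfolding R_def by linarith
  qed
  have data_R: "\<bar>xT i - x0 i\<bar> < R * T" if "i \<in> {1..N}" for i
  proof -
    have "\<bar>mean i\<bar> < R" using mean_R[OF that] by linarith
    then have "\<bar>mean i\<bar> * T < R * T" using T_pos by (rule mult_strict_right_mono)
    then show ?thesis unfolding mean_def using T_pos by simp
  qed
  show thesis
  proof (rule that[of "\<bar>R0\<bar>" C])
    fix H K
    assume inter: "interaction H K" and m: "\<And>i d. m \<le> H i d" and B: "\<And>i. H i (\<delta> / 2) \<le> B"
    obtain x p v where o: "orbit K {- R..R} x p v" by (rule orbit_exists[OF inter data_R])
    note bounds = ap[OF inter m B mean_R o]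
    have "orbit K UNIV x p v"
      unfolding orbit_def
    proof (intro ballI conjI)
      fix i assume i: "i \<in> {1..N}"
      show "x 0 i = x0 i" "x T i = xT i" "continuous_on {0..T} (\<lambda>t. v t i)"
        by (rule orbitD[OF o i])+
      fix t assume t: "t \<in> {0..T}"
      show "((\<lambda>t. x t i) has_real_derivative v t i) (at t within {0..T})"
        "((\<lambda>t. p t i) has_real_derivative force K i (x t) t) (at t within {0..T})"
        by (rule orbitD(4)[OF o i t], rule orbitD(5)[OF o i t])
      have "\<bar>v t i\<bar> \<le> R0" using bounds i t by blast
      then show "strong_minimizer L \<theta> UNIV (p t i) (v t i)"
        using R0R by (intro strong_minimizer_interior[OF orbitD(6)[OF o i t]]) linarith
    qed
    moreover have "\<forall>i\<in>{1..N}. (\<forall>t\<in>{0..T}. \<bar>v t i\<bar> \<le> \<bar>R0\<bar>) \<and> integral {0..T} (\<lambda>t. \<bar>K i (gap (x t) i)\<bar>) \<le> C"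
    proof (intro ballI conjI)
      fix i assume i: "i \<in> {1..N}"
      show "integral {0..T} (\<lambda>t. \<bar>K i (gap (x t) i)\<bar>) \<le> C" using bounds i by blast
      fix t assume "t \<in> {0..T}"
      then have "\<bar>v t i\<bar> \<le> R0" using bounds i by blast
      then show "\<bar>v t i\<bar> \<le> \<bar>R0\<bar>" by linarith
    qed
    ultimately show "\<exists>x p v. orbit K UNIV x p v \<and>
        (\<forall>i\<in>{1..N}. (\<forall>t\<in>{0..T}. \<bar>v t i\<bar> \<le> \<bar>R0\<bar>) \<and> integral {0..T} (\<lambda>t. \<bar>K i (gap (x t) i)\<bar>) \<le> C)"
      by (intro exI conjI)
  qed simp
qed

end

section \<open>Preservation of order without interaction\<close>

lemma increasing_within:
  fixes d :: "real \<Rightarrow> real"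
  assumes "\<And>t. t \<in> {0..T} \<Longrightarrow> (d has_real_derivative e t) (at t within {0..T})"
    and "0 \<le> r" "r \<le> s" "s \<le> T" and "\<And>t. r < t \<Longrightarrow> t < s \<Longrightarrow> 0 \<le> e t"
  shows "d r \<le> d s"
proof (cases "r = s")
  case False
  then have "r < s" using assms by simp
  have sub: "{r..s} \<subseteq> {0..T}" using assms by auto
  have "continuous_on {0..T} d" using assms(1) by (rule DERIV_continuous_on)
  then have c: "continuous_on {r..s} d" using sub by (rule continuous_on_subset)
  have der: "(d has_derivative (*) (e t)) (at t)" if t: "r < t" "t < s" for t
  proof -
    have "t \<in> {0..T}" using t sub by auto
    then have "(d has_real_derivative e t) (at t)"
      by (rule has_real_derivative_interior[OF assms(1)]) (use t assms in auto)
    then show ?thesis by (simp only: has_field_derivative_def)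
  qed
  obtain z where z: "r < z" "z < s" "d s - d r = e z * (s - r)"
    by (rule mvt[OF \<open>r < s\<close> c der])
  have "0 \<le> e z * (s - r)" using assms(5)[OF z(1,2)] \<open>r < s\<close> by simp
  then show ?thesis using z(3) by linarith
qed simp

text \<open>A gap \<open>d\<close> that is negative somewhere has a maximal interval of negativity.  There the momentum
  difference \<open>q\<close> is nonincreasing, so \<open>d\<close> is first nondecreasing and then nonincreasing, which
  contradicts its vanishing or positivity at both ends.\<close>

lemma gap_stays_nonneg:
  fixes d q :: "real \<Rightarrow> real"
  assumes d: "\<And>t. t \<in> {0..T} \<Longrightarrow> (d has_real_derivative e t) (at t within {0..T})"
    and q: "\<And>t. t \<in> {0..T} \<Longrightarrow> (q has_real_derivative r t) (at t within {0..T})"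
    and ends: "0 \<le> d 0" "0 \<le> d T"
    and r: "\<And>t. t \<in> {0..T} \<Longrightarrow> d t < 0 \<Longrightarrow> r t \<le> 0"
    and e: "\<And>t. t \<in> {0..T} \<Longrightarrow> 0 \<le> q t \<Longrightarrow> 0 \<le> e t" "\<And>t. t \<in> {0..T} \<Longrightarrow> q t \<le> 0 \<Longrightarrow> e t \<le> 0"
    and t: "t \<in> {0..T}"
  shows "0 \<le> d t"
proof (rule ccontr)
  assume "\<not> 0 \<le> d t"
  then have neg: "d t < 0" by simp
  have d_cont: "continuous_on {0..T} d" using d by (rule DERIV_continuous_on)
  have q_mono: "q s' \<le> q s" if "0 \<le> s" "s \<le> s'" "s' \<le> T" "\<And>u. s < u \<Longrightarrow> u < s' \<Longrightarrow> d u < 0" for s s'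
  proof -
    have "- q s \<le> - q s'"
    proof (rule increasing_within[of T "\<lambda>t. - q t" "\<lambda>t. - r t"])
      show "((\<lambda>t. - q t) has_real_derivative - r u) (at u within {0..T})" if "u \<in> {0..T}" for u
        by (rule DERIV_minus[OF q[OF that]])
      show "0 \<le> - r u" if "s < u" "u < s'" for u
        using r[of u] that \<open>0 \<le> s\<close> \<open>s' \<le> T\<close> \<open>\<And>u. s < u \<Longrightarrow> u < s' \<Longrightarrow> d u < 0\<close>[of u] by simp
    qed (use that in auto)
    then show ?thesis by simp
  qed
  show False
  \<comment> \<open>The sign of \<open>q\<close> at time \<open>t\<close> decides the side: if
    \<open>q t \<ge> 0\<close>, then \<open>d\<close> is nondecreasing from the last earlier
    nonnegative time up to \<open>t\<close>; otherwise it is nonincreasing up to the next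
    one.\<close>
  proof (cases "0 \<le> q t")
    case True
    have c: "continuous_on {0..t} d" by (rule continuous_on_subset[OF d_cont]) (use t in auto)
    define Z where "Z = {s \<in> {0..t}. 0 \<le> d s}"
    have "closed Z" unfolding Z_def
      using continuous_closed_preimage[OF c, of "{0..}"] by (simp add: vimage_def Int_def)
    moreover have "Z \<noteq> {}" "bdd_above Z" using ends t by (auto simp: Z_def bdd_above_def)
    ultimately have "Sup Z \<in> Z" by (intro closed_contains_Sup)
    define s where "s = Sup Z"
    have s: "0 \<le> s" "s \<le> t" "0 \<le> d s" using \<open>Sup Z \<in> Z\<close> by (auto simp: Z_def s_def)
    have neg_after: "d u < 0" if "s < u" "u \<le> t" for u
    proof (rule ccontr)
      assume "\<not> d u < 0"
      then have "u \<in> Z" using that s by (auto simp: Z_def)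
      then have "u \<le> s" unfolding s_def using \<open>bdd_above Z\<close> by (rule cSup_upper)
      then show False using that by simp
    qed
    have "d s \<le> d t"
    proof (rule increasing_within[of T d e])
      fix u assume u: "s < u" "u < t"
      have "q t \<le> q u" by (rule q_mono) (use u s t neg_after in auto)
      then show "0 \<le> e u" using True u s t by (intro e(1)) auto
    qed (use s t d in auto)
    then show False using s(3) neg by linarith
  next
    case False
    have c: "continuous_on {t..T} d" by (rule continuous_on_subset[OF d_cont]) (use t in auto)
    define Z where "Z = {s \<in> {t..T}. 0 \<le> d s}"
    have "closed Z" unfolding Z_def
      using continuous_closed_preimage[OF c, of "{0..}"] by (simp add: vimage_def Int_def)
    moreover have "Z \<noteq> {}" "bdd_below Z" using ends t by (auto simp: Z_def bdd_below_def)
    ultimately have "Inf Z \<in> Z" by (intro closed_contains_Inf)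
    define s where "s = Inf Z"
    have s: "t \<le> s" "s \<le> T" "0 \<le> d s" using \<open>Inf Z \<in> Z\<close> by (auto simp: Z_def s_def)
    have neg_before: "d u < 0" if "u < s" "t \<le> u" for u
    proof (rule ccontr)
      assume "\<not> d u < 0"
      then have "u \<in> Z" using that s by (auto simp: Z_def)
      then have "s \<le> u" unfolding s_def using \<open>bdd_below Z\<close> by (rule cInf_lower)
      then show False using that by simp
    qed
    have "- d t \<le> - d s"
    proof (rule increasing_within[of T "\<lambda>t. - d t" "\<lambda>t. - e t"])
      fix u assume u: "t < u" "u < s"
      have "q u \<le> q t" by (rule q_mono) (use u s t neg_before in auto)
      then have "e u \<le> 0" using False u s t by (intro e(2)) auto
      then show "0 \<le> - e u" by simp
    next
      show "((\<lambda>t. - d t) has_real_derivative - e u) (at u within {0..T})" if "u \<in> {0..T}" for u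
        by (rule DERIV_minus[OF d[OF that]])
    qed (use s t in auto)
    then show False using s(3) neg by linarith
  qed
qed

text \<open>Without interaction the momentum difference of two neighbours changes at the rate
  \<open>W (x (prev i)) - W (x i)\<close>, which is nonpositive where the gap is negative. All
  particles share the same \<open>L\<close>, so the order of their momenta is the order of their
  velocities.\<close>

lemma (in particle_data) free_gap_nonneg:
  assumes o: "orbit (\<lambda>_ _. 0) UNIV x p v" and i: "i \<in> {1..N}"
    and W: "\<And>t. t \<in> {0..T} \<Longrightarrow> gap (x t) i < 0 \<Longrightarrow> W (x t (prev i)) t \<le> W (x t i) t"
    and t: "t \<in> {0..T}"
  shows "0 \<le> gap (x t) i"
proof -
  let ?j = "prev i"
  have j: "?j \<in> {1..N}" by (rule prev_in[OF i])
  show ?thesis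
  proof (rule gap_stays_nonneg[where d = "\<lambda>t. gap (x t) i" and e = "\<lambda>t. v t i - v t ?j" and
      q = "\<lambda>t. p t i - p t ?j" and r = "\<lambda>t. W (x t ?j) t - W (x t i) t" and T = T])
    fix s assume s: "s \<in> {0..T}"
    show "((\<lambda>t. gap (x t) i) has_real_derivative v s i - v s ?j) (at s within {0..T})"
      unfolding gap_def
      using DERIV_add[OF DERIV_diff[OF orbitD(4)[OF o i s] orbitD(4)[OF o j s]] DERIV_const[of "\<kappa> i"]]
      by simp
    show "((\<lambda>t. p t i - p t ?j) has_real_derivative W (x s ?j) s - W (x s i) s) (at s within {0..T})"
      using DERIV_diff[OF orbitD(5)[OF o i s] orbitD(5)[OF o j s]] by (simp add: force_def)
    show "W (x s ?j) s - W (x s i) s \<le> 0" if "gap (x s) i < 0" using W[OF s that] by simp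
    have mono: "2 * \<theta> * (v s i - v s ?j)\<^sup>2 \<le> (p s i - p s ?j) * (v s i - v s ?j)"
      by (rule strong_minimizer_monotone[OF orbitD(6)[OF o i s] orbitD(6)[OF o j s]])
    \<comment> \<open>Strong monotonicity rules out opposite strict signs of the differences of
      momenta and velocities.\<close>
    have zero: "v s i - v s ?j = 0" if "(p s i - p s ?j) * (v s i - v s ?j) \<le> 0"
    proof -
      have "2 * \<theta> * (v s i - v s ?j)\<^sup>2 \<le> 0" using mono that by linarith
      then have "(v s i - v s ?j)\<^sup>2 \<le> 0" using theta_pos by (simp add: mult_le_0_iff)
      then show ?thesis by simp
    qed
    show "0 \<le> v s i - v s ?j" if "0 \<le> p s i - p s ?j"
    proof (rule ccontr)
      assume "\<not> 0 \<le> v s i - v s ?j"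
      then have "v s i - v s ?j \<le> 0" by simp
      with that have "(p s i - p s ?j) * (v s i - v s ?j) \<le> 0" by (rule mult_nonneg_nonpos)
      then show False using zero \<open>\<not> 0 \<le> v s i - v s ?j\<close> by simp
    qed
    show "v s i - v s ?j \<le> 0" if "p s i - p s ?j \<le> 0"
    proof (rule ccontr)
      assume "\<not> v s i - v s ?j \<le> 0"
      then have "0 \<le> v s i - v s ?j" by simp
      with that have "(p s i - p s ?j) * (v s i - v s ?j) \<le> 0" by (rule mult_nonpos_nonneg)
      then show False using zero \<open>\<not> v s i - v s ?j \<le> 0\<close> by simp
    qed
  next
    have "\<delta> \<le> gap x0 i" "\<delta> \<le> gap xT i" using gap_data[OF i] by (simp_all add: gap_def prev_def)
    moreover have "gap (x 0) i = gap x0 i" "gap (x T) i = gap xT i"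
      using orbitD(1,2)[OF o i] orbitD(1,2)[OF o j] by (simp_all add: gap_def)
    ultimately show "0 \<le> gap (x 0) i" "0 \<le> gap (x T) i" using delta_pos by linarith+
  qed (rule t)
qed

section \<open>Optimality and uniqueness of a calibrated orbit\<close>

context particle_data
begin

text \<open>The true interaction cost \<open>E\<close> is kept abstract. All that is used of it is
  that it equals \<open>H\<close> along the orbit and dominates \<open>H\<close> along a competitor,
  so an orbit of a modified interaction can be optimal for the true one.\<close>

definition cost_rate ::
    "((nat \<Rightarrow> real) \<Rightarrow> nat \<Rightarrow> ereal) \<Rightarrow> (real \<Rightarrow> nat \<Rightarrow> real) \<Rightarrow> (real \<Rightarrow> nat \<Rightarrow> real) \<Rightarrow> nat \<Rightarrow> real \<Rightarrow> ereal" where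
  "cost_rate E y u i s = ereal (L (u s i)) + E (y s) i - ereal (V (y s i) s)"

definition total_cost :: "((nat \<Rightarrow> real) \<Rightarrow> nat \<Rightarrow> ereal) \<Rightarrow> (real \<Rightarrow> nat \<Rightarrow> real) \<Rightarrow> ereal" where
  "total_cost E y = (\<Sum>i=1..N. extended_integral (lebesgue_on {0..T}) (cost_rate E y (velocity y) i))"

context
  fixes H K :: "nat \<Rightarrow> real \<Rightarrow> real" and x p v :: "real \<Rightarrow> nat \<Rightarrow> real"
    and E :: "(nat \<Rightarrow> real) \<Rightarrow> nat \<Rightarrow> ereal"
  assumes inter: "interaction H K" and o: "orbit K UNIV x p v"
    and E_orbit: "\<And>t i. t \<in> {0..T} \<Longrightarrow> i \<in> {1..N} \<Longrightarrow> E (x t) i = ereal (H i (gap (x t) i))"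
begin

definition rate :: "nat \<Rightarrow> real \<Rightarrow> real" where
  "rate i t = L (v t i) + H i (gap (x t) i) - V (x t i) t"

lemma rate_integrable: "i \<in> {1..N} \<Longrightarrow> integrable (lebesgue_on {0..T}) (rate i)"
  unfolding rate_def
  by (intro continuous_imp_integrable_lebesgue_on continuous_on_diff continuous_on_add continuous_on_L
      orbitD(3)[OF o] V_path_cont orbitD(7)[OF o] interactionD(1)[OF inter] gap_cont[OF orbitD(7)[OF o]])

lemma orbit_deriv:
  assumes "i \<in> {1..N}" "0 < t" "t < T"
  shows "((\<lambda>s. x s i) has_real_derivative v t i) (at t)"
  by (rule has_real_derivative_interior[OF orbitD(4)[OF o assms(1)]]) (use assms in auto)

lemma total_cost_orbit: "total_cost E x = ereal (\<Sum>i=1..N. integral\<^sup>L (lebesgue_on {0..T}) (rate i))"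
proof -
  have "extended_integral (lebesgue_on {0..T}) (cost_rate E x (velocity x) i)
      = ereal (integral\<^sup>L (lebesgue_on {0..T}) (rate i))" if i: "i \<in> {1..N}" for i
  proof -
    have "AE t in lebesgue_on {0..T}. cost_rate E x (velocity x) i t = ereal (rate i t)"
      using AE_interior
    proof eventually_elim
      case (elim t)
      have "velocity x t i = v t i"
        unfolding velocity_def by (rule DERIV_imp_deriv[OF orbit_deriv[OF i]]) (use elim in auto)
      then show ?case using E_orbit[OF _ i, of t] elim by (simp add: cost_rate_def rate_def)
    qed
    then show ?thesis
      using extended_integral_cong_AE extended_integral_ereal[OF rate_integrable[OF i]] by metis
  qed
  then show ?thesis unfolding total_cost_def by simp
qed

context
  fixes y :: "real \<Rightarrow> nat \<Rightarrow> real"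
  assumes E_y: "\<And>t i. t \<in> {0..T} \<Longrightarrow> i \<in> {1..N} \<Longrightarrow> ereal (H i (gap (y t) i)) \<le> E (y t) i"
    and y_ac: "\<And>i. i \<in> {1..N} \<Longrightarrow> absolutely_continuous_on {0..T} (\<lambda>t. y t i)"
    and y_ends: "\<And>i. i \<in> {1..N} \<Longrightarrow> y 0 i = x0 i \<and> y T i = xT i"
begin

definition dev :: "nat \<Rightarrow> real \<Rightarrow> real" where "dev i t = y t i - x t i"
text \<open>The square of the velocity difference may fail to be integrable for an absolutely
  continuous competitor. Truncation at \<open>1\<close> makes it integrable and keeps its
  zeros.\<close>

definition excess :: "nat \<Rightarrow> real \<Rightarrow> real" where "excess i t = min 1 ((deriv (dev i) t)\<^sup>2)"
definition linear_part :: "nat \<Rightarrow> real \<Rightarrow> real" where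
  "linear_part i t = K i (gap (x t) i) * (gap (y t) i - gap (x t) i) - W (x t i) t * (y t i - x t i)"

lemma dev_ac: "i \<in> {1..N} \<Longrightarrow> absolutely_continuous_on {0..T} (dev i)"
  unfolding dev_def using T_pos
  by (intro absolutely_continuous_on_diff y_ac absolutely_continuous_on_C1[OF orbitD(4)[OF o] orbitD(3)[OF o]]) auto

lemma dev_deriv:
  "i \<in> {1..N} \<Longrightarrow> AE t in lebesgue_on {0..T}. (dev i has_real_derivative deriv (dev i) t) (at t)"
  "i \<in> {1..N} \<Longrightarrow> integrable (lebesgue_on {0..T}) (deriv (dev i))"
  using absolutely_continuous_derivative[OF dev_ac T_pos] by auto

lemma dev_ends: "i \<in> {1..N} \<Longrightarrow> dev i 0 = 0" "i \<in> {1..N} \<Longrightarrow> dev i T = 0"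
  using y_ends orbitD(1,2)[OF o] by (simp_all add: dev_def)

lemma y_cont: "i \<in> {1..N} \<Longrightarrow> continuous_on {0..T} (\<lambda>t. y t i)"
  by (rule absolutely_continuous_on_continuous[OF y_ac])

lemma excess_integrable:
  assumes "i \<in> {1..N}" shows "integrable (lebesgue_on {0..T}) (excess i)"
proof (rule Bochner_Integration.integrable_bound)
  show "integrable (lebesgue_on {0..T}) (\<lambda>_. 1 :: real)"
    by (rule continuous_imp_integrable_lebesgue_on) (rule continuous_on_const)
  have "deriv (dev i) \<in> borel_measurable (lebesgue_on {0..T})"
    by (rule borel_measurable_integrable[OF dev_deriv(2)[OF assms]])
  then show "excess i \<in> borel_measurable (lebesgue_on {0..T})"
    unfolding excess_def by (intro borel_measurable_min borel_measurable_const borel_measurable_power)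
  have "0 \<le> excess i t" "excess i t \<le> 1" for t by (simp_all add: excess_def)
  then show "AE t in lebesgue_on {0..T}. norm (excess i t) \<le> norm (1 :: real)"
    by (intro AE_I2) (simp add: abs_of_nonneg)
qed

lemma linear_part_integrable: "i \<in> {1..N} \<Longrightarrow> integrable (lebesgue_on {0..T}) (linear_part i)"
  unfolding linear_part_def
  by (intro continuous_imp_integrable_lebesgue_on continuous_on_diff continuous_on_mult W_path_cont
      orbitD(7)[OF o] y_cont interactionD(2)[OF inter] gap_cont[OF orbitD(7)[OF o]] gap_cont[OF y_cont])

lemma momentum_parts:
  assumes i: "i \<in> {1..N}"
  shows "integrable (lebesgue_on {0..T}) (\<lambda>t. p t i * deriv (dev i) t)"
    "integral\<^sup>L (lebesgue_on {0..T}) (\<lambda>t. p t i * deriv (dev i) t)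
      + integral\<^sup>L (lebesgue_on {0..T}) (\<lambda>t. force K i (x t) t * dev i t) = 0"
  using absolutely_continuous_integration_by_parts[OF dev_ac[OF i] T_pos orbitD(5)[OF o i]
      orbit_force_cont[OF inter o i]] dev_ends[OF i] by simp_all

lemma sum_linear_part:
  "(\<Sum>i=1..N. integral\<^sup>L (lebesgue_on {0..T}) (linear_part i))
    = (\<Sum>i=1..N. integral\<^sup>L (lebesgue_on {0..T}) (\<lambda>t. force K i (x t) t * dev i t))"
proof -
  have "(\<Sum>i=1..N. integral\<^sup>L (lebesgue_on {0..T}) (linear_part i))
    = integral\<^sup>L (lebesgue_on {0..T}) (\<lambda>t. \<Sum>i=1..N. linear_part i t)"
    by (rule Bochner_Integration.integral_sum[symmetric]) (rule linear_part_integrable)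
  also have "(\<lambda>t. \<Sum>i=1..N. linear_part i t) = (\<lambda>t. \<Sum>i=1..N. force K i (x t) t * dev i t)"
    unfolding linear_part_def dev_def sum_force ..
  also have "integral\<^sup>L (lebesgue_on {0..T}) \<dots>
    = (\<Sum>i=1..N. integral\<^sup>L (lebesgue_on {0..T}) (\<lambda>t. force K i (x t) t * dev i t))"
  proof (rule Bochner_Integration.integral_sum)
    fix i assume i: "i \<in> {1..N}"
    show "integrable (lebesgue_on {0..T}) (\<lambda>t. force K i (x t) t * dev i t)"
      by (intro continuous_imp_integrable_lebesgue_on continuous_on_mult orbit_force_cont[OF inter o i]
          absolutely_continuous_on_continuous[OF dev_ac[OF i]])
  qed
  finally show ?thesis .
qed

text \<open>Three convexity inequalities are added at a fixed time: strong minimality of the orbit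
  velocity, the tangent inequality for \<open>H\<close>, and the one for \<open>V\<close>.\<close>

lemma lower_bound_AE:
  assumes i: "i \<in> {1..N}"
  shows "AE t in lebesgue_on {0..T}.
    ereal (rate i t + p t i * deriv (dev i) t + \<theta> * excess i t + linear_part i t)
      \<le> cost_rate E y (velocity y) i t"
  using dev_deriv(1)[OF i] AE_interior
proof eventually_elim
  case (elim t)
  then have t: "t \<in> {0..T}" by simp
  let ?r = "deriv (dev i) t"
  have "((\<lambda>s. dev i s + x s i) has_real_derivative ?r + v t i) (at t)"
    using elim by (intro DERIV_add orbit_deriv i) auto
  then have "((\<lambda>s. y s i) has_real_derivative ?r + v t i) (at t)" by (simp add: dev_def)
  then have vel: "velocity y t i = ?r + v t i" unfolding velocity_def by (rule DERIV_imp_deriv)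
  have "L (v t i) - p t i * v t i + \<theta> * (?r + v t i - v t i)\<^sup>2 \<le> L (?r + v t i) - p t i * (?r + v t i)"
    by (rule strong_minimizerD[OF orbitD(6)[OF o i t]]) simp
  then have "L (v t i) + p t i * ?r + \<theta> * ?r\<^sup>2 \<le> L (?r + v t i)" by (simp add: algebra_simps)
  moreover have "\<theta> * excess i t \<le> \<theta> * ?r\<^sup>2" unfolding excess_def using theta_pos by simp
  ultimately have L: "L (v t i) + p t i * ?r + \<theta> * excess i t \<le> L (?r + v t i)" by linarith
  have H: "H i (gap (x t) i) + K i (gap (x t) i) * (gap (y t) i - gap (x t) i) \<le> H i (gap (y t) i)"
    by (rule interactionD(4)[OF inter])
  have V: "V (y t i) t \<le> V (x t i) t + W (x t i) t * (y t i - x t i)" by (rule V_gradient[OF t])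
  have "ereal (rate i t + p t i * ?r + \<theta> * excess i t + linear_part i t)
      \<le> ereal (L (?r + v t i) + H i (gap (y t) i) - V (y t i) t)"
    unfolding rate_def linear_part_def using L H V by simp
  also have "\<dots> = ereal (L (?r + v t i)) + ereal (H i (gap (y t) i)) - ereal (V (y t i) t)" by simp
  also have "\<dots> \<le> cost_rate E y (velocity y) i t"
    unfolding cost_rate_def vel by (intro ereal_minus_mono add_mono E_y t i order_refl)
  finally show ?case .
qed

lemma total_cost_lower_bound:
  "ereal ((\<Sum>i=1..N. integral\<^sup>L (lebesgue_on {0..T}) (rate i))
      + \<theta> * (\<Sum>i=1..N. integral\<^sup>L (lebesgue_on {0..T}) (excess i))) \<le> total_cost E y"
proof -
  let ?M = "lebesgue_on {0..T}"
  define l where "l i t = rate i t + p t i * deriv (dev i) t + \<theta> * excess i t + linear_part i t" for i t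
  have ints: "integrable ?M (rate i)" "integrable ?M (\<lambda>t. p t i * deriv (dev i) t)"
    "integrable ?M (\<lambda>t. \<theta> * excess i t)" "integrable ?M (linear_part i)" if "i \<in> {1..N}" for i
    using rate_integrable[OF that] momentum_parts(1)[OF that] integrable_mult_right[OF excess_integrable[OF that]]
      linear_part_integrable[OF that] by auto
  have int: "integrable ?M (l i)" if "i \<in> {1..N}" for i
    unfolding l_def using ints[OF that] by (intro Bochner_Integration.integrable_add)
  have val: "integral\<^sup>L ?M (l i) = integral\<^sup>L ?M (rate i) + integral\<^sup>L ?M (\<lambda>t. p t i * deriv (dev i) t)
      + \<theta> * integral\<^sup>L ?M (excess i) + integral\<^sup>L ?M (linear_part i)" if "i \<in> {1..N}" for i
    unfolding l_def using ints[OF that]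
    by (simp add: Bochner_Integration.integral_add Bochner_Integration.integrable_add)
  \<comment> \<open>The first-order terms cancel after integration by parts: this is the
    Euler-Lagrange equation in weak form, tested with the deviation \<open>dev\<close>.\<close>
  have "(\<Sum>i=1..N. integral\<^sup>L ?M (\<lambda>t. p t i * deriv (dev i) t)) + (\<Sum>i=1..N. integral\<^sup>L ?M (linear_part i)) = 0"
    unfolding sum_linear_part sum.distrib[symmetric] by (rule sum.neutral) (use momentum_parts(2) in blast)
  moreover have "(\<Sum>i=1..N. integral\<^sup>L ?M (l i)) = (\<Sum>i=1..N. integral\<^sup>L ?M (rate i))
      + (\<Sum>i=1..N. integral\<^sup>L ?M (\<lambda>t. p t i * deriv (dev i) t))
      + \<theta> * (\<Sum>i=1..N. integral\<^sup>L ?M (excess i)) + (\<Sum>i=1..N. integral\<^sup>L ?M (linear_part i))"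
    unfolding sum_distrib_left sum.distrib[symmetric] by (rule sum.cong[OF refl val])
  ultimately have "(\<Sum>i=1..N. integral\<^sup>L ?M (rate i)) + \<theta> * (\<Sum>i=1..N. integral\<^sup>L ?M (excess i))
      = (\<Sum>i=1..N. integral\<^sup>L ?M (l i))" by linarith
  also have "ereal \<dots> = (\<Sum>i=1..N. ereal (integral\<^sup>L ?M (l i)))" by simp
  also have "\<dots> \<le> total_cost E y"
    unfolding total_cost_def
  proof (rule sum_mono)
    fix i assume i: "i \<in> {1..N}"
    have "AE t in ?M. ereal (l i t) \<le> cost_rate E y (velocity y) i t"
      unfolding l_def by (rule lower_bound_AE[OF i])
    from extended_integral_mono[OF this]
    show "ereal (integral\<^sup>L ?M (l i)) \<le> extended_integral ?M (cost_rate E y (velocity y) i)"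
      unfolding extended_integral_ereal[OF int[OF i]] .
  qed
  finally show ?thesis .
qed

lemma excess_nonneg: "0 \<le> integral\<^sup>L (lebesgue_on {0..T}) (excess i)"
  by (rule Bochner_Integration.integral_nonneg) (simp add: excess_def)

lemma orbit_optimal: "total_cost E x \<le> total_cost E y"
proof -
  have "0 \<le> \<theta> * (\<Sum>i=1..N. integral\<^sup>L (lebesgue_on {0..T}) (excess i))"
    using theta_pos by (intro mult_nonneg_nonneg sum_nonneg excess_nonneg) simp
  then show ?thesis
    unfolding total_cost_orbit by (intro order_trans[OF _ total_cost_lower_bound]) simp
qed

text \<open>If the costs do not differ, the total \<open>excess\<close> vanishes, so both
  trajectories have the same velocity almost everywhere, and they start at the same point.\<close>

lemma orbit_unique:
  assumes "total_cost E y \<le> total_cost E x" and i: "i \<in> {1..N}" and t: "t \<in> {0..T}"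
  shows "y t i = x t i"
proof -
  have "ereal ((\<Sum>i=1..N. integral\<^sup>L (lebesgue_on {0..T}) (rate i))
      + \<theta> * (\<Sum>i=1..N. integral\<^sup>L (lebesgue_on {0..T}) (excess i)))
      \<le> ereal (\<Sum>i=1..N. integral\<^sup>L (lebesgue_on {0..T}) (rate i))"
    using order_trans[OF total_cost_lower_bound assms(1)] unfolding total_cost_orbit .
  then have "\<theta> * (\<Sum>i=1..N. integral\<^sup>L (lebesgue_on {0..T}) (excess i)) \<le> 0" by simp
  then have "(\<Sum>i=1..N. integral\<^sup>L (lebesgue_on {0..T}) (excess i)) \<le> 0"
    using theta_pos by (simp add: mult_le_0_iff)
  moreover have "integral\<^sup>L (lebesgue_on {0..T}) (excess i)
      \<le> (\<Sum>i=1..N. integral\<^sup>L (lebesgue_on {0..T}) (excess i))"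
    using i excess_nonneg by (intro member_le_sum) auto
  ultimately have "integral\<^sup>L (lebesgue_on {0..T}) (excess i) = 0" using excess_nonneg[of i] by linarith
  then have "AE t in lebesgue_on {0..T}. excess i t = 0"
    using integral_nonneg_eq_0_iff_AE[OF excess_integrable[OF i]] by (simp add: excess_def)
  then have "AE t in lebesgue_on {0..T}. deriv (dev i) t = 0"
    by eventually_elim (auto simp: excess_def min_def split: if_splits)
  from absolutely_continuous_deriv_zero[OF dev_ac[OF i] this t] show ?thesis
    using dev_ends(1)[OF i] by (simp add: dev_def)
qed

end

end

end

subsection \<open>The interaction energy\<close>

locale interaction_energy =
  fixes N :: nat and G G' :: "real \<Rightarrow> real"
  assumes N_pos: "N \<ge> 1"
    and G_deriv: "\<And>r. r > 0 \<Longrightarrow> (G has_real_derivative G' r) (at r)"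
    and G'_cont: "continuous_on {0<..} G'"
    and G'_nonneg: "\<And>r. r > 0 \<Longrightarrow> 0 \<le> G' r"
    and G_gradient: "\<And>r s. r > 0 \<Longrightarrow> s > 0 \<Longrightarrow> G r + G' r * (s - r) \<le> G s"
    and G_cont: "continuous_on {0..} G"
begin

definition h :: "real \<Rightarrow> real" where "h d = G ((1 / real N) / d)"
definition h' :: "real \<Rightarrow> real" where "h' d = - (G' ((1 / real N) / d) * (1 / real N) / d\<^sup>2)"

lemma N0: "0 < real N" using N_pos by simp

lemma G_lower: assumes "r \<ge> 0" shows "G 0 \<le> G r"
proof (cases "r = 0")
  case False
  show ?thesis using assms
  proof (rule DERIV_nonneg_imp_increasing_open)
    show "\<exists>y. DERIV G x :> y \<and> 0 \<le> y" if "0 < x" "x < r" for x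
      using G_deriv[OF that(1)] G'_nonneg[OF that(1)] by blast
    show "continuous_on {0..r} G" by (rule continuous_on_subset[OF G_cont]) auto
  qed
qed simp

lemma h_lower: "d > 0 \<Longrightarrow> G 0 \<le> h d"
  unfolding h_def using N0 by (intro G_lower) simp

lemma h'_nonpos: "d > 0 \<Longrightarrow> h' d \<le> 0"
  unfolding h'_def using N0 G'_nonneg[of "(1 / real N) / d"] by simp

text \<open>\<open>h\<close> is convex as the composition of the nondecreasing convex
  \<open>G\<close> with the convex function \<open>(1 / real N) / d\<close>; the tangent
  inequalities of both are chained, with the sign of \<open>G'\<close> preserving the
  direction.\<close>

lemma h_gradient: assumes "d > 0" "e > 0" shows "h d + h' d * (e - d) \<le> h e"
proof -
  let ?r = "(1 / real N) / d" and ?s = "(1 / real N) / e"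
  have pos: "0 < ?r" "0 < ?s" using assms N0 by simp_all
  have "- ((1 / real N) / d\<^sup>2 * (e - d)) \<le> ?s - ?r"
  proof -
    have "?s - ?r + (1 / real N) / d\<^sup>2 * (e - d) = (1 / real N) * ((e - d)\<^sup>2 / (e * d\<^sup>2))"
      using assms N0 by (simp add: field_simps power2_eq_square)
    moreover have "0 \<le> (1 / real N) * ((e - d)\<^sup>2 / (e * d\<^sup>2))" using assms by simp
    ultimately show ?thesis by linarith
  qed
  then have "G' ?r * - ((1 / real N) / d\<^sup>2 * (e - d)) \<le> G' ?r * (?s - ?r)"
    using G'_nonneg[OF pos(1)] by (rule mult_left_mono)
  moreover have "G' ?r * - ((1 / real N) / d\<^sup>2 * (e - d)) = h' d * (e - d)"
    by (simp add: h'_def)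
  ultimately show ?thesis using G_gradient[OF pos] unfolding h_def by linarith
qed

lemma h'_mono: assumes "0 < d" "d \<le> e" shows "h' d \<le> h' e"
proof (cases "d = e")
  case False
  then have "0 < e - d" "0 < e" using assms by simp_all
  have "h d + h' d * (e - d) \<le> h e" "h e + h' e * (d - e) \<le> h d"
    using h_gradient assms \<open>0 < e\<close> by simp_all
  then have "h' d * (e - d) \<le> h' e * (e - d)" by (simp add: algebra_simps)
  then show ?thesis using \<open>0 < e - d\<close> by simp
qed simp

lemma h_cont: "continuous_on {0<..} h"
  unfolding h_def
  by (rule continuous_on_compose2[OF G_cont]) (use N0 in \<open>auto intro!: continuous_intros\<close>)

lemma h'_cont: "continuous_on {0<..} h'"
proof -
  have "continuous_on {0<..} (\<lambda>d. G' ((1 / real N) / d))"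
    by (rule continuous_on_compose2[OF G'_cont]) (use N0 in \<open>auto intro!: continuous_intros\<close>)
  then show ?thesis unfolding h'_def by (intro continuous_intros) auto
qed

text \<open>The interaction is continued below the gap \<open>\<epsilon>\<close> by its tangent, which keeps it convex and
  makes it finite on the whole line.\<close>

definition H_tan :: "real \<Rightarrow> real \<Rightarrow> real" where
  "H_tan \<epsilon> d = h (max d \<epsilon>) + h' \<epsilon> * (min d \<epsilon> - \<epsilon>)"
definition K_tan :: "real \<Rightarrow> real \<Rightarrow> real" where
  "K_tan \<epsilon> d = h' (max d \<epsilon>)"

context
  fixes \<epsilon> :: real assumes eps: "\<epsilon> > 0"
begin

lemma H_tan_eq: "\<epsilon> \<le> d \<Longrightarrow> H_tan \<epsilon> d = h d"
  by (simp add: H_tan_def max_def min_def)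

text \<open>Below \<open>\<epsilon>\<close> a tangent of a convex function lies under it. This makes
  the modified cost a lower bound for the true one at every competitor with positive gaps.\<close>

lemma H_tan_le: "0 < d \<Longrightarrow> H_tan \<epsilon> d \<le> h d"
  using h_gradient[OF eps, of d] by (cases "\<epsilon> \<le> d") (simp_all add: H_tan_def max_def min_def)

text \<open>This lower bound does not depend on \<open>\<epsilon>\<close>, as required for a priori
  constants chosen before \<open>\<epsilon>\<close>.\<close>

lemma H_tan_lower: "G 0 \<le> H_tan \<epsilon> d"
proof -
  have "G 0 \<le> h (max d \<epsilon>)" using eps by (intro h_lower) (simp add: less_max_iff_disj)
  moreover have "0 \<le> h' \<epsilon> * (min d \<epsilon> - \<epsilon>)" using h'_nonpos[OF eps] by (intro mult_nonpos_nonpos) auto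
  ultimately show ?thesis unfolding H_tan_def by linarith
qed

lemma K_tan_nonpos: "K_tan \<epsilon> d \<le> 0"
  unfolding K_tan_def using eps by (intro h'_nonpos) (simp add: less_max_iff_disj)

lemma H_tan_cont: "continuous_on UNIV (H_tan \<epsilon>)"
proof -
  have "continuous_on UNIV (\<lambda>d. h (max d \<epsilon>))"
    by (rule continuous_on_compose2[OF h_cont]) (use eps in \<open>auto intro!: continuous_intros simp: less_max_iff_disj\<close>)
  then show ?thesis unfolding H_tan_def by (intro continuous_intros)
qed

lemma K_tan_cont: "continuous_on UNIV (K_tan \<epsilon>)"
  unfolding K_tan_def
  by (rule continuous_on_compose2[OF h'_cont]) (use eps in \<open>auto intro!: continuous_intros simp: less_max_iff_disj\<close>)

lemma H_tan_gradient: "H_tan \<epsilon> d + K_tan \<epsilon> d * (e - d) \<le> H_tan \<epsilon> e"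
proof -
  consider "\<epsilon> \<le> d" "\<epsilon> \<le> e" | "\<epsilon> \<le> d" "e < \<epsilon>" | "d < \<epsilon>" "\<epsilon> \<le> e" | "d < \<epsilon>" "e < \<epsilon>" by linarith
  then show ?thesis
  proof cases
    case 1
    then have "H_tan \<epsilon> d = h d" "H_tan \<epsilon> e = h e" "K_tan \<epsilon> d = h' d"
      by (simp_all add: H_tan_eq K_tan_def max_absorb1)
    then show ?thesis using h_gradient[of d e] eps 1 by simp
  \<comment> \<open>In the second case the tangent at \<open>d\<close> is followed only down to
    \<open>\<epsilon>\<close>; from there on the slope \<open>h' \<epsilon>\<close>, which is at
    most \<open>h' d\<close>, takes over.\<close>
  next
    case 2
    have "h' d * (e - \<epsilon>) \<le> h' \<epsilon> * (e - \<epsilon>)"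
      using h'_mono[OF eps 2(1)] 2(2) by (intro mult_right_mono_neg) auto
    moreover have "h d + h' d * (\<epsilon> - d) \<le> h \<epsilon>" using h_gradient[of d \<epsilon>] eps 2 by simp
    moreover have "h' d * (e - d) = h' d * (e - \<epsilon>) + h' d * (\<epsilon> - d)" by (simp add: algebra_simps)
    moreover have "H_tan \<epsilon> e = h \<epsilon> + h' \<epsilon> * (e - \<epsilon>)" "H_tan \<epsilon> d = h d" "K_tan \<epsilon> d = h' d"
      using 2 by (simp_all add: H_tan_def K_tan_def max_def min_def)
    ultimately show ?thesis by (simp only:)
  next
    case 3
    have "h \<epsilon> + h' \<epsilon> * (e - \<epsilon>) \<le> h e" using h_gradient[of \<epsilon> e] eps 3 by simp
    moreover have "h' \<epsilon> * (e - d) = h' \<epsilon> * (e - \<epsilon>) - h' \<epsilon> * (d - \<epsilon>)" by (simp add: algebra_simps)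
    moreover have "H_tan \<epsilon> d = h \<epsilon> + h' \<epsilon> * (d - \<epsilon>)" "H_tan \<epsilon> e = h e" "K_tan \<epsilon> d = h' \<epsilon>"
      using 3 by (simp_all add: H_tan_def K_tan_def max_def min_def)
    ultimately show ?thesis by (simp only:)
  next
    case 4
    then show ?thesis by (simp add: H_tan_def K_tan_def max_def min_def algebra_simps)
  qed
qed

end

lemma G'_mono: assumes "0 < r" "r \<le> s" shows "G' r \<le> G' s"
proof (cases "r = s")
  case False
  then have "0 < s - r" "0 < s" using assms by simp_all
  have "G r + G' r * (s - r) \<le> G s" "G s + G' s * (r - s) \<le> G r"
    using G_gradient assms \<open>0 < s\<close> by simp_all
  then have "G' r * (s - r) \<le> G' s * (s - r)" by (simp add: algebra_simps)
  then show ?thesis using \<open>0 < s - r\<close> by simp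
qed simp

section \<open>Dichotomy between constant and unbounded \<open>G\<close>\<close>

lemma G_constant:
  assumes "\<And>r. r > 0 \<Longrightarrow> G' r = 0" "r \<ge> 0" shows "G r = G 0"
proof (cases "r = 0")
  case False
  have "- G 0 \<le> - G r"
  proof (rule DERIV_nonneg_imp_increasing_open[OF assms(2)])
    show "\<exists>y. ((\<lambda>x. - G x) has_real_derivative y) (at x) \<and> 0 \<le> y" if "0 < x" "x < r" for x
      using DERIV_minus[OF G_deriv[OF that(1)]] assms(1)[OF that(1)] by (intro exI[of _ "- G' x"]) simp
    show "continuous_on {0..r} (\<lambda>x. - G x)"
      by (rule continuous_on_minus[OF continuous_on_subset[OF G_cont]]) auto
  qed
  then show ?thesis using G_lower[OF assms(2)] by simp
qed simp

lemma extend_constant: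
  assumes "\<And>r. r > 0 \<Longrightarrow> G' r = 0"
  shows "extend_at_infinity G \<infinity> = ereal (G 0)"
proof -
  have "((\<lambda>\<rho>. ereal (G \<rho>)) \<longlongrightarrow> ereal (G 0)) at_top"
  proof (rule tendsto_eventually)
    show "\<forall>\<^sub>F \<rho> in at_top. ereal (G \<rho>) = ereal (G 0)"
      using eventually_ge_at_top[of 0]
    proof eventually_elim
      case (elim \<rho>)
      then show ?case using G_constant[OF assms, of \<rho>] by simp
    qed
  qed
  then show ?thesis by (simp add: extend_at_infinity_def tendsto_Lim)
qed

text \<open>One tangent of positive slope forces \<open>G\<close> to infinity. Touching particles
  then have infinite interaction cost, so the finite modified energy lies below it there as
  well.\<close>

lemma extend_unbounded:
  assumes r: "r > 0" "G' r > 0"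
  shows "extend_at_infinity G \<infinity> = \<infinity>"
proof -
  have "filterlim (\<lambda>s. G r + G' r * (s - r)) at_top at_top"
    using r by real_asymp
  then have "filterlim G at_top at_top"
  proof (rule filterlim_at_top_mono)
    show "\<forall>\<^sub>F s in at_top. G r + G' r * (s - r) \<le> G s"
      using eventually_gt_at_top[of 0] by eventually_elim (rule G_gradient[OF r(1)])
  qed
  then have "((\<lambda>\<rho>. ereal (G \<rho>)) \<longlongrightarrow> \<infinity>) at_top" by (simp add: tendsto_PInfty_eq_at_top)
  then show ?thesis by (simp add: extend_at_infinity_def tendsto_Lim)
qed

text \<open>\<open>G'\<close> is nondecreasing, so it is at least \<open>G' r\<close> at all
  densities above \<open>r\<close>; the factor \<open>1 / d\<^sup>2\<close> comes from
  differentiating \<open>(1 / real N) / d\<close>.\<close>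

lemma h'_blow_up:
  assumes r: "r > 0" and d: "0 < d" "d \<le> 1 / (real N * r)"
  shows "G' r / real N / d\<^sup>2 \<le> \<bar>h' d\<bar>"
proof -
  have "r \<le> (1 / real N) / d" using d r N0 by (simp add: field_simps)
  from G'_mono[OF r this] have "G' r \<le> G' ((1 / real N) / d)" .
  then have "G' r / real N / d\<^sup>2 \<le> G' ((1 / real N) / d) / real N / d\<^sup>2"
    using N0 by (intro divide_right_mono) auto
  also have "\<dots> = - h' d" by (simp add: h'_def)
  also have "\<dots> = \<bar>h' d\<bar>" using h'_nonpos[OF d(1)] by simp
  finally show ?thesis .
qed

text \<open>If the gap dropped to \<open>\<epsilon>\<close>, it would stay below \<open>(1 + \<Lambda>) \<epsilon>\<close> during a time \<open>\<epsilon>\<close>; the force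
  there is of order \<open>\<epsilon>\<^sup>-\<^sup>2\<close>, so that its integral would be of order \<open>1 / \<epsilon>\<close>.\<close>

lemma no_collision:
  assumes eps: "0 < \<epsilon>" "\<epsilon> \<le> T / 2" and \<Lambda>: "0 \<le> \<Lambda>" and r: "r > 0"
    and small: "\<epsilon> * (1 + \<Lambda>) \<le> 1 / (real N * r)" "C < G' r / real N / (\<epsilon> * (1 + \<Lambda>)\<^sup>2)"
    and d: "continuous_on {0..T} d"
    and lip: "\<And>s t. s \<in> {0..T} \<Longrightarrow> t \<in> {0..T} \<Longrightarrow> \<bar>d t - d s\<bar> \<le> \<Lambda> * \<bar>t - s\<bar>"
    and C: "integral {0..T} (\<lambda>t. \<bar>K_tan \<epsilon> (d t)\<bar>) \<le> C"
    and t: "t \<in> {0..T}"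
  shows "\<epsilon> < d t"
proof (rule ccontr)
  assume "\<not> \<epsilon> < d t"
  then have dt: "d t \<le> \<epsilon>" by simp
  \<comment> \<open>A window of length \<open>\<epsilon>\<close> that contains \<open>t\<close> and
    fits into \<open>{0..T}\<close>, to the right or to the left of \<open>t\<close>; possible
    because \<open>\<epsilon> \<le> T / 2\<close>.\<close>
  obtain a where a: "0 \<le> a" "a + \<epsilon> \<le> T" "a \<le> t" "t \<le> a + \<epsilon>"
  proof (cases "t \<le> T / 2")
    case True
    then show ?thesis using eps t by (intro that[of t]) auto
  next
    case False
    then show ?thesis using eps t by (intro that[of "t - \<epsilon>"]) auto
  qed
  \<comment> \<open>A lower bound for the force on the whole window, where the gap is at most
    \<open>\<epsilon> * (1 + \<Lambda>)\<close>. By the second part of \<open>small\<close>,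
    \<open>\<epsilon> * c\<close> exceeds \<open>C\<close>.\<close>
  define c where "c = G' r / real N / (\<epsilon> * (1 + \<Lambda>))\<^sup>2"
  have cont: "continuous_on {0..T} (\<lambda>t. \<bar>K_tan \<epsilon> (d t)\<bar>)"
    by (intro continuous_on_rabs continuous_on_compose2[OF K_tan_cont[OF eps(1)] d]) simp
  have sub: "{a..a + \<epsilon>} \<subseteq> {0..T}" using a by auto
  have "integral {a..a + \<epsilon>} (\<lambda>_. c) \<le> integral {a..a + \<epsilon>} (\<lambda>t. \<bar>K_tan \<epsilon> (d t)\<bar>)"
  proof (rule integral_le)
    show "(\<lambda>t. \<bar>K_tan \<epsilon> (d t)\<bar>) integrable_on {a..a + \<epsilon>}"
      by (rule integrable_continuous_real[OF continuous_on_subset[OF cont sub]])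
    fix s assume s: "s \<in> {a..a + \<epsilon>}"
    let ?e = "max (d s) \<epsilon>"
    have "s \<in> {0..T}" using s sub by blast
    have "\<Lambda> * \<bar>s - t\<bar> \<le> \<Lambda> * \<epsilon>" using s a \<Lambda> by (intro mult_left_mono) auto
    then have "d s \<le> \<epsilon> + \<Lambda> * \<epsilon>" using lip[OF t \<open>s \<in> {0..T}\<close>] dt by linarith
    moreover have "0 \<le> \<Lambda> * \<epsilon>" using \<Lambda> eps by simp
    ultimately have e: "0 < ?e" "?e \<le> \<epsilon> * (1 + \<Lambda>)" using eps by (auto simp: algebra_simps)
    have "c \<le> G' r / real N / ?e\<^sup>2"
      unfolding c_def using G'_nonneg[OF r] e N0 eps(1) \<Lambda>
      by (intro divide_left_mono power_mono mult_pos_pos zero_less_power divide_nonneg_pos) simp_all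
    also have "\<dots> \<le> \<bar>h' ?e\<bar>" by (rule h'_blow_up[OF r e(1)]) (use e(2) small(1) in linarith)
    finally show "c \<le> \<bar>K_tan \<epsilon> (d s)\<bar>" by (simp add: K_tan_def)
  qed (rule integrable_const_ivl)
  also have "\<dots> \<le> integral {0..T} (\<lambda>t. \<bar>K_tan \<epsilon> (d t)\<bar>)"
    by (intro integral_subset_le sub integrable_continuous_real continuous_on_subset[OF cont sub] cont) simp
  finally have "\<epsilon> * c \<le> C" using C eps by simp
  moreover have "\<epsilon> * c = G' r / real N / (\<epsilon> * (1 + \<Lambda>)\<^sup>2)"
    unfolding c_def using eps by (simp add: power2_eq_square)
  ultimately show False using small(2) by simp
qed

lemma small_gap_exists:
  assumes "r > 0" "G' r > 0" "T > 0" "\<Lambda> \<ge> 0" "\<delta> > 0"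
  obtains \<epsilon> where "0 < \<epsilon>" "\<epsilon> \<le> T / 2" "\<epsilon> \<le> \<delta>" "\<epsilon> * (1 + \<Lambda>) \<le> 1 / (real N * r)"
    "C < G' r / real N / (\<epsilon> * (1 + \<Lambda>)\<^sup>2)"
proof -
  have L1: "0 < 1 + \<Lambda>" using assms by simp
  \<comment> \<open>\<open>a\<close> and \<open>b\<close> solve the last two conditions for
    \<open>\<epsilon>\<close>; \<open>\<bar>C\<bar> + 1\<close> replaces \<open>C\<close>, whose
    sign is not known, and makes the inequality strict.\<close>
  define a where "a = 1 / (real N * r) / (1 + \<Lambda>)"
  define b where "b = G' r / real N / ((\<bar>C\<bar> + 1) * (1 + \<Lambda>)\<^sup>2)"
  have ab: "0 < a" "0 < b" using assms N0 L1 by (simp_all add: a_def b_def)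
  define \<epsilon> where "\<epsilon> = min (min (T / 2) \<delta>) (min a b)"
  have e: "0 < \<epsilon>" "\<epsilon> \<le> T / 2" "\<epsilon> \<le> \<delta>" "\<epsilon> \<le> a" "\<epsilon> \<le> b" using assms ab by (auto simp: \<epsilon>_def)
  show thesis
  proof (rule that[OF e(1-3)])
    have "\<epsilon> * (1 + \<Lambda>) \<le> a * (1 + \<Lambda>)" using e(4) L1 by (intro mult_right_mono) auto
    then show "\<epsilon> * (1 + \<Lambda>) \<le> 1 / (real N * r)" using L1 by (simp add: a_def)
    have "\<epsilon> * ((\<bar>C\<bar> + 1) * (1 + \<Lambda>)\<^sup>2) \<le> b * ((\<bar>C\<bar> + 1) * (1 + \<Lambda>)\<^sup>2)"
      using e(5) by (intro mult_right_mono) auto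
    also have "\<dots> = G' r / real N" using L1 by (simp add: b_def)
    finally have "(\<bar>C\<bar> + 1) * (\<epsilon> * (1 + \<Lambda>)\<^sup>2) \<le> G' r / real N" by (simp add: mult_ac)
    moreover have "0 < \<epsilon> * (1 + \<Lambda>)\<^sup>2" using e(1) L1 by simp
    ultimately have "\<bar>C\<bar> + 1 \<le> G' r / real N / (\<epsilon> * (1 + \<Lambda>)\<^sup>2)"
      by (subst pos_le_divide_eq)
    then show "C < G' r / real N / (\<epsilon> * (1 + \<Lambda>)\<^sup>2)" by linarith
  qed
qed

end

section \<open>Translation of the hypotheses on the data\<close>

lemma interaction_energy_of_coupling:
  assumes N: "N \<ge> 1" and g: "admissible_coupling g" and G: "is_interaction_energy g G"
    and convex: "convex_on {0<..} G"
  shows "interaction_energy N G (\<lambda>r. 1 / r\<^sup>2 * (LINT s:{0..r}|lborel. s * half_line_deriv g s))"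
    (is "interaction_energy N G ?G'")
proof
  have deriv: "(G has_real_derivative ?G' r) (at r)" if "r > 0" for r
    using G that unfolding is_interaction_energy_def by blast
  show "1 \<le> N" by (rule N)
  show "continuous_on {0..} G" using G unfolding is_interaction_energy_def by blast
  show "(G has_real_derivative ?G' r) (at r)" if "r > 0" for r by (rule deriv[OF that])
  show "continuous_on {0<..} ?G'"
  proof -
    \<comment> \<open>Continuity of the integral formula for the derivative is inherited from the
      continuous derivative in \<open>C1_on\<close>, by uniqueness of derivatives.\<close>
    obtain D where D: "\<And>z. z \<in> {0<..} \<Longrightarrow> (G has_derivative blinfun_apply (D z)) (at z within {0<..})"
      and D_cont: "continuous_on {0<..} D"
      using G unfolding is_interaction_energy_def C1_on_def by blast
    have eq: "blinfun_apply (D r) 1 = ?G' r" if r: "r \<in> {0<..}" for r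
    proof -
      have "(G has_derivative blinfun_apply (D r)) (at r)" using D[OF r] r by (simp add: at_within_open[of r "{0<..}"])
      moreover have "(G has_derivative (*) (?G' r)) (at r)"
        using deriv[of r] r unfolding has_field_derivative_def by simp
      ultimately have "blinfun_apply (D r) = (*) (?G' r)" by (rule has_derivative_unique)
      then show ?thesis by simp
    qed
    have "continuous_on {0<..} (\<lambda>r. blinfun_apply (D r) 1)" by (intro continuous_intros D_cont)
    then show ?thesis by (rule continuous_on_eq) (rule eq)
  qed
  show "0 \<le> ?G' r" if "r > 0" for r
  proof -
    obtain D where D: "\<And>z. z \<in> {0..} \<Longrightarrow> (g has_derivative blinfun_apply (D z)) (at z within {0..})"
      using g unfolding admissible_coupling_def C1_on_def by blast
    have mono: "mono_on {0..} g" using g unfolding admissible_coupling_def by blast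
    have nonneg: "0 \<le> half_line_deriv g s" if s: "s > 0" for s
    proof -
      have int: "s \<in> interior {0..}" using s by simp
      then have at: "at s within {0..} = at s" by (rule at_within_interior)
      then have "g differentiable (at s)" using D[of s] s unfolding differentiable_def by auto
      then obtain d where d: "(g has_real_derivative d) (at s)" by (auto simp: real_differentiable_def)
      then have "half_line_deriv g s = d"
        unfolding at by (simp add: has_real_derivative_iff_has_vector_derivative vector_derivative_at)
      then show ?thesis using mono_on_imp_deriv_nonneg[OF mono d int] by simp
    qed
    have "0 \<le> (LINT s:{0..r}|lborel. s * half_line_deriv g s)"
      unfolding set_lebesgue_integral_def
    proof (rule Bochner_Integration.integral_nonneg)
      fix s
      show "0 \<le> indicat_real {0..r} s *\<^sub>R (s * half_line_deriv g s)"
      \<comment> \<open>At \<open>s = 0\<close> the factor \<open>s\<close> vanishes, whatever the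
        one-sided derivative is; for \<open>s < 0\<close> the indicator does.\<close>
      proof (cases "s > 0")
        case True
        then show ?thesis using nonneg[OF True] by simp
      next
        case False
        then show ?thesis by (cases "s = 0") (auto simp: indicator_def)
      qed
    qed
    then show ?thesis by simp
  qed
  show "G r + ?G' r * (s - r) \<le> G s" if "r > 0" "s > 0" for r s
  proof -
    have "?G' r * (s - r) \<le> G s - G r"
    proof (rule convex_on_imp_above_tangent[OF convex])
      show "(G has_real_derivative ?G' r) (at r within {0<..})"
        by (rule has_field_derivative_at_within[OF deriv[OF that(1)]])
    qed (use that in \<open>auto simp: interior_open\<close>)
    then show ?thesis by linarith
  qed
qed

text \<open>\<open>W\<close> is the partial derivative in \<open>x\<close>, obtained by restricting
  the joint derivative to horizontal lines; its joint continuity comes from \<open>C1_on\<close>. On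
  the torus \<open>V\<close> is constant in \<open>x\<close>, so the tangent inequality is an
  equality with \<open>W = 0\<close>.\<close>

lemma potential_derivative:
  assumes "admissible_potential \<Omega> T V"
  obtains W where "continuous_on (UNIV \<times> {0..T}) (\<lambda>(x, t). V x t)"
    "continuous_on (UNIV \<times> {0..T}) (\<lambda>(x, t). W x t)"
    "\<And>x y t. t \<in> {0..T} \<Longrightarrow> V y t \<le> V x t + W x t * (y - x)"
    "\<And>x t. \<Omega> = Torus \<Longrightarrow> t \<in> {0..T} \<Longrightarrow> W x t = 0"
proof -
  obtain D where D: "\<And>z. z \<in> UNIV \<times> {0..T} \<Longrightarrow>
      ((\<lambda>(x, t). V x t) has_derivative blinfun_apply (D z)) (at z within UNIV \<times> {0..T})"
    and D_cont: "continuous_on (UNIV \<times> {0..T}) D"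
    using assms unfolding admissible_potential_def C1_on_def by blast
  define W where "W x t = blinfun_apply (D (x, t)) (1, 0)" for x t
  have deriv: "((\<lambda>x. V x t) has_real_derivative W x t) (at x)" if t: "t \<in> {0..T}" for x t
  proof -
    have e: "((\<lambda>x. (x, t)) has_derivative (\<lambda>h. (h, 0))) (at x within UNIV)"
      by (auto intro!: derivative_eq_intros)
    have "((\<lambda>(x, t). V x t) has_derivative blinfun_apply (D (x, t))) (at (x, t) within (\<lambda>x. (x, t)) ` UNIV)"
      by (rule has_derivative_subset[OF D]) (use t in auto)
    from has_derivative_in_compose[OF e this]
    have "((\<lambda>x. V x t) has_derivative (\<lambda>h. blinfun_apply (D (x, t)) (h, 0))) (at x)" by simp
    moreover have "(\<lambda>h. blinfun_apply (D (x, t)) (h, 0)) = (*) (W x t)"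
    proof
      fix h :: real
      have "blinfun_apply (D (x, t)) (h *\<^sub>R (1, 0)) = h *\<^sub>R W x t" unfolding W_def by (rule blinfun.scaleR_right)
      then show "blinfun_apply (D (x, t)) (h, 0) = W x t * h" by (simp add: mult.commute)
    qed
    ultimately show ?thesis unfolding has_field_derivative_def by simp
  qed
  have torus: "W x t = 0" if "\<Omega> = Torus" and t: "t \<in> {0..T}" for x t
  proof -
    have "(\<lambda>x. V x t) constant_on UNIV"
      using assms t unfolding admissible_potential_def \<open>\<Omega> = Torus\<close> by simp
    then obtain c where "\<forall>x\<in>UNIV. V x t = c" unfolding constant_on_def by blast
    then have "((\<lambda>x. c) has_real_derivative W x t) (at x)" using deriv[OF t, of x] by simp
    then show ?thesis using DERIV_const[of c] by (rule DERIV_unique)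
  qed
  have tangent: "V y t \<le> V x t + W x t * (y - x)" if t: "t \<in> {0..T}" for x y t
  proof (cases \<Omega>)
    case Real_Line
    then have "convex_on UNIV (\<lambda>x. - V x t)"
      using assms t unfolding admissible_potential_def concave_on_def by auto
    from convex_on_imp_above_tangent[OF this _ _ _ DERIV_minus[OF deriv[OF t, of x]], of y]
    have "- W x t * (y - x) \<le> - V y t - - V x t" by simp
    then show ?thesis by simp
  next
    case Torus
    have "(\<lambda>x. V x t) constant_on UNIV"
      using assms t unfolding admissible_potential_def Torus by simp
    then obtain c where "\<forall>x\<in>UNIV. V x t = c" unfolding constant_on_def by blast
    then show ?thesis using torus[OF Torus t, of x] by simp
  qed
  show thesis
  proof (rule that[OF _ _ tangent torus])
    show "continuous_on (UNIV \<times> {0..T}) (\<lambda>(x, t). V x t)"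
      using D by (rule has_derivative_continuous_on)
    have "continuous_on (UNIV \<times> {0..T}) (\<lambda>z. blinfun_apply (D z) (1, 0))"
      by (intro continuous_intros D_cont)
    then show "continuous_on (UNIV \<times> {0..T}) (\<lambda>(x, t). W x t)"
      by (simp add: W_def case_prod_beta)
  qed
qed

lemma initial_gaps:
  fixes x0 xT :: "nat \<Rightarrow> real"
  assumes N: "N \<ge> 1" and nt: "non_touching \<Omega> N x0" "non_touching \<Omega> N xT"
  obtains \<kappa> \<delta> where "\<delta> > 0"
    "\<And>i. i \<in> {1..N} \<Longrightarrow> \<delta> \<le> x0 i - x0 (if i = 1 then N else i - 1) + \<kappa> i \<and>
        \<delta> \<le> xT i - xT (if i = 1 then N else i - 1) + \<kappa> i"
    "\<Omega> = Torus \<Longrightarrow> \<kappa> 1 = 1" "\<And>i. i \<noteq> 1 \<Longrightarrow> \<kappa> i = 0"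
proof -
  \<comment> \<open>On the line, \<open>\<kappa> 1\<close> is so large that the dummy gap of the
    first particle is at least \<open>1\<close> at both times; all indices then satisfy the same
    positivity requirement.\<close>
  define \<kappa> where "\<kappa> i = (if i = 1 then (if \<Omega> = Torus then 1
      else 1 + \<bar>x0 1 - x0 N\<bar> + \<bar>xT 1 - xT N\<bar>) else 0)" for i :: nat
  define gp where "gp z i = z i - z (if i = 1 then N else i - 1) + \<kappa> i" for z :: "nat \<Rightarrow> real" and i
  have pos: "0 < gp z i" if z: "z \<in> {x0, xT}" and i: "i \<in> {1..N}" for z i
  proof -
    have lt: "left_neighbour \<Omega> N z i < ereal (z i)"
      using nt z i unfolding non_touching_def by auto
    show ?thesis
    proof (cases "i = 1")
      case False
      then show ?thesis using lt by (simp add: gp_def \<kappa>_def left_neighbour_def)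
    next
      case True
      show ?thesis
      proof (cases \<Omega>)
        case Real_Line
        then show ?thesis using True z by (auto simp: gp_def \<kappa>_def)
      next
        case Torus
        then show ?thesis using lt True by (simp add: gp_def \<kappa>_def left_neighbour_def)
      qed
    qed
  qed
  define S where "S = (\<lambda>i. min (gp x0 i) (gp xT i)) ` {1..N}"
  have S: "finite S" "S \<noteq> {}" using N by (auto simp: S_def)
  show thesis
  proof (rule that[of "Min S" \<kappa>])
    show "0 < Min S" using S pos by (simp add: S_def)
    fix i assume i: "i \<in> {1..N}"
    then have "Min S \<le> min (gp x0 i) (gp xT i)" using S(1) by (intro Min_le) (auto simp: S_def)
    then show "Min S \<le> x0 i - x0 (if i = 1 then N else i - 1) + \<kappa> i \<and>
        Min S \<le> xT i - xT (if i = 1 then N else i - 1) + \<kappa> i"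
      by (simp add: gp_def)
  qed (simp_all add: \<kappa>_def)
qed

lemma C1_onI:
  fixes f :: "real \<Rightarrow> real"
  assumes d: "\<And>t. t \<in> S \<Longrightarrow> (f has_real_derivative f' t) (at t within S)" and c: "continuous_on S f'"
  shows "C1_on S f"
  unfolding C1_on_def
proof (intro exI conjI ballI)
  show "continuous_on S (\<lambda>t. blinfun_mult_right (f' t))"
    by (rule bounded_linear.continuous_on[OF bounded_linear_blinfun_mult_right c])
  fix t assume "t \<in> S"
  from d[OF this] show "(f has_derivative blinfun_apply (blinfun_mult_right (f' t))) (at t within S)"
    by (simp add: has_field_derivative_def)
qed

section \<open>The chain on the line and on the torus\<close>

locale chain_model = particle_data L \<theta> N T V W \<kappa> x0 xT \<delta> Lmin + interaction_energy N G G'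
  for L \<theta> N T V W \<kappa> x0 xT \<delta> Lmin G G' +
  fixes \<Omega> :: spatial_domain
  assumes kappa: "\<Omega> = Torus \<Longrightarrow> \<kappa> 1 = 1" "\<And>i. i \<noteq> 1 \<Longrightarrow> \<kappa> i = 0"
    and W_torus: "\<And>x t. \<Omega> = Torus \<Longrightarrow> t \<in> {0..T} \<Longrightarrow> W x t = 0"
begin

definition E :: "(nat \<Rightarrow> real) \<Rightarrow> nat \<Rightarrow> ereal" where
  "E y i = extend_at_infinity G (ereal (1 / real N) / (ereal (y i) - left_neighbour \<Omega> N y i))"

text \<open>Marks the only index whose formal gap in the cyclic chain carries no
  interaction.\<close>

definition free_end :: "nat \<Rightarrow> bool" where "free_end i \<longleftrightarrow> \<Omega> = Real_Line \<and> i = 1"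

lemma action_eq: "action \<Omega> N T L G V y (velocity y) = ereal (1 / real N) * total_cost E y"
proof -
  have "running_cost \<Omega> N L G V y (velocity y) i = cost_rate E y (velocity y) i" for i
    by (simp add: fun_eq_iff running_cost_def cost_rate_def E_def)
  then show ?thesis by (simp add: action_def total_cost_def)
qed

lemma E_free_end: "free_end i \<Longrightarrow> E y i = ereal (G 0)"
  unfolding free_end_def E_def left_neighbour_def by (simp add: extend_at_infinity_def)

lemma not_free_end_1: "\<not> free_end 1 \<Longrightarrow> \<Omega> = Torus"
  unfolding free_end_def by (cases \<Omega>) simp_all

lemma minus_left_neighbour:
  assumes "\<not> free_end i" shows "ereal (y i) - left_neighbour \<Omega> N y i = ereal (gap y i)"
proof (cases "i = 1")
  case True
  then have "\<Omega> = Torus" using assms not_free_end_1 by simp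
  then show ?thesis using True kappa(1) by (simp add: left_neighbour_def gap_def prev_def)
next
  case False
  then show ?thesis using kappa(2) by (simp add: left_neighbour_def gap_def prev_def)
qed

lemma E_pos: assumes "\<not> free_end i" "0 < gap y i" shows "E y i = ereal (h (gap y i))"
  unfolding E_def minus_left_neighbour[OF assms(1)] using assms(2)
  by (simp add: extend_at_infinity_def h_def)

lemma E_zero: assumes "\<not> free_end i" "gap y i = 0" shows "E y i = extend_at_infinity G \<infinity>"
proof -
  have "ereal (1 / real N) / ereal 0 = \<infinity>" using N0 by (simp add: divide_ereal_def)
  then show ?thesis unfolding E_def minus_left_neighbour[OF assms(1)] assms(2) by simp
qed

lemma gap_config:
  assumes "y \<in> configurations \<Omega> N" "i \<in> {1..N}" "\<not> free_end i" shows "0 \<le> gap y i"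
proof (cases "i = 1")
  case True
  then have "\<Omega> = Torus" using assms not_free_end_1 by simp
  then show ?thesis using True assms(1) kappa(1) by (simp add: configurations_def gap_def prev_def)
next
  case False
  have "mono_on {1..N} y" using assms(1) by (simp add: configurations_def)
  then have "y (i - 1) \<le> y i" by (rule mono_onD) (use False assms(2) in auto)
  then show ?thesis using False kappa(2) by (simp add: gap_def prev_def)
qed

lemma configI:
  assumes "\<And>i. i \<in> {1..N} \<Longrightarrow> \<not> free_end i \<Longrightarrow> 0 \<le> gap y i"
  shows "y \<in> configurations \<Omega> N"
proof -
  have "y r \<le> y s" if "1 \<le> r" "r \<le> s" "s \<le> N" for r s
    using that(2,3)
  proof (induction s rule: dec_induct)
    case (step n)
    then show ?case using \<open>1 \<le> r\<close> assms[of "Suc n"] kappa(2)[of "Suc n"]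
      by (auto simp: free_end_def gap_def prev_def)
  qed simp
  then have "mono_on {1..N} y" by (intro mono_onI) auto
  moreover have "y N \<le> y 1 + 1" if "\<Omega> = Torus"
  proof -
    have "\<not> free_end 1" unfolding free_end_def using that by simp
    then have "0 \<le> gap y 1" using assms[of 1] N_pos by simp
    then show ?thesis using kappa(1)[OF that] by (simp add: gap_def prev_def)
  qed
  ultimately show ?thesis by (simp add: configurations_def)
qed

lemma W_antimono: assumes "t \<in> {0..T}" "x \<le> y" shows "W y t \<le> W x t"
proof (cases "x = y")
  case False
  then have "0 < y - x" using assms by simp
  have "V y t \<le> V x t + W x t * (y - x)" "V x t \<le> V y t + W y t * (x - y)"
    by (rule V_gradient[OF assms(1)])+
  then have "W y t * (y - x) \<le> W x t * (y - x)" by (simp add: algebra_simps)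
  then show ?thesis using \<open>0 < y - x\<close> by simp
qed simp

text \<open>The certificate consumed by \<open>orbit_optimal\<close> and
  \<open>orbit_unique\<close>: a finite convex energy below the true interaction on all
  configurations and equal to it along the orbit. Each of the two cases for \<open>G\<close> only
  has to produce one.\<close>

definition calibrated :: "(nat \<Rightarrow> real \<Rightarrow> real) \<Rightarrow> (nat \<Rightarrow> real \<Rightarrow> real) \<Rightarrow> (real \<Rightarrow> nat \<Rightarrow> real) \<Rightarrow>
    (real \<Rightarrow> nat \<Rightarrow> real) \<Rightarrow> (real \<Rightarrow> nat \<Rightarrow> real) \<Rightarrow> bool" where
  "calibrated H K x p v \<longleftrightarrow> interaction H K \<and> orbit K UNIV x p v \<and>
     (\<forall>t\<in>{0..T}. x t \<in> configurations \<Omega> N) \<and>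
     (\<forall>t\<in>{0..T}. \<forall>i\<in>{1..N}. E (x t) i = ereal (H i (gap (x t) i))) \<and>
     (\<forall>y\<in>configurations \<Omega> N. \<forall>i\<in>{1..N}. ereal (H i (gap y i)) \<le> E y i)"

text \<open>The energy is \<open>G 0\<close> on every configuration, also at touching particles, so
  gaps may vanish and only the order of the particles has to be preserved.\<close>

lemma calibrated_constant:
  assumes zero: "\<And>r. r > 0 \<Longrightarrow> G' r = 0"
  obtains H K x p v where "calibrated H K x p v"
proof -
  let ?H = "\<lambda>_ _ :: real. G 0" and ?K = "\<lambda>_ _ :: real. 0"
  have inter: "interaction ?H ?K" by (simp add: interaction_def)
  obtain x p v where o: "orbit ?K UNIV x p v"
    using free_orbit_exists[of "G 0" "G 0"] inter by (metis order_refl)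
  have gap_nonneg: "0 \<le> gap (x t) i" if i: "i \<in> {1..N}" and ne: "\<not> free_end i" and t: "t \<in> {0..T}" for i t
  proof (rule free_gap_nonneg[OF o i _ t])
    fix s assume s: "s \<in> {0..T}" and neg: "gap (x s) i < 0"
    show "W (x s (prev i)) s \<le> W (x s i) s"
    proof (cases \<Omega>)
      case Torus
      then show ?thesis using W_torus[OF _ s] by simp
    next
      case Real_Line
      then have "i \<noteq> 1" using ne unfolding free_end_def by simp
      then have "x s i \<le> x s (prev i)" using neg kappa(2)[of i] by (simp add: gap_def)
      then show ?thesis by (rule W_antimono[OF s])
    qed
  qed
  have E_const: "E y i = ereal (G 0)" if y: "y \<in> configurations \<Omega> N" and i: "i \<in> {1..N}" for y i
  proof (cases "free_end i")
    case False
    show ?thesis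
    proof (cases "gap y i = 0")
      case True
      then show ?thesis using E_zero[OF False] extend_constant[OF zero] by simp
    next
      case nz: False
      then have "0 < gap y i" using gap_config[OF y i False] by simp
      then show ?thesis using E_pos[OF False] G_constant[OF zero, of "1 / real N / gap y i"]
        by (simp add: h_def)
    qed
  qed (rule E_free_end)
  have conf: "x t \<in> configurations \<Omega> N" if "t \<in> {0..T}" for t
    using gap_nonneg that by (intro configI)
  have "calibrated ?H ?K x p v"
    unfolding calibrated_def using inter o conf E_const by simp
  then show thesis by (rule that)
qed

text \<open>The constants \<open>C\<close> and \<open>R0\<close> come first, from \<open>G 0\<close>
  and \<open>h (\<delta> / 2)\<close> alone; only then is \<open>\<epsilon>\<close> chosen. The
  requirement \<open>\<epsilon> \<le> \<delta> / 2\<close> keeps the value of the modified energy at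
  \<open>\<delta> / 2\<close> independent of \<open>\<epsilon>\<close>.\<close>

lemma calibrated_increasing:
  assumes r: "r > 0" "G' r > 0"
  obtains H K x p v where "calibrated H K x p v"
proof (rule free_orbit_exists[of "G 0" "h (\<delta> / 2)"])
  fix C R0 :: real
  assume R0: "0 \<le> R0"
    and ex: "\<And>H K. interaction H K \<Longrightarrow> (\<And>i d. G 0 \<le> H i d) \<Longrightarrow> (\<And>i. H i (\<delta> / 2) \<le> h (\<delta> / 2)) \<Longrightarrow>
      \<exists>x p v. orbit K UNIV x p v \<and>
        (\<forall>i\<in>{1..N}. (\<forall>t\<in>{0..T}. \<bar>v t i\<bar> \<le> R0) \<and> integral {0..T} (\<lambda>t. \<bar>K i (gap (x t) i)\<bar>) \<le> C)"
  \<comment> \<open>A gap is a difference of two positions with speed at most \<open>R0\<close>,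
    hence its Lipschitz constant \<open>2 * R0\<close>.\<close>
  obtain \<epsilon> where eps: "0 < \<epsilon>" "\<epsilon> \<le> T / 2" "\<epsilon> \<le> \<delta> / 2" "\<epsilon> * (1 + 2 * R0) \<le> 1 / (real N * r)"
    "C < G' r / real N / (\<epsilon> * (1 + 2 * R0)\<^sup>2)"
    by (rule small_gap_exists[OF r T_pos, of "2 * R0" "\<delta> / 2" C]) (use R0 delta_pos in auto)
  define H where "H i = (if free_end i then (\<lambda>_. G 0) else H_tan \<epsilon>)" for i
  define K where "K i = (if free_end i then (\<lambda>_. 0) else K_tan \<epsilon>)" for i
  have inter: "interaction H K"
    unfolding interaction_def H_def K_def
    using H_tan_cont[OF eps(1)] K_tan_cont[OF eps(1)] K_tan_nonpos[OF eps(1)] H_tan_gradient[OF eps(1)]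
    by simp
  have "\<exists>x p v. orbit K UNIV x p v \<and>
        (\<forall>i\<in>{1..N}. (\<forall>t\<in>{0..T}. \<bar>v t i\<bar> \<le> R0) \<and> integral {0..T} (\<lambda>t. \<bar>K i (gap (x t) i)\<bar>) \<le> C)"
  proof (rule ex[OF inter])
    show "G 0 \<le> H i d" for i d using H_tan_lower[OF eps(1)] by (simp add: H_def)
    show "H i (\<delta> / 2) \<le> h (\<delta> / 2)" for i
      using H_tan_eq[OF eps(1,3)] h_lower[of "\<delta> / 2"] delta_pos by (simp add: H_def)
  qed
  then obtain x p v where o: "orbit K UNIV x p v"
    and bound: "\<forall>i\<in>{1..N}. (\<forall>t\<in>{0..T}. \<bar>v t i\<bar> \<le> R0) \<and> integral {0..T} (\<lambda>t. \<bar>K i (gap (x t) i)\<bar>) \<le> C"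
    by blast
  have gap_big: "\<epsilon> < gap (x t) i" if i: "i \<in> {1..N}" and ne: "\<not> free_end i" and t: "t \<in> {0..T}" for i t
  proof (rule no_collision[where d = "\<lambda>t. gap (x t) i", OF eps(1,2) _ r(1) eps(4,5)])
    show "0 \<le> 2 * R0" using R0 by simp
    show "continuous_on {0..T} (\<lambda>t. gap (x t) i)" by (rule gap_cont[OF orbitD(7)[OF o] i])
    have "integral {0..T} (\<lambda>t. \<bar>K i (gap (x t) i)\<bar>) \<le> C" using bound i by blast
    then show "integral {0..T} (\<lambda>t. \<bar>K_tan \<epsilon> (gap (x t) i)\<bar>) \<le> C" using ne by (simp add: K_def)
    show "t \<in> {0..T}" by (rule t)
    fix s u assume su: "s \<in> {0..T}" "u \<in> {0..T}"
    have lip: "\<bar>x u j - x s j\<bar> \<le> R0 * \<bar>u - s\<bar>" if j: "j \<in> {1..N}" for j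
    proof -
      have "norm (x u j - x s j) \<le> R0 * norm (u - s)"
      proof (rule field_differentiable_bound[OF convex_real_interval(5) orbitD(4)[OF o j] _ su(2,1)])
        show "norm (v z j) \<le> R0" if "z \<in> {0..T}" for z using bound j that by simp
      qed
      then show ?thesis by simp
    qed
    show "\<bar>gap (x u) i - gap (x s) i\<bar> \<le> 2 * R0 * \<bar>u - s\<bar>"
      using lip[OF i] lip[OF prev_in[OF i]] unfolding gap_def by linarith
  qed
  have conf: "x t \<in> configurations \<Omega> N" if t: "t \<in> {0..T}" for t
  proof (rule configI)
    show "0 \<le> gap (x t) i" if "i \<in> {1..N}" "\<not> free_end i" for i using gap_big[OF that t] eps(1) by simp
  qed
  have E_x: "E (x t) i = ereal (H i (gap (x t) i))" if t: "t \<in> {0..T}" and i: "i \<in> {1..N}" for t i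
  proof (cases "free_end i")
    case True
    then show ?thesis by (simp add: E_free_end H_def)
  next
    case False
    have "\<epsilon> < gap (x t) i" by (rule gap_big[OF i False t])
    then show ?thesis using E_pos[OF False, of "x t"] H_tan_eq[OF eps(1)] eps(1) False by (simp add: H_def)
  qed
  have E_y: "ereal (H i (gap y i)) \<le> E y i" if y: "y \<in> configurations \<Omega> N" and i: "i \<in> {1..N}" for y i
  proof (cases "free_end i")
    case True
    then show ?thesis by (simp add: E_free_end H_def)
  next
    case False
    show ?thesis
    proof (cases "gap y i = 0")
      case True
      then show ?thesis using E_zero[OF False] extend_unbounded[OF r] by simp
    next
      case nz: False
      then have "0 < gap y i" using gap_config[OF y i False] by simp
      then show ?thesis using E_pos[OF False] H_tan_le[OF eps(1)] False by (simp add: H_def)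
    qed
  qed
  have "calibrated H K x p v"
    unfolding calibrated_def using inter o conf E_x E_y by simp
  then show thesis by (rule that)
qed

theorem unique_C1_solution:
  "\<exists>x u. C1_trajectory N T x \<and> Linfty_trajectory N T u \<and>
    is_solution \<Omega> N T L G V x0 xT x u \<and>
    (\<forall>y w. is_solution \<Omega> N T L G V x0 xT y w \<longrightarrow>
       (\<forall>t\<in>{0..T}. \<forall>i\<in>{1..N}. y t i = x t i) \<and>
       (AE t in lebesgue_on {0..T}. \<forall>i\<in>{1..N}. w t i = u t i))"
proof -
  have "\<exists>H K x p v. calibrated H K x p v"
  proof (cases "\<forall>r>0. G' r = 0")
    case True
    then obtain H K x p v where "calibrated H K x p v" using calibrated_constant by blast
    then show ?thesis by blast
  next
    case False
    \<comment> \<open>Since \<open>G'\<close> is nonnegative, failing to vanish somewhere means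
      being positive there.\<close>
    then obtain r where "r > 0" "G' r > 0" using G'_nonneg by (metis less_eq_real_def)
    then obtain H K x p v where "calibrated H K x p v" using calibrated_increasing by blast
    then show ?thesis by blast
  qed
  then obtain H K x p v where cal: "calibrated H K x p v" by blast
  then have inter: "interaction H K" and o: "orbit K UNIV x p v"
    and conf: "\<And>t. t \<in> {0..T} \<Longrightarrow> x t \<in> configurations \<Omega> N"
    and E_x: "\<And>t i. t \<in> {0..T} \<Longrightarrow> i \<in> {1..N} \<Longrightarrow> E (x t) i = ereal (H i (gap (x t) i))"
    and E_y: "\<And>y i. y \<in> configurations \<Omega> N \<Longrightarrow> i \<in> {1..N} \<Longrightarrow> ereal (H i (gap y i)) \<le> E y i"
    unfolding calibrated_def by simp_all
  let ?adm = "admissible_trajectories \<Omega> N T x0 xT"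
  have admD: "y t \<in> configurations \<Omega> N" "absolutely_continuous_on {0..T} (\<lambda>t. y t i)"
    "y 0 i = x0 i \<and> y T i = xT i" if "y \<in> ?adm" "t \<in> {0..T}" "i \<in> {1..N}" for y t i
    using that by (simp_all add: admissible_trajectories_def)
  have T0: "0 \<in> {0..T}" "1 \<in> {1..N}" using T_pos N_pos by simp_all
  have x_adm: "x \<in> ?adm"
    unfolding admissible_trajectories_def
  proof (intro CollectI conjI ballI)
    show "x t \<in> configurations \<Omega> N" if "t \<in> {0..T}" for t by (rule conf[OF that])
    fix i assume i: "i \<in> {1..N}"
    show "absolutely_continuous_on {0..T} (\<lambda>t. x t i)"
      by (rule absolutely_continuous_on_C1[OF orbitD(4)[OF o i] orbitD(3)[OF o i]]) (use T_pos in simp_all)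
    show "x 0 i = x0 i" "x T i = xT i" by (rule orbitD(1)[OF o i], rule orbitD(2)[OF o i])
  qed
  have opt: "total_cost E x \<le> total_cost E y" if y: "y \<in> ?adm" for y
  proof (rule orbit_optimal[OF inter o])
    show "E (x t) i = ereal (H i (gap (x t) i))" if "t \<in> {0..T}" "i \<in> {1..N}" for t i
      by (rule E_x[OF that])
    show "ereal (H i (gap (y t) i)) \<le> E (y t) i" if "t \<in> {0..T}" "i \<in> {1..N}" for t i
      by (rule E_y[OF admD(1)[OF y that] that(2)])
    show "absolutely_continuous_on {0..T} (\<lambda>t. y t i)" "y 0 i = x0 i \<and> y T i = xT i" if "i \<in> {1..N}" for i
      by (rule admD(2)[OF y T0(1) that], rule admD(3)[OF y T0(1) that])
  qed
  have unique: "y t i = x t i"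
    if y: "y \<in> ?adm" and le: "total_cost E y \<le> total_cost E x" and i: "i \<in> {1..N}" and t: "t \<in> {0..T}" for y t i
  proof (rule orbit_unique[OF inter o _ _ _ _ le i t])
    show "E (x t) i = ereal (H i (gap (x t) i))" if "t \<in> {0..T}" "i \<in> {1..N}" for t i
      by (rule E_x[OF that])
    show "ereal (H i (gap (y t) i)) \<le> E (y t) i" if "t \<in> {0..T}" "i \<in> {1..N}" for t i
      by (rule E_y[OF admD(1)[OF y that] that(2)])
    show "absolutely_continuous_on {0..T} (\<lambda>t. y t i)" "y 0 i = x0 i \<and> y T i = xT i" if "i \<in> {1..N}" for i
      by (rule admD(2)[OF y T0(1) that], rule admD(3)[OF y T0(1) that])
  qed
  have scale: "(ereal (1 / real N) * a \<le> ereal (1 / real N) * b) \<longleftrightarrow> a \<le> b" for a b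
    using N0 by (simp add: ereal_mult_le_mult_iff)
  have minimizer: "is_minimizer \<Omega> N T L G V x0 xT x"
    unfolding is_minimizer_def action_eq scale using x_adm opt by blast
  have x_deriv: "((\<lambda>s. x s i) has_real_derivative v t i) (at t)" if "i \<in> {1..N}" "0 < t" "t < T" for i t
    by (rule has_real_derivative_interior[OF orbitD(4)[OF o that(1)]]) (use that in simp_all)
  have sol: "is_solution \<Omega> N T L G V x0 xT x v"
    unfolding is_solution_def
  proof (rule conjI[OF minimizer])
    show "AE t in lebesgue_on {0..T}. \<forall>i\<in>{1..N}. ((\<lambda>s. x s i) has_real_derivative v t i) (at t)"
      using AE_interior by eventually_elim (use x_deriv in blast)
  qed
  have C1: "C1_trajectory N T x"
    unfolding C1_trajectory_def
  proof
    fix i assume i: "i \<in> {1..N}"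
    show "C1_on {0..T} (\<lambda>t. x t i)" by (rule C1_onI[OF orbitD(4)[OF o i] orbitD(3)[OF o i]])
  qed
  have Linfty: "Linfty_trajectory N T v"
    unfolding Linfty_trajectory_def
  proof (intro ballI conjI)
    fix i assume i: "i \<in> {1..N}"
    have c: "continuous_on {0..T} (\<lambda>t. v t i)" by (rule orbitD(3)[OF o i])
    show "(\<lambda>t. v t i) \<in> borel_measurable (lebesgue_on {0..T})"
      by (rule borel_measurable_integrable[OF continuous_imp_integrable_lebesgue_on[OF c]])
    have "compact ((\<lambda>t. v t i) ` {0..T})" by (rule compact_continuous_image[OF c]) simp
    from compact_imp_bounded[OF this] obtain C where "\<forall>y\<in>(\<lambda>t. v t i) ` {0..T}. norm y \<le> C"
      unfolding bounded_iff by blast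
    then have "\<bar>v t i\<bar> \<le> C" if "t \<in> {0..T}" for t using that by simp
    then show "\<exists>C. AE t in lebesgue_on {0..T}. \<bar>v t i\<bar> \<le> C"
      by (intro exI[of _ C] AE_I2) simp
  qed
  have uniq: "(\<forall>t\<in>{0..T}. \<forall>i\<in>{1..N}. y t i = x t i) \<and>
      (AE t in lebesgue_on {0..T}. \<forall>i\<in>{1..N}. w t i = v t i)"
    if s: "is_solution \<Omega> N T L G V x0 xT y w" for y w
  proof
    have y: "y \<in> ?adm" and le: "total_cost E y \<le> total_cost E x"
      using s x_adm unfolding is_solution_def is_minimizer_def action_eq scale by blast+
    have eq: "y t i = x t i" if "i \<in> {1..N}" "t \<in> {0..T}" for i t by (rule unique[OF y le that])
    then show "\<forall>t\<in>{0..T}. \<forall>i\<in>{1..N}. y t i = x t i" by blast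
    have "AE t in lebesgue_on {0..T}. \<forall>i\<in>{1..N}. ((\<lambda>s. y s i) has_real_derivative w t i) (at t)"
      using s unfolding is_solution_def by blast
    then show "AE t in lebesgue_on {0..T}. \<forall>i\<in>{1..N}. w t i = v t i"
      using AE_interior
    proof eventually_elim
      case (elim t)
      show ?case
      proof
        fix i assume i: "i \<in> {1..N}"
        have "((\<lambda>s. y s i) has_real_derivative w t i) (at t)" using elim(1) i by blast
        moreover have "((\<lambda>s. y s i) has_real_derivative v t i) (at t)"
        \<comment> \<open>The trajectories agree on a whole neighbourhood of an interior time, so
          the derivative of \<open>y\<close> is that of \<open>x\<close>; this settles uniqueness of
          the second component.\<close>
        proof (rule has_field_derivative_transform_within_open[OF x_deriv[OF i]])
          show "x s i = y s i" if "s \<in> {0<..<T}" for s using eq[OF i, of s] that by simp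
        qed (use elim(2) in simp_all)
        ultimately show "w t i = v t i" by (rule DERIV_unique)
      qed
    qed
  qed
  show ?thesis using C1 Linfty sol uniq by blast
qed

end

theorem proposition3p2:
  fixes \<Omega> :: spatial_domain and N :: nat and T :: real
    and g G L :: "real \<Rightarrow> real" and V :: "real \<Rightarrow> real \<Rightarrow> real"
    and q \<alpha> \<beta> :: real and x0 xT :: "nat \<Rightarrow> real"
  assumes "N \<ge> 1" and "T > 0"
    and "admissible_coupling g"
    and "is_interaction_energy g G" and "convex_on {0<..} G"
    and "admissible_potential \<Omega> T V"
    and "admissible_lagrangian L"
    and "q > 1" and "\<alpha> > 0" and "\<beta> \<ge> 0"
    and "\<And>x y u. x < y \<Longrightarrow> pair_cost N L G x y u \<ge> \<alpha> * \<bar>u\<bar> powr q - \<beta>"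
    and "x0 \<in> configurations \<Omega> N" and "xT \<in> configurations \<Omega> N"
    and "non_touching \<Omega> N x0" and "non_touching \<Omega> N xT"
  shows "\<exists>x u.
    C1_trajectory N T x \<and> Linfty_trajectory N T u \<and>
    is_solution \<Omega> N T L G V x0 xT x u \<and>
    (\<forall>y v. is_solution \<Omega> N T L G V x0 xT y v \<longrightarrow>
       (\<forall>t\<in>{0..T}. \<forall>i\<in>{1..N}. y t i = x t i) \<and>
       (AE t in lebesgue_on {0..T}. \<forall>i\<in>{1..N}. v t i = u t i))"
proof -
  let ?G' = "\<lambda>r. 1 / r\<^sup>2 * (LINT s:{0..r}|lborel. s * half_line_deriv g s)"
  have L_cont: "continuous_on UNIV L" and L_bdd: "bdd_below (range L)" and L_conv: "uniformly_convex L"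
    using assms(7) unfolding admissible_lagrangian_def by simp_all
  obtain \<theta> where theta: "\<theta> > 0" "\<forall>u v. \<forall>c\<in>{0..1}. L (c * u + (1 - c) * v)
      \<le> c * L u + (1 - c) * L v - \<theta> * c * (1 - c) * (u - v)\<^sup>2"
    using L_conv unfolding uniformly_convex_def by blast
  obtain Lmin where Lmin: "\<And>u. Lmin \<le> L u" using L_bdd unfolding bdd_below_def by blast
  show ?thesis
  proof (rule potential_derivative[OF assms(6)], rule initial_gaps[OF assms(1,14,15)])
    fix W \<kappa> and \<delta> :: real
    assume V: "continuous_on (UNIV \<times> {0..T}) (\<lambda>(x, t). V x t)"
      and W: "continuous_on (UNIV \<times> {0..T}) (\<lambda>(x, t). W x t)"
      and VW: "\<And>x y t. t \<in> {0..T} \<Longrightarrow> V y t \<le> V x t + W x t * (y - x)"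
      and W0: "\<And>x t. \<Omega> = Torus \<Longrightarrow> t \<in> {0..T} \<Longrightarrow> W x t = 0"
      and delta: "0 < \<delta>"
      and gaps: "\<And>i. i \<in> {1..N} \<Longrightarrow> \<delta> \<le> x0 i - x0 (if i = 1 then N else i - 1) + \<kappa> i \<and>
        \<delta> \<le> xT i - xT (if i = 1 then N else i - 1) + \<kappa> i"
      and kappa1: "\<Omega> = Torus \<Longrightarrow> \<kappa> 1 = 1" and kappa0: "\<And>i. i \<noteq> 1 \<Longrightarrow> \<kappa> i = 0"
    interpret interaction_energy N G ?G'
      by (rule interaction_energy_of_coupling[OF assms(1,3,4,5)])
    interpret chain_model L \<theta> N T V W \<kappa> x0 xT \<delta> Lmin G ?G' \<Omega>
    proof unfold_locales
      show "0 < \<theta>" by (rule theta(1))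
      show "continuous_on UNIV L" by (rule L_cont)
      show "L (c * u + (1 - c) * v) \<le> c * L u + (1 - c) * L v - \<theta> * c * (1 - c) * (u - v)\<^sup>2"
        if "c \<in> {0..1}" for u v c using theta(2) that by blast
      show "1 \<le> N" "0 < T" by (rule assms(1), rule assms(2))
      show "Lmin \<le> L u" for u by (rule Lmin)
      show "continuous_on (UNIV \<times> {0..T}) (\<lambda>(x, t). V x t)" by (rule V)
      show "continuous_on (UNIV \<times> {0..T}) (\<lambda>(x, t). W x t)" by (rule W)
      show "V y t \<le> V x t + W x t * (y - x)" if "t \<in> {0..T}" for x y t by (rule VW[OF that])
      show "0 < \<delta>" by (rule delta)
      show "\<delta> \<le> x0 i - x0 (if i = 1 then N else i - 1) + \<kappa> i \<and>
        \<delta> \<le> xT i - xT (if i = 1 then N else i - 1) + \<kappa> i" if "i \<in> {1..N}" for i by (rule gaps[OF that])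
      show "\<kappa> 1 = 1" if "\<Omega> = Torus" by (rule kappa1[OF that])
      show "\<kappa> i = 0" if "i \<noteq> 1" for i by (rule kappa0[OF that])
      show "W x t = 0" if "\<Omega> = Torus" "t \<in> {0..T}" for x t by (rule W0[OF that])
    qed
    show ?thesis by (rule unique_C1_solution)
  qed
qed

end
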